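(* There exist a finitely generated group $G$, a space $X$ on which $G$ acts (on the right) and a symmetric non-degenerate probability measure $\mu$ on $G$ such that (i) $G$ acts amenably and transitively on $X$; (ii) the random walk induced by $\mu$ on the Schreier graph of the action is transient; (iii) the random walk induced by $\mu$ on the Schreier graph does not (almost surely) converge towards an end of the graph. In particular, an example is provided by the action of $G=F$, Thompson's group, on the set $X=\mathbb{Z}[\frac12]\cap(0,1)$ of dyadic rationals, where $\mu$ is the measure of Juschenko and Zheng, a symmetric non-degenerate probability measure on $F$ whose induced random walk on $X$ has trivial Poisson boundary.
   Context: A probability measure $\mu$ on $G$ is symmetric if $\mu(g)=\mu(g^{-1})$ for all $g$, and non-degenerate if its support generates $G$ as a semigroup. An action of $G$ on $X$ is amenable if there is a $G$-invariant mean on $X$. Schreier graph: for a finite generating set $S$ of $G$, the Schreier graph of a transitive action is the undirected graph with vertex set $X$ and edges $\{(x,x.s): x\in X,\ s\in S\}$. Induced random walk: let $(h_n)$ be i.i.d. with law $\mu$, let $g_0=e$ and $g_{n+1}=g_nh_n$. For a starting point $\mathfrak{o}\in X$ the induced random walk is $(\mathfrak{o}.g_n)_n$; it is the Markov chain with kernel $P(x,y)=\sum_{g\in G:\,x.g=y}\mu(g)$. It is transient if, for any point, almost every trajectory visits that point only finitely often. Its Poisson boundary, when the chain is irreducible, is trivial if and only if every bounded $P$-harmonic function on $X$ is constant. Ends: for a finite set $K\subset X$ let $\pi_0(X\setminus K)$ be the set of connected components of the subgraph obtained by deleting the vertices of $K$ and the edges adjacent to them. For $K_1\subseteq K_2$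 there is a natural map $\pi_0(X\setminus K_2)\to\pi_0(X\setminus K_1)$ sending a component to the component containing it. The end space is the inverse limit $\varprojlim_K\pi_0(X\setminus K)$ over finite $K\subset X$. A trajectory $(x_n)$ converges towards an end $(U_K)_K$ if for every finite $K\subset X$ one has $x_n\in U_K$ for all sufficiently large $n$. Thompson's group $F$ is the group of orientation-preserving piecewise linear self-isomorphisms of $[0,1]$ with slopes that are integer powers of $2$, with finitely many break points, all in $\mathbb{Z}[\frac12]=\{a2^b: a,b\in\mathbb{Z}\}$. It is finitely generated and acts transitively on $\mathbb{Z}[\frac12]\cap(0,1)$ by $x.g=g(x)$, with product such that $x.(gh)=(x.g).h$. Juschenko and Zheng proved (Theorem 3 of "Infinitely supported Liouville measures of Schreier graphs", Groups, Geometry, and Dynamics 12 (2018)) that there exists a symmetric non-degenerate probability measure on $F$ such that the induced random walk on the dyadic rationals has trivial Poisson boundary. *)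

theory Defs
  imports "HOL-Probability.Probability" "HOL-Algebra.Generated_Groups"
begin

section \<open>Groups, right actions and measures on groups\<close>

definition finite_generating_set :: "('g, 'm) monoid_scheme \<Rightarrow> 'g set \<Rightarrow> bool" where
  "finite_generating_set G S \<longleftrightarrow> finite S \<and> S \<subseteq> carrier G \<and> generate G S = carrier G"

definition finitely_generated_group :: "('g, 'm) monoid_scheme \<Rightarrow> bool" where
  "finitely_generated_group G \<longleftrightarrow> group G \<and> (\<exists>S. finite_generating_set G S)"

text \<open>The library's \<open>group_action\<close> is a left action; \<open>act x g\<close> below stands for \<open>x.g\<close>.\<close>

definition right_action :: "('g, 'm) monoid_scheme \<Rightarrow> 'x set \<Rightarrow> ('x \<Rightarrow> 'g \<Rightarrow> 'x) \<Rightarrow> bool" where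
  "right_action G X act \<longleftrightarrow>
     (\<forall>x\<in>X. \<forall>g\<in>carrier G. act x g \<in> X) \<and>
     (\<forall>x\<in>X. act x \<one>\<^bsub>G\<^esub> = x) \<and>
     (\<forall>x\<in>X. \<forall>g\<in>carrier G. \<forall>h\<in>carrier G. act x (g \<otimes>\<^bsub>G\<^esub> h) = act (act x g) h)"

definition transitive_action :: "('g, 'm) monoid_scheme \<Rightarrow> 'x set \<Rightarrow> ('x \<Rightarrow> 'g \<Rightarrow> 'x) \<Rightarrow> bool" where
  "transitive_action G X act \<longleftrightarrow> (\<forall>x\<in>X. \<forall>y\<in>X. \<exists>g\<in>carrier G. act x g = y)"

definition bounded_fun_on :: "'x set \<Rightarrow> ('x \<Rightarrow> real) \<Rightarrow> bool" where
  "bounded_fun_on X f \<longleftrightarrow> (\<exists>C. \<forall>x\<in>X. \<bar>f x\<bar> \<le> C)"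

text \<open>
  A mean on \<open>X\<close> is a normalised positive linear functional on the bounded functions on \<open>X\<close>.
  The functions are total on the ambient type; by linearity and positivity the value
  of the mean depends only on their restrictions to \<open>X\<close>.
\<close>

definition is_mean :: "'x set \<Rightarrow> (('x \<Rightarrow> real) \<Rightarrow> real) \<Rightarrow> bool" where
  "is_mean X m \<longleftrightarrow>
     (\<forall>f g. bounded_fun_on X f \<longrightarrow> bounded_fun_on X g \<longrightarrow> m (\<lambda>x. f x + g x) = m f + m g) \<and>
     (\<forall>c f. bounded_fun_on X f \<longrightarrow> m (\<lambda>x. c * f x) = c * m f) \<and>
     (\<forall>f. bounded_fun_on X f \<longrightarrow> (\<forall>x\<in>X. 0 \<le> f x) \<longrightarrow> 0 \<le> m f) \<and>
     m (\<lambda>x. 1) = 1"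

definition amenable_action :: "('g, 'm) monoid_scheme \<Rightarrow> 'x set \<Rightarrow> ('x \<Rightarrow> 'g \<Rightarrow> 'x) \<Rightarrow> bool" where
  "amenable_action G X act \<longleftrightarrow>
     (\<exists>m. is_mean X m \<and>
          (\<forall>g\<in>carrier G. \<forall>f. bounded_fun_on X f \<longrightarrow> m (\<lambda>x. f (act x g)) = m f))"

text \<open>
  A probability measure on a countable group is rendered as a \<open>pmf\<close> with support in the carrier.
\<close>

definition prob_measure_on :: "('g, 'm) monoid_scheme \<Rightarrow> 'g pmf \<Rightarrow> bool" where
  "prob_measure_on G \<mu> \<longleftrightarrow> set_pmf \<mu> \<subseteq> carrier G"

definition symmetric_measure :: "('g, 'm) monoid_scheme \<Rightarrow> 'g pmf \<Rightarrow> bool" where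
  "symmetric_measure G \<mu> \<longleftrightarrow> (\<forall>g\<in>carrier G. pmf \<mu> g = pmf \<mu> (inv\<^bsub>G\<^esub> g))"

inductive_set semigroup_generated :: "('g, 'm) monoid_scheme \<Rightarrow> 'g set \<Rightarrow> 'g set"
  for G :: "('g, 'm) monoid_scheme" and A :: "'g set" where
  incl: "a \<in> A \<Longrightarrow> a \<in> semigroup_generated G A"
| mult: "a \<in> semigroup_generated G A \<Longrightarrow> b \<in> semigroup_generated G A \<Longrightarrow>
         a \<otimes>\<^bsub>G\<^esub> b \<in> semigroup_generated G A"

definition non_degenerate :: "('g, 'm) monoid_scheme \<Rightarrow> 'g pmf \<Rightarrow> bool" where
  "non_degenerate G \<mu> \<longleftrightarrow> semigroup_generated G (set_pmf \<mu>) = carrier G"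


section \<open>The induced random walk\<close>

text \<open>The law of the i.i.d. increments \<open>h\<^sub>0, h\<^sub>1, \<dots>\<close>.\<close>

definition increments :: "'g pmf \<Rightarrow> (nat \<Rightarrow> 'g) measure" where
  "increments \<mu> = (\<Pi>\<^sub>M i\<in>UNIV. measure_pmf \<mu>)"

primrec walk :: "('g, 'm) monoid_scheme \<Rightarrow> (nat \<Rightarrow> 'g) \<Rightarrow> nat \<Rightarrow> 'g" where
  "walk G h 0 = \<one>\<^bsub>G\<^esub>"
| "walk G h (Suc n) = walk G h n \<otimes>\<^bsub>G\<^esub> h n"

definition induced_walk ::
  "('g, 'm) monoid_scheme \<Rightarrow> ('x \<Rightarrow> 'g \<Rightarrow> 'x) \<Rightarrow> 'x \<Rightarrow> (nat \<Rightarrow> 'g) \<Rightarrow> nat \<Rightarrow> 'x" where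
  "induced_walk G act x\<^sub>0 h n = act x\<^sub>0 (walk G h n)"

definition transient_walk ::
  "('g, 'm) monoid_scheme \<Rightarrow> 'x set \<Rightarrow> ('x \<Rightarrow> 'g \<Rightarrow> 'x) \<Rightarrow> 'g pmf \<Rightarrow> bool" where
  "transient_walk G X act \<mu> \<longleftrightarrow>
     (\<forall>x\<^sub>0\<in>X. \<forall>y\<in>X. AE h in increments \<mu>. finite {n. induced_walk G act x\<^sub>0 h n = y})"

text \<open>\<open>pmf (kernel act \<mu> x) y\<close> is \<open>P(x,y)\<close>, the sum of \<open>\<mu>(g)\<close> over all \<open>g\<close> with \<open>x.g = y\<close>.\<close>

definition kernel :: "('x \<Rightarrow> 'g \<Rightarrow> 'x) \<Rightarrow> 'g pmf \<Rightarrow> 'x \<Rightarrow> 'x pmf" where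
  "kernel act \<mu> x = map_pmf (act x) \<mu>"

definition harmonic_on :: "'x set \<Rightarrow> ('x \<Rightarrow> 'g \<Rightarrow> 'x) \<Rightarrow> 'g pmf \<Rightarrow> ('x \<Rightarrow> real) \<Rightarrow> bool" where
  "harmonic_on X act \<mu> f \<longleftrightarrow> (\<forall>x\<in>X. f x = measure_pmf.expectation (kernel act \<mu> x) f)"

text \<open>
  Triviality of the Poisson boundary of the induced chain, in the form valid for irreducible
  chains; the chain is irreducible whenever \<open>\<mu>\<close> is non-degenerate and the action transitive.
\<close>

definition trivial_poisson_boundary :: "'x set \<Rightarrow> ('x \<Rightarrow> 'g \<Rightarrow> 'x) \<Rightarrow> 'g pmf \<Rightarrow> bool" where
  "trivial_poisson_boundary X act \<mu> \<longleftrightarrow>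
     (\<forall>f. bounded_fun_on X f \<longrightarrow> harmonic_on X act \<mu> f \<longrightarrow> (\<exists>c. \<forall>x\<in>X. f x = c))"


section \<open>Schreier graphs and their ends\<close>

definition schreier_adj :: "'x set \<Rightarrow> ('x \<Rightarrow> 'g \<Rightarrow> 'x) \<Rightarrow> 'g set \<Rightarrow> ('x \<times> 'x) set" where
  "schreier_adj X act S =
     {(x, y). x \<in> X \<and> y \<in> X \<and> (\<exists>s\<in>S. act x s = y \<or> act y s = x)}"

definition components_outside ::
  "'x set \<Rightarrow> ('x \<Rightarrow> 'g \<Rightarrow> 'x) \<Rightarrow> 'g set \<Rightarrow> 'x set \<Rightarrow> 'x set set" where
  "components_outside X act S K =
     (let V = X - K in V // {(x, y). x \<in> V \<and> y \<in> V \<and> (x, y) \<in> (schreier_adj X act S \<inter> V \<times> V)\<^sup>*})"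

text \<open>
  The inverse limit: the component of \<open>X - K\<^sub>1\<close> containing the component \<open>U K\<^sub>2\<close> of
  \<open>X - K\<^sub>2\<close> has to be \<open>U K\<^sub>1\<close>.
\<close>

definition ends :: "'x set \<Rightarrow> ('x \<Rightarrow> 'g \<Rightarrow> 'x) \<Rightarrow> 'g set \<Rightarrow> ('x set \<Rightarrow> 'x set) set" where
  "ends X act S =
     {U \<in> (\<Pi>\<^sub>E K\<in>{K. finite K \<and> K \<subseteq> X}. components_outside X act S K).
        \<forall>K\<^sub>1 K\<^sub>2. finite K\<^sub>2 \<longrightarrow> K\<^sub>2 \<subseteq> X \<longrightarrow> K\<^sub>1 \<subseteq> K\<^sub>2 \<longrightarrow> U K\<^sub>2 \<subseteq> U K\<^sub>1}"

definition converges_to_end :: "'x set \<Rightarrow> (nat \<Rightarrow> 'x) \<Rightarrow> ('x set \<Rightarrow> 'x set) \<Rightarrow> bool" where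
  "converges_to_end X x U \<longleftrightarrow>
     (\<forall>K. finite K \<longrightarrow> K \<subseteq> X \<longrightarrow> (\<forall>\<^sub>F n in sequentially. x n \<in> U K))"

definition walk_converges_to_ends ::
  "('g, 'm) monoid_scheme \<Rightarrow> 'x set \<Rightarrow> ('x \<Rightarrow> 'g \<Rightarrow> 'x) \<Rightarrow> 'g set \<Rightarrow> 'g pmf \<Rightarrow> 'x \<Rightarrow> bool" where
  "walk_converges_to_ends G X act S \<mu> x\<^sub>0 \<longleftrightarrow>
     (AE h in increments \<mu>. \<exists>U\<in>ends X act S. converges_to_end X (induced_walk G act x\<^sub>0 h) U)"


section \<open>Thompson's group F and its action on the dyadic rationals\<close>

definition dyadics :: "real set" where
  "dyadics = {of_int a * 2 powi b | a b :: int. True}"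

text \<open>
  A self-map of \<open>[0,1]\<close> is represented by its extension to the real line by the identity, so that
  composition of total functions is the group operation. Below, \<open>b 0 < \<dots> < b n\<close> is a
  dyadic subdivision of \<open>[0,1]\<close> containing all break points.
\<close>

definition thompson_F_set :: "(real \<Rightarrow> real) set" where
  "thompson_F_set =
     {f. bij_betw f {0..1} {0..1} \<and> strict_mono_on {0..1} f \<and> (\<forall>x. x \<notin> {0..1} \<longrightarrow> f x = x) \<and>
         (\<exists>(n::nat) (b::nat \<Rightarrow> real).
            b 0 = 0 \<and> b n = 1 \<and> (\<forall>i\<le>n. b i \<in> dyadics) \<and> (\<forall>i<n. b i < b (Suc i)) \<and>
            (\<forall>i<n. \<exists>(k::int) c. \<forall>x\<in>{b i..b (Suc i)}. f x = 2 powi k * x + c))}"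

text \<open>The product \<open>g h\<close> is ``first \<open>g\<close>, then \<open>h\<close>'', so that \<open>x.g = g x\<close> is a right action.\<close>

definition thompson_F :: "(real \<Rightarrow> real) monoid" where
  "thompson_F = \<lparr>carrier = thompson_F_set, mult = (\<lambda>g h. h \<circ> g), one = id\<rparr>"

definition dyadic_points :: "real set" where
  "dyadic_points = dyadics \<inter> {0<..<1}"

definition thompson_act :: "real \<Rightarrow> (real \<Rightarrow> real) \<Rightarrow> real" where
  "thompson_act x g = g x"

end

theory Submission
  imports Defs
begin

text \<open>
  The walk is driven by \<open>\<mu> = \<Sum>\<^sub>k \<nu>\<^sub>k / 2 ^ (k + 1)\<close>.  Here \<open>\<nu>\<^sub>0\<close> is uniform on a symmetric generating set and
  \<open>\<nu>\<^sub>k\<close>, for \<open>k \<ge> 1\<close>, is uniform on the powers \<open>g\<^sup>j\<close> with \<open>\<bar>j\<bar> \<le> N\<close>, where \<open>g\<close> and \<open>N\<close> are chosen after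
  \<open>\<nu>\<^sub>0, \<dots>, \<nu>\<^bsub>k-1\<^esub>\<close>.  The element is \<open>g x = min (2x) (min (x + d) ((1 + x)/2))\<close> with \<open>d = 1 / 2 ^ L\<close> small.  It moves
  every point of \<open>(0,1)\<close> up, so its orbits there are infinite; it puts all multiples of \<open>d\<close> in \<open>(0,1)\<close>
  into one orbit; and it doubles near \<open>0\<close>, so that the backward orbit of \<open>1/2\<close> ends up in the ray
  \<open>A = {1/2, 1/4, 1/8, \<dots>}\<close>, while the forward orbit avoids \<open>A\<close> (\<open>dyadic_points_in_one_orbit\<close>).

  A single jump distributed as \<open>\<nu>\<^sub>k\<close> therefore does three things (\<open>exists_mixing\<close>).  Since orbits are
  infinite, it spreads every starting law thinly, which bounds \<open>P(X\<^sub>n = y)\<close> by a summable sequence and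
  makes the walk transient.  Since any two points of a prescribed finite set are in the same orbit, it
  nearly merges the laws of the walks started at them, so bounded harmonic functions are constant.
  And it leads to \<open>A\<close> and to the complement of \<open>A\<close> with probability about \<open>1/2\<close> each, so every
  starting point has a uniformly positive chance to hit either set and both are visited infinitely
  often.  The prescribed finite set contains everything that can be reached by \<open>4 ^ (m + 1)\<close> jumps with
  index at most \<open>m\<close>; the first jump with larger index comes after a geometric time with mean
  \<open>2 ^ (m + 1)\<close>, hence in time with probability tending to one as \<open>m\<close> grows (\<open>late_jump_bound\<close>, \<open>backward_iteration\<close>).

  The ray \<open>A\<close> is almost invariant: near \<open>0\<close> an element of \<open>F\<close> is multiplication by a power of \<open>2\<close>, so
  it moves only finitely many points into or out of \<open>A\<close>.  Hence finitely many vertices \<open>K\<close> separate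
  \<open>A\<close> from its complement in the Schreier graph, for any finite generating set.  Convergence to an end
  would confine the walk eventually to one component of the graph outside \<open>K\<close>, that is, to one side.

  The same behaviour near \<open>0\<close> gives amenability of the action: averages along the ray are
  asymptotically invariant, and a cluster point of them is an invariant mean.  The group structure and
  the finite generation of \<open>F\<close> come from tree pairs: every element of \<open>F\<close> carries some iterated halving
  of \<open>[0,1]\<close> affinely to another one, and every iterated halving is carried to a right comb by a
  product of the elements \<open>thompson_x i\<close>, which all lie in the group generated by the first two.
\<close>

section \<open>Dyadic subdivisions of the unit interval\<close>

text \<open>
  Subdivisions with \<open>n\<close> intervals are encoded by their points \<open>P 0, \<dots>, P n\<close>; the values of \<open>P\<close> beyond
  \<open>n\<close> are arbitrary.  Prescribing values along the segments, and not slopes, makes the notion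
  transitive and symmetric without any division.
\<close>

definition affine_between :: "(real \<Rightarrow> real) \<Rightarrow> nat \<Rightarrow> (nat \<Rightarrow> real) \<Rightarrow> (nat \<Rightarrow> real) \<Rightarrow> bool" where
  "affine_between f n P Q \<longleftrightarrow>
     (\<forall>i<n. \<forall>t\<in>{0..1}. f (P i + t * (P (Suc i) - P i)) = Q i + t * (Q (Suc i) - Q i))"

definition halve :: "nat \<Rightarrow> (nat \<Rightarrow> real) \<Rightarrow> nat \<Rightarrow> real" where
  "halve i P j = (if j \<le> i then P j else if j = Suc i then (P i + P (Suc i)) / 2 else P (j - 1))"

inductive dyadic_subdivision :: "nat \<Rightarrow> (nat \<Rightarrow> real) \<Rightarrow> bool" where
  unit: "dyadic_subdivision 1 real"
| halve: "dyadic_subdivision n P \<Longrightarrow> i < n \<Longrightarrow> dyadic_subdivision (Suc n) (halve i P)"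

text \<open>
  Weaker than being an iterated halving: the lengths are powers of two, the positions are arbitrary.
  This is what the image of a fine grid under an element of \<open>F\<close> visibly satisfies.
\<close>

definition dyadic_steps :: "nat \<Rightarrow> nat \<Rightarrow> (nat \<Rightarrow> real) \<Rightarrow> bool" where
  "dyadic_steps L n P \<longleftrightarrow> P 0 = 0 \<and> P n = 1 \<and> (\<forall>i<n. \<exists>l\<le>L. P (Suc i) - P i = 1 / 2 ^ l)"

lemma halve_cases:
  assumes "j < Suc n" "i < n"
  obtains "j < i" "halve i P j = P j" "halve i P (Suc j) = P (Suc j)"
  | "j = i" "halve i P j = P i" "halve i P (Suc j) = (P i + P (Suc i)) / 2"
  | "j = Suc i" "halve i P j = (P i + P (Suc i)) / 2" "halve i P (Suc j) = P (Suc i)"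
  | k where "j = Suc k" "i < k" "k < n" "halve i P j = P k" "halve i P (Suc j) = P (Suc k)"
proof -
  consider "j < i" | "j = i" | "j = Suc i" | "j > Suc i" by linarith
  then show thesis
  proof cases
    case 4
    then obtain k where "j = Suc k" by (cases j) auto
    with 4 assms that(4)[of k] show thesis by (auto simp: halve_def)
  qed (use that(1-3) in \<open>auto simp: halve_def\<close>)
qed

lemma affine_between_halve:
  assumes "affine_between f n P Q" "i < n"
  shows "affine_between f (Suc n) (halve i P) (halve i Q)"
  unfolding affine_between_def
proof (intro allI impI ballI)
  fix j and t :: real assume j: "j < Suc n" and t: "t \<in> {0..1}"
  have A: "f (P k + s * (P (Suc k) - P k)) = Q k + s * (Q (Suc k) - Q k)"
    if "k < n" "s \<in> {0..1}" for k s
    using assms that by (auto simp: affine_between_def)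
  consider "j < i" | "j = i" | "j = Suc i" | k where "j = Suc k" "i < k" "k < n"
    using halve_cases[OF j assms(2), of P thesis] by auto
  then show "f (halve i P j + t * (halve i P (Suc j) - halve i P j)) =
        halve i Q j + t * (halve i Q (Suc j) - halve i Q j)"
  proof cases
    case 1 then show ?thesis using A[of j t] assms t by (simp add: halve_def)
  next
    case 2 then show ?thesis using A[of i "t/2"] assms t
      by (simp add: halve_def field_simps)
  next
    case 3
    have "f (P i + (1/2 + t/2) * (P (Suc i) - P i)) = Q i + (1/2 + t/2) * (Q (Suc i) - Q i)"
      using A[of i "1/2 + t/2"] assms t by simp
    moreover have "P i + (1/2 + t/2) * (P (Suc i) - P i) =
        (P i + P (Suc i)) / 2 + t * (P (Suc i) - (P i + P (Suc i)) / 2)" for P :: "nat \<Rightarrow> real"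
      by (simp add: field_simps)
    ultimately show ?thesis using 3 by (simp add: halve_def)
  next
    case (4 k) then show ?thesis using A[of k t] t by (simp add: halve_def)
  qed
qed

lemma dyadic_steps_halve:
  assumes "dyadic_steps L n P" "i < n" "P (Suc i) - P i = 1 / 2 ^ l" "l < L"
  shows "dyadic_steps L (Suc n) (halve i P)"
  unfolding dyadic_steps_def
proof (intro conjI allI impI)
  show "halve i P 0 = 0" "halve i P (Suc n) = 1"
    using assms by (auto simp: halve_def dyadic_steps_def)
  fix j assume "j < Suc n"
  then show "\<exists>l\<le>L. halve i P (Suc j) - halve i P j = 1 / 2 ^ l"
  proof (rule halve_cases[OF _ assms(2), of j P], goal_cases)
    case 1 then show ?case using assms by (auto simp: dyadic_steps_def)
  next
    case 2
    then have "halve i P (Suc j) - halve i P j = (P (Suc i) - P i) / 2" by (simp add: field_simps)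
    then show ?case using assms(3,4) by (intro exI[of _ "Suc l"]) simp
  next
    case 3
    then have "halve i P (Suc j) - halve i P j = (P (Suc i) - P i) / 2" by (simp add: field_simps)
    then show ?case using assms(3,4) by (intro exI[of _ "Suc l"]) simp
  next
    case (4 k) then show ?case using assms by (auto simp: dyadic_steps_def)
  qed
qed

lemma dyadic_steps_mono: "dyadic_steps L n P \<Longrightarrow> L \<le> L' \<Longrightarrow> dyadic_steps L' n P"
  unfolding dyadic_steps_def by (meson order_trans)

lemma dyadic_subdivision_steps:
  assumes "dyadic_subdivision n P"
  shows "\<exists>L. dyadic_steps L n P"
  using assms
proof induction
  case unit
  show ?case by (rule exI[of _ 0]) (simp add: dyadic_steps_def)
next
  case (halve n P i)
  then obtain L where L: "dyadic_steps L n P" by blast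
  then obtain l where "l \<le> L" "P (Suc i) - P i = 1 / 2 ^ l"
    using halve by (auto simp: dyadic_steps_def)
  then show ?case
    using dyadic_steps_halve[of "Suc L" n P i l] dyadic_steps_mono[OF L, of "Suc L"] halve
    by auto
qed

lemma dyadic_steps_pos: "dyadic_steps L n P \<Longrightarrow> n \<ge> 1"
  by (cases n) (auto simp: dyadic_steps_def)

lemma dyadic_steps_lower:
  assumes "dyadic_steps L n P" "i \<le> n"
  shows "real i / 2 ^ L \<le> P i"
  using assms(2)
proof (induction i)
  case 0 then show ?case using assms by (simp add: dyadic_steps_def)
next
  case (Suc i)
  then obtain l where "l \<le> L" "P (Suc i) - P i = 1 / 2 ^ l"
    using assms unfolding dyadic_steps_def by (meson Suc_le_lessD)
  moreover from this have "(1::real) / 2 ^ L \<le> 1 / 2 ^ l"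
    by (simp add: field_simps)
  ultimately show ?case using Suc by (simp add: add_divide_distrib)
qed

text \<open>
  Halving a long interval of \<open>Q\<close> together with the corresponding interval of \<open>P\<close> preserves the
  hypotheses.  Intervals of \<open>Q\<close> have length at least \<open>1 / 2 ^ L\<close>, so there are at most \<open>2 ^ L\<close> of them
  and the process stops; then all lengths are \<open>1 / 2 ^ L\<close>, which makes \<open>Q\<close> the uniform grid.  In this
  way subdivisions with arbitrarily placed intervals are replaced by iterated halvings.
\<close>

lemma refine_to_grid:
  assumes "affine_between f n P Q" "dyadic_subdivision n P" "dyadic_steps L n Q"
  shows "\<exists>P'. dyadic_subdivision (2 ^ L) P' \<and> affine_between f (2 ^ L) P' (\<lambda>i. i / 2 ^ L)"
  using assms
proof (induction "2 ^ L - n" arbitrary: n P Q rule: less_induct)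
  case less
  show ?case
  proof (cases "\<exists>i<n. \<exists>l<L. Q (Suc i) - Q i = 1 / 2 ^ l")
    case True
    then obtain i l where i: "i < n" "l < L" "Q (Suc i) - Q i = 1 / 2 ^ l" by blast
    note * = affine_between_halve[OF less.prems(1) i(1)] dyadic_subdivision.halve[OF less.prems(2) i(1)]
      dyadic_steps_halve[OF less.prems(3) i(1) i(3) i(2)]
    have "real (Suc n) / 2 ^ L \<le> 1"
      using dyadic_steps_lower[OF *(3), of "Suc n"] *(3) by (simp add: dyadic_steps_def)
    then have "real (Suc n) \<le> real (2 ^ L)" by (simp add: field_simps)
    then have "Suc n \<le> 2 ^ L" by (simp only: of_nat_le_iff)
    with less.hyps[OF _ *] show ?thesis by simp
  next
    case False
    have step: "Q (Suc i) - Q i = 1 / 2 ^ L" if i: "i < n" for i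
    proof -
      obtain l where "l \<le> L" "Q (Suc i) - Q i = 1 / 2 ^ l"
        using less.prems(3) i by (auto simp: dyadic_steps_def)
      with False i show ?thesis by (cases "l = L") auto
    qed
    have Q: "Q i = real i / 2 ^ L" if "i \<le> n" for i
      using that
    proof (induction i)
      case 0 then show ?case using less.prems(3) by (simp add: dyadic_steps_def)
    next
      case (Suc i) then show ?case using step[of i] by (simp add: add_divide_distrib)
    qed
    have "real n = real (2 ^ L)" using Q[of n] less.prems(3) by (simp add: dyadic_steps_def field_simps)
    then have "n = 2 ^ L" by (simp only: of_nat_eq_iff)
    moreover have "affine_between f n P (\<lambda>i. i / 2 ^ L)"
      using less.prems(1) Q by (auto simp: affine_between_def)
    ultimately show ?thesis using less.prems(2) by blast
  qed
qed

lemma affine_between_cong: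
  assumes "\<And>i. i \<le> n \<Longrightarrow> P i = P' i" "\<And>i. i \<le> n \<Longrightarrow> Q i = Q' i"
  shows "affine_between f n P Q \<longleftrightarrow> affine_between f n P' Q'"
  using assms by (auto simp: affine_between_def Suc_le_eq)

lemma affine_between_endpoints:
  assumes "affine_between f n P Q" "n \<ge> 1" "i \<le> n"
  shows "f (P i) = Q i"
proof (cases "i = n")
  case True
  then show ?thesis
    using assms by (cases n) (auto simp: affine_between_def dest!: spec[of _ "n-1"] bspec[of _ _ 1])
next
  case False
  then show ?thesis
    using assms by (auto simp: affine_between_def dest!: spec[of _ i] bspec[of _ _ 0])
qed

lemma grid_subdivision:
  "\<exists>P. dyadic_subdivision (2 ^ L) P \<and> (\<forall>i\<le>2 ^ L. P i = i / 2 ^ L)"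
proof -
  \<comment> \<open>refining the unit interval along the identity produces the grid itself\<close>
  have "affine_between id 1 real real" "dyadic_steps L 1 real"
    by (auto simp: affine_between_def dyadic_steps_def)
  from refine_to_grid[OF this(1) dyadic_subdivision.unit this(2)]
  obtain P where P: "dyadic_subdivision (2 ^ L) P" "affine_between id (2 ^ L) P (\<lambda>i. i / 2 ^ L)"
    by blast
  then show ?thesis using affine_between_endpoints[OF P(2)] by auto
qed

lemma affine_between_comp:
  assumes "affine_between f n P Q" "affine_between g n Q R"
  shows "affine_between (g \<circ> f) n P R"
  using assms by (simp add: affine_between_def)

lemma affine_between_inv:
  assumes "affine_between f n P Q" "inj f"
  shows "affine_between (inv_into UNIV f) n Q P"
  using assms by (force simp: affine_between_def intro: inv_f_eq)

lemma bracket_exists: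
  fixes P :: "nat \<Rightarrow> real"
  assumes "P 0 \<le> x" "x < P n"
  shows "\<exists>i<n. P i \<le> x \<and> x < P (Suc i)"
  using assms
proof (induction n)
  case (Suc n) then show ?case by (cases "x < P n") (auto simp: less_Suc_eq)
qed simp

lemma affine_between_unique:
  assumes "affine_between f n P Q" "affine_between g n P Q"
    and "P 0 \<le> x" "x \<le> P n" "n \<ge> 1"
  shows "f x = g x"
proof (cases "x < P n")
  case True
  then obtain i where i: "i < n" "P i \<le> x" "x < P (Suc i)"
    using bracket_exists[of P x n] assms by blast
  define t where "t = (x - P i) / (P (Suc i) - P i)"
  have "t \<in> {0..1}" "x = P i + t * (P (Suc i) - P i)" using i by (auto simp: t_def)
  then show ?thesis using assms(1,2) i(1) by (auto simp: affine_between_def)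
next
  case False
  with assms have "x = P n" by simp
  then show ?thesis
    using affine_between_endpoints[OF assms(1,5)] affine_between_endpoints[OF assms(2,5)] by simp
qed

section \<open>Thompson's group as a group of tree pairs\<close>

lemma dyadicsI: "x = of_int a / 2 ^ L \<Longrightarrow> x \<in> dyadics"
  unfolding dyadics_def mem_Collect_eq
  by (rule exI[of _ a], rule exI[of _ "- int L"]) (simp add: power_int_minus divide_inverse)

lemma dyadicsE:
  assumes "x \<in> dyadics"
  obtains a :: int and L :: nat where "x = of_int a / 2 ^ L"
proof -
  obtain a b :: int where x: "x = of_int a * 2 powi b" using assms by (auto simp: dyadics_def)
  show thesis
  proof (cases "b \<ge> 0")
    case True
    then have "x = of_int (a * 2 ^ nat b) / 2 ^ 0" using x by (simp add: power_int_def)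
    then show thesis using that by blast
  next
    case False
    then have "b = - int (nat (- b))" by simp
    then have "x = of_int a * 2 powi (- int (nat (- b)))" using x by (simp only:)
    then have "x = of_int a / 2 ^ nat (- b)"
      by (simp only: power_int_minus power_int_of_nat divide_inverse)
    then show thesis using that by blast
  qed
qed

lemma dyadics_raise: "(of_int a :: real) / 2 ^ L = of_int (a * 2 ^ k) / 2 ^ (L + k)"
  by (simp add: power_add)

text \<open>
  One denominator for finitely many dyadic numbers; it serves to make breakpoints, or points that have
  to lie in one orbit, grid points.
\<close>

lemma finite_dyadics_common_level:
  assumes "finite K" "K \<subseteq> dyadics"
  shows "\<exists>L0. \<forall>L\<ge>L0. \<forall>x\<in>K. \<exists>a::int. x = of_int a / 2 ^ L"
  using assms
proof (induction K rule: finite_induct)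
  case (insert x K)
  then obtain L0 where L0: "\<forall>L\<ge>L0. \<forall>x\<in>K. \<exists>a::int. x = of_int a / 2 ^ L" by auto
  obtain a :: int and M where x: "x = of_int a / 2 ^ M" using insert.prems by (auto elim: dyadicsE)
  have "\<exists>a::int. x = of_int a / 2 ^ L" if "L \<ge> M" for L
  proof -
    have "x = of_int (a * 2 ^ (L - M)) / 2 ^ (M + (L - M))" unfolding x by (rule dyadics_raise)
    then show ?thesis using that by (simp only: le_add_diff_inverse) blast
  qed
  with L0 have "\<forall>y\<in>insert x K. \<exists>a::int. y = of_int a / 2 ^ L" if "L \<ge> max L0 M" for L
    using that by simp
  then show ?case by blast
qed simp

lemma piecewise_affine_mono_continuous:
  fixes f :: "real \<Rightarrow> real" and b :: "nat \<Rightarrow> real"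
  assumes "\<And>i. i < n \<Longrightarrow> b i < b (Suc i)"
    and "\<And>i. i < n \<Longrightarrow> \<exists>(k::int) c. \<forall>x\<in>{b i..b (Suc i)}. f x = 2 powi k * x + c"
  shows "strict_mono_on {b 0..b n} f \<and> continuous_on {b 0..b n} f"
  using assms
proof (induction n)
  case 0
  show ?case by (auto simp: strict_mono_on_def)
next
  case (Suc n)
  have incr: "\<And>i. i < Suc n \<Longrightarrow> b i < b (Suc i)" by (rule Suc.prems(1))
  have IH: "strict_mono_on {b 0..b n} f" "continuous_on {b 0..b n} f"
    using Suc.IH Suc.prems by auto
  obtain k :: int and c where kc: "\<And>x. x \<in> {b n..b (Suc n)} \<Longrightarrow> f x = 2 powi k * x + c"
    using Suc.prems(2)[of n] by auto
  have bn: "b n < b (Suc n)" using Suc.prems(1) by simp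
  have "m \<le> n \<Longrightarrow> b 0 \<le> b m" for m
  proof (induction m)
    case (Suc m)
    then have "b m < b (Suc m)" using incr by simp
    then show ?case using Suc by linarith
  qed simp
  then have b0: "b 0 \<le> b n" by simp
  have "continuous_on {b n..b (Suc n)} (\<lambda>x. 2 powi k * x + c)" by (intro continuous_intros)
  then have cont: "continuous_on {b n..b (Suc n)} f" using kc continuous_on_cong by (metis (no_types, lifting))
  have un: "{b 0..b (Suc n)} = {b 0..b n} \<union> {b n..b (Suc n)}" using bn b0 by auto
  have "f x < f y" if xy: "x \<in> {b 0..b (Suc n)}" "y \<in> {b 0..b (Suc n)}" "x < y" for x y
  proof -
    have le: "f x \<le> f (b n)" if "x \<le> b n"
      using IH(1) that xy b0 by (cases "x = b n") (auto simp: strict_mono_on_def intro: less_imp_le)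
    have aff: "f u < f v" if "b n \<le> u" "u < v" "v \<le> b (Suc n)" for u v
      using that kc[of u] kc[of v] by simp
    consider "y \<le> b n" | "b n \<le> x" | "x < b n" "b n < y" by linarith
    then show ?thesis
    proof cases
      case 1 then show ?thesis using IH(1) xy by (auto simp: strict_mono_on_def)
    next
      case 2 then show ?thesis using aff xy by simp
    next
      case 3 then show ?thesis using le aff[of "b n" y] xy by simp
    qed
  qed
  then show ?case
    unfolding un using IH(2) cont by (auto simp: strict_mono_on_def un intro!: continuous_on_closed_Un)
qed

lemma thompson_F_setI:
  fixes b :: "nat \<Rightarrow> real"
  assumes "f 0 = 0" "f 1 = 1" "\<And>x. x \<notin> {0..1} \<Longrightarrow> f x = x"
    and "b 0 = 0" "b n = 1" "\<And>i. i \<le> n \<Longrightarrow> b i \<in> dyadics" "\<And>i. i < n \<Longrightarrow> b i < b (Suc i)"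
    and "\<And>i. i < n \<Longrightarrow> \<exists>(k::int) c. \<forall>x\<in>{b i..b (Suc i)}. f x = 2 powi k * x + c"
  shows "f \<in> thompson_F_set"
proof -
  have *: "strict_mono_on {0..1} f" "continuous_on {0..1} f"
    using piecewise_affine_mono_continuous[of n b f] assms by auto
  have "mono_on {0..1} f" using *(1) by (rule strict_mono_on_imp_mono_on)
  then have "f 0 \<le> f x" "f x \<le> f 1" if "x \<in> {0..1}" for x
    using that by (auto simp: mono_on_def)
  then have "f ` {0..1} \<subseteq> {0..1}" using assms(1,2) by auto
  moreover have "y \<in> f ` {0..1}" if "y \<in> {0..1}" for y
    using IVT'[of f 0 y 1] *(2) that assms(1,2) by auto
  ultimately have "bij_betw f {0..1} {0..1}"
    using strict_mono_on_imp_inj_on[OF *(1)] by (auto simp: bij_betw_def)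
  then show ?thesis unfolding thompson_F_set_def using assms * by blast
qed

lemma thompson_F_fixes_ends:
  assumes "f \<in> thompson_F_set"
  shows "f 0 = 0" "f 1 = 1"
proof -
  have bij: "bij_betw f {0..1} {0..1}" and mono: "mono_on {0..1} f"
    using assms by (auto simp: thompson_F_set_def intro: strict_mono_on_imp_mono_on)
  have range: "f 0 \<in> {0..1}" "f 1 \<in> {0..1}" using bij by (auto simp: bij_betw_def)
  have "0 \<in> f ` {0..1}" "1 \<in> f ` {0..1}" using bij by (auto simp: bij_betw_def)
  then obtain x y where xy: "x \<in> {0..1}" "f x = 0" "y \<in> {0..1}" "f y = 1" by auto
  have "f 0 \<le> f x" "f x \<le> f 1" if "x \<in> {0..1}" for x
    using mono that by (auto simp: mono_on_def)
  then have "f 0 \<le> 0" "1 \<le> f 1" using xy by metis+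
  then show "f 0 = 0" "f 1 = 1" using range by auto
qed

lemma thompson_F_outside: "f \<in> thompson_F_set \<Longrightarrow> x \<notin> {0<..<1} \<Longrightarrow> f x = x"
  using thompson_F_fixes_ends[of f] by (cases "x = 0"; cases "x = 1") (auto simp: thompson_F_set_def)

lemma thompson_F_bij:
  assumes "f \<in> thompson_F_set"
  shows "bij f"
proof -
  have 1: "bij_betw f {0..1} {0..1}" and 2: "\<And>x. x \<notin> {0..1} \<Longrightarrow> f x = x"
    using assms by (auto simp: thompson_F_set_def)
  from 2 have "bij_betw f (- {0..1}) (- {0..1})"
    by (simp add: bij_betw_def inj_on_def image_def)
  from bij_betw_combine[OF 1 this] show ?thesis by (simp add: Un_commute)
qed

lemma thompson_F_strict_mono:
  assumes "f \<in> thompson_F_set" "x < y"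
  shows "f x < f y"
proof -
  have m: "strict_mono_on {0..1} f" and b: "bij_betw f {0..1} {0..1}" and o: "\<And>x. x \<notin> {0..1} \<Longrightarrow> f x = x"
    using assms by (auto simp: thompson_F_set_def)
  have r: "u \<in> {0..1} \<Longrightarrow> f u \<in> {0..1}" for u using b by (auto simp: bij_betw_def)
  consider "x \<in> {0..1}" "y \<in> {0..1}" | "x \<in> {0..1}" "y \<notin> {0..1}"
    | "x \<notin> {0..1}" "y \<in> {0..1}" | "x \<notin> {0..1}" "y \<notin> {0..1}" by blast
  then show ?thesis
  proof cases
    case 1 then show ?thesis using m assms(2) by (auto simp: strict_mono_on_def)
  next
    case 2 then show ?thesis using r[of x] o[of y] assms(2) by auto
  next
    case 3 then show ?thesis using r[of y] o[of x] assms(2) by auto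
  next
    case 4 then show ?thesis using o assms(2) by simp
  qed
qed

lemma thompson_F_germ_at_0:
  assumes "f \<in> thompson_F_set"
  shows "\<exists>(k::int) e. e > 0 \<and> (\<forall>x\<in>{0..e}. f x = 2 powi k * x)"
proof -
  obtain n :: nat and b :: "nat \<Rightarrow> real" where b: "b 0 = 0" "b n = 1" "\<forall>i<n. b i < b (Suc i)"
    "\<forall>i<n. \<exists>(k::int) c. \<forall>x\<in>{b i..b (Suc i)}. f x = 2 powi k * x + c"
    using assms by (auto simp: thompson_F_set_def)
  have "n > 0" using b(1,2) by (cases n) auto
  then obtain k :: int and c where kc: "b (Suc 0) > 0" "\<forall>x\<in>{0..b (Suc 0)}. f x = 2 powi k * x + c"
    using b by fastforce
  moreover from kc have "c = 0" using thompson_F_fixes_ends(1)[OF assms] by (auto dest!: bspec[of _ _ 0])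
  ultimately show ?thesis by (intro exI[of _ k] exI[of _ "b (Suc 0)"]) simp
qed

text \<open>
  The classical description of \<open>F\<close> by pairs of finite binary trees with equally many leaves, the trees
  being iterated halvings of \<open>[0,1]\<close>.
\<close>

definition tree_pair :: "(real \<Rightarrow> real) \<Rightarrow> bool" where
  "tree_pair f \<longleftrightarrow> (\<forall>x. x \<notin> {0..1} \<longrightarrow> f x = x) \<and>
     (\<exists>n P Q. dyadic_subdivision n P \<and> dyadic_subdivision n Q \<and> affine_between f n P Q)"

lemma dyadic_steps_in_dyadics:
  assumes "dyadic_steps L n P" "i \<le> n"
  shows "\<exists>a::int. P i = of_int a / 2 ^ L"
  using assms(2)
proof (induction i)
  case 0 then show ?case using assms by (auto simp: dyadic_steps_def intro: exI[of _ 0])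
next
  case (Suc i)
  then obtain a :: int where a: "P i = of_int a / 2 ^ L" by auto
  obtain l where l: "l \<le> L" "P (Suc i) - P i = 1 / 2 ^ l"
    using assms Suc unfolding dyadic_steps_def by (meson Suc_le_lessD)
  have "P (Suc i) = of_int a / 2 ^ L + of_int 1 / 2 ^ l" using l a by simp
  also have "(of_int 1 :: real) / 2 ^ l = of_int (1 * 2 ^ (L - l)) / 2 ^ (l + (L - l))"
    by (rule dyadics_raise)
  finally have "P (Suc i) = of_int (a + 2 ^ (L - l)) / 2 ^ L"
    using l by (simp add: add_divide_distrib)
  then show ?case by blast
qed

lemma tree_pair_imp_thompson:
  assumes "tree_pair f"
  shows "f \<in> thompson_F_set"
proof -
  obtain n P Q L L' where *: "affine_between f n P Q" "dyadic_steps L n P" "dyadic_steps L' n Q"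
    using assms dyadic_subdivision_steps unfolding tree_pair_def by meson
  have n: "n \<ge> 1" using *(2) by (rule dyadic_steps_pos)
  have end0: "P 0 = 0" "Q 0 = 0" "P n = 1" "Q n = 1" using * by (auto simp: dyadic_steps_def)
  show ?thesis
  proof (rule thompson_F_setI[of f P n])
    show "f 0 = 0" "f 1 = 1"
      using affine_between_endpoints[OF *(1) n] end0 by (metis le0, metis order_refl)
    show "f x = x" if "x \<notin> {0..1}" for x using assms that by (auto simp: tree_pair_def)
    show "P i \<in> dyadics" if "i \<le> n" for i
      using dyadic_steps_in_dyadics[OF *(2) that] by (auto intro: dyadicsI)
    fix i assume i: "i < n"
    obtain l where l: "P (Suc i) - P i = 1 / 2 ^ l" using *(2) i by (auto simp: dyadic_steps_def)
    obtain l' where l': "Q (Suc i) - Q i = 1 / 2 ^ l'" using *(3) i by (auto simp: dyadic_steps_def)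
    have "(0::real) < 1 / 2 ^ l" by simp
    then show lt: "P i < P (Suc i)" using l by linarith
    have "f x = 2 powi (int l - int l') * x + (Q i - 2 powi (int l - int l') * P i)"
      if x: "x \<in> {P i..P (Suc i)}" for x
    proof -
      define t where "t = (x - P i) / (P (Suc i) - P i)"
      have t: "t \<in> {0..1}" "x = P i + t * (P (Suc i) - P i)" using x lt by (auto simp: t_def)
      then have "f x = Q i + t * (Q (Suc i) - Q i)" using *(1) i by (auto simp: affine_between_def)
      also have "t * (Q (Suc i) - Q i) = 2 powi (int l - int l') * (x - P i)"
        unfolding t_def l l' by (simp add: power_int_diff)
      finally show ?thesis by (simp add: algebra_simps)
    qed
    then show "\<exists>(k::int) c. \<forall>x\<in>{P i..P (Suc i)}. f x = 2 powi k * x + c" by blast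
  qed (use end0 in auto)
qed

text \<open>
  On a uniform grid that contains all breakpoints the map is affine on each interval, with slope a
  power of two, so the image intervals have lengths that are powers of two.  Refining the image to a
  uniform grid turns both sides into iterated halvings.
\<close>

lemma thompson_imp_tree_pair:
  assumes f: "f \<in> thompson_F_set"
  shows "tree_pair f"
proof -
  obtain n :: nat and b :: "nat \<Rightarrow> real" where b: "b 0 = 0" "b n = 1" "\<forall>i\<le>n. b i \<in> dyadics"
    "\<forall>i<n. b i < b (Suc i)"
    "\<forall>i<n. \<exists>(k::int) c. \<forall>x\<in>{b i..b (Suc i)}. f x = 2 powi k * x + c"
    using f by (auto simp: thompson_F_set_def)
  obtain N where N: "\<forall>x\<in>b ` {..n}. \<exists>a::int. x = of_int a / 2 ^ N"
    using finite_dyadics_common_level[of "b ` {..n}"] b(3) by (force simp del: ball_simps)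
  obtain G where G: "dyadic_subdivision (2 ^ N) G" "\<And>i. i \<le> 2 ^ N \<Longrightarrow> G i = real i / 2 ^ N"
    using grid_subdivision[of N] by blast
  define Q where "Q i = f (G i)" for i
  have piece: "\<exists>k::int. \<forall>t\<in>{0..1}. f (G j + t * (G (Suc j) - G j)) = Q j + t * (2 powi k / 2 ^ N)"
    if j: "j < 2 ^ N" for j
  proof -
    have "real j < 2 ^ N" using j by (metis of_nat_less_iff of_nat_numeral of_nat_power)
    then have "b 0 \<le> G j" "G j < b n" using j b G(2)[of j] by auto
    then obtain i where i: "i < n" "b i \<le> G j" "G j < b (Suc i)" using bracket_exists by blast
    obtain a :: int where a: "b (Suc i) = of_int a / 2 ^ N"
      using N i(1) by (meson Suc_leI atMost_iff imageI)
    have "int j < a" using i(3) a G(2)[of j] j by (simp add: divide_strict_right_mono field_simps)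
    then have "of_int (int j + 1) \<le> (of_int a :: real)" by (subst of_int_le_iff) simp
    then have le: "G (Suc j) \<le> b (Suc i)"
      using j a G(2)[of "Suc j"] by (simp add: divide_right_mono)
    obtain k :: int and c where kc: "\<forall>x\<in>{b i..b (Suc i)}. f x = 2 powi k * x + c" using b(5) i(1) by blast
    have d: "G (Suc j) - G j = 1 / 2 ^ N" using G(2)[of j] G(2)[of "Suc j"] j by (simp add: diff_divide_distrib[symmetric])
    have "f (G j + t * (G (Suc j) - G j)) = Q j + t * (2 powi k / 2 ^ N)" if t: "t \<in> {0..1}" for t
    proof -
      have "t * (G (Suc j) - G j) \<le> 1 * (G (Suc j) - G j)" "0 \<le> t * (G (Suc j) - G j)"
        using t d by (auto simp: divide_right_mono)
      then have "G j + t * (G (Suc j) - G j) \<in> {b i..b (Suc i)}" "G j \<in> {b i..b (Suc i)}"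
        using i le by auto
      then show ?thesis using kc by (simp add: Q_def d algebra_simps)
    qed
    then show ?thesis by blast
  qed
  have "\<exists>l. Q (Suc j) - Q j = 1 / 2 ^ l" if j: "j < 2 ^ N" for j
  proof -
    obtain k :: int where k: "Q (Suc j) - Q j = 2 powi k / 2 ^ N"
      using piece[OF j] by (auto simp: Q_def dest!: bspec[of _ _ 1])
    have r: "f u \<in> {0..1}" if "u \<in> {0..1}" for u
      using f that by (auto simp: thompson_F_set_def bij_betw_def)
    have "real (Suc j) \<le> real (2 ^ N)" using j by (intro of_nat_mono) simp
    then have "G j \<in> {0..1}" "G (Suc j) \<in> {0..1}" using G(2)[of j] G(2)[of "Suc j"] j by auto
    from this[THEN r] have "Q (Suc j) - Q j \<le> 1" by (auto simp: Q_def)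
    \<comment> \<open>the image interval lies in \<open>[0,1]\<close>, so the exponent of its length is not positive\<close>
    then have "(2::real) powi (k - int N) \<le> 2 powi 0"
      unfolding k by (simp add: power_int_diff)
    then have "k - int N \<le> 0" by (metis one_less_numeral_iff power_int_le_imp_le_exp semiring_norm(76) not_le power_int_strict_increasing)
    then have "k - int N = - int (nat (int N - k))" by simp
    then have "2 powi (k - int N) = (1::real) / 2 ^ nat (int N - k)"
      by (simp only: power_int_minus power_int_of_nat divide_inverse mult_1_left)
    then have "2 powi k / 2 ^ N = (1::real) / 2 ^ nat (int N - k)"
      by (simp add: power_int_diff)
    with k show ?thesis by metis
  qed
  then obtain l where l: "\<And>j. j < 2 ^ N \<Longrightarrow> Q (Suc j) - Q j = 1 / 2 ^ l j" by metis
  define L where "L = Max (l ` {..<2 ^ N})"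
  have "dyadic_steps L (2 ^ N) Q"
    unfolding dyadic_steps_def
    using l G(2)[of 0] G(2)[of "2 ^ N"] thompson_F_fixes_ends[OF f] by (auto simp: L_def Q_def)
  moreover have "affine_between f (2 ^ N) G Q"
    unfolding affine_between_def
  proof (intro allI impI ballI)
    fix j :: nat and t :: real assume j: "j < 2 ^ N" and t: "t \<in> {0..1}"
    obtain k :: int where k: "\<forall>t\<in>{0..1}. f (G j + t * (G (Suc j) - G j)) = Q j + t * (2 powi k / 2 ^ N)"
      using piece[OF j] by blast
    from k have "Q (Suc j) - Q j = 2 powi k / 2 ^ N" by (auto simp: Q_def dest!: bspec[of _ _ 1])
    with k t show "f (G j + t * (G (Suc j) - G j)) = Q j + t * (Q (Suc j) - Q j)" by simp
  qed
  ultimately obtain P' where P': "dyadic_subdivision (2 ^ L) P'" "affine_between f (2 ^ L) P' (\<lambda>i. i / 2 ^ L)"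
    using refine_to_grid G(1) by blast
  obtain H where H: "dyadic_subdivision (2 ^ L) H" "\<And>i. i \<le> 2 ^ L \<Longrightarrow> H i = real i / 2 ^ L"
    using grid_subdivision[of L] by blast
  have "affine_between f (2 ^ L) P' H"
    using P'(2) H(2) affine_between_cong[of "2 ^ L" P' P' "\<lambda>i. i / 2 ^ L" H f] by simp
  then show ?thesis using P'(1) H(1) f by (auto simp: tree_pair_def thompson_F_set_def)
qed

lemma thompson_iff_tree_pair: "f \<in> thompson_F_set \<longleftrightarrow> tree_pair f"
  using tree_pair_imp_thompson thompson_imp_tree_pair by blast

lemma thompson_inv_closed:
  assumes "f \<in> thompson_F_set"
  shows "inv_into UNIV f \<in> thompson_F_set"
proof -
  have inj: "inj f" using thompson_F_bij[OF assms] by (simp add: bij_def)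
  obtain n P Q where "dyadic_subdivision n P" "dyadic_subdivision n Q" "affine_between f n P Q"
    and o: "\<And>x. x \<notin> {0..1} \<Longrightarrow> f x = x"
    using assms by (auto simp: thompson_iff_tree_pair tree_pair_def)
  moreover have "inv_into UNIV f x = x" if "x \<notin> {0..1}" for x
    using o[OF that] inj by (simp add: inv_f_eq)
  ultimately show ?thesis
    using affine_between_inv[OF _ inj] unfolding thompson_iff_tree_pair tree_pair_def by blast
qed

text \<open>
  Both the target of \<open>f\<close> and the source of \<open>g\<close> can be refined to the same uniform grid; the latter by
  refining the target of the inverse of \<open>g\<close>.
\<close>

lemma thompson_comp_closed:
  assumes f: "f \<in> thompson_F_set" and g: "g \<in> thompson_F_set"
  shows "g \<circ> f \<in> thompson_F_set"
proof -
  obtain n P Q where 1: "dyadic_subdivision n P" "dyadic_subdivision n Q" "affine_between f n P Q"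
    using f by (auto simp: thompson_iff_tree_pair tree_pair_def)
  obtain m R S where 2: "dyadic_subdivision m S" "dyadic_subdivision m R" "affine_between (inv_into UNIV g) m S R"
    using thompson_inv_closed[OF g] by (auto simp: thompson_iff_tree_pair tree_pair_def)
  obtain L1 L2 where L: "dyadic_steps L1 n Q" "dyadic_steps L2 m R"
    using 1(2) 2(2) dyadic_subdivision_steps by blast
  define L where "L = max L1 L2"
  have "dyadic_steps L n Q" "dyadic_steps L m R"
    using L by (auto simp: L_def intro: dyadic_steps_mono)
  then obtain P' S' where 3: "dyadic_subdivision (2 ^ L) P'" "affine_between f (2 ^ L) P' (\<lambda>i. i / 2 ^ L)"
    "dyadic_subdivision (2 ^ L) S'" "affine_between (inv_into UNIV g) (2 ^ L) S' (\<lambda>i. i / 2 ^ L)"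
    using refine_to_grid[OF 1(3,1)] refine_to_grid[OF 2(3,1)] by blast
  have bij: "bij g" by (rule thompson_F_bij[OF g])
  then have "affine_between g (2 ^ L) (\<lambda>i. i / 2 ^ L) S'"
    using affine_between_inv[OF 3(4)] by (simp add: bij_imp_bij_inv bij_is_inj inv_inv_eq)
  from affine_between_comp[OF 3(2) this] 3(1,3) f g
  show ?thesis by (auto simp: thompson_iff_tree_pair tree_pair_def)
qed

lemma id_thompson: "id \<in> thompson_F_set"
  unfolding thompson_iff_tree_pair tree_pair_def
  by (auto intro!: exI[of _ 1] exI[of _ real] dyadic_subdivision.unit simp: affine_between_def)

lemma group_thompson_F: "group thompson_F"
proof (rule groupI)
  fix f assume "f \<in> carrier thompson_F"
  then show "\<exists>g\<in>carrier thompson_F. g \<otimes>\<^bsub>thompson_F\<^esub> f = \<one>\<^bsub>thompson_F\<^esub>"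
    using surj_iff[of f] thompson_F_bij[of f] thompson_inv_closed[of f]
    by (intro bexI[of _ "inv_into UNIV f"]) (auto simp: thompson_F_def bij_is_surj)
qed (auto simp: thompson_F_def thompson_comp_closed id_thompson)

lemma inv_thompson_F:
  assumes "f \<in> thompson_F_set"
  shows "inv\<^bsub>thompson_F\<^esub> f = inv_into UNIV f"
proof -
  interpret group thompson_F by (rule group_thompson_F)
  show ?thesis
    using surj_iff[of f] thompson_F_bij[OF assms] thompson_inv_closed[OF assms] assms
    by (intro inv_equality) (auto simp: thompson_F_def bij_is_surj)
qed

section \<open>Finite generation of Thompson's group\<close>

lemma dyadics_add: "x \<in> dyadics \<Longrightarrow> y \<in> dyadics \<Longrightarrow> x + y \<in> dyadics"
proof -
  assume "x \<in> dyadics" "y \<in> dyadics"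
  then obtain L where "\<forall>z\<in>{x, y}. \<exists>a::int. z = of_int a / 2 ^ L"
    using finite_dyadics_common_level[of "{x, y}"] by blast
  then obtain a b :: int where "x = of_int a / 2 ^ L" "y = of_int b / 2 ^ L" by blast
  then have "x + y = of_int (a + b) / 2 ^ L" by (simp add: add_divide_distrib)
  then show ?thesis by (rule dyadicsI)
qed

lemma dyadics_basic: "0 \<in> dyadics" "1 \<in> dyadics" "of_int k / 2 ^ n \<in> dyadics"
  using dyadicsI[of 0 0 0] dyadicsI[of 1 1 0] dyadicsI[of "of_int k / 2 ^ n" k n] by auto

text \<open>
  The slopes are \<open>2\<close>, \<open>1\<close> and \<open>1/2\<close> on \<open>[a, 1]\<close>.  For \<open>a = 0\<close> and small \<open>d\<close>
  a single orbit contains all multiples of \<open>d\<close>, and these maps drive the random walk; for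
  \<open>a = 1 - 1 / 2 ^ i\<close> and \<open>d = 1 / 2 ^ (i + 2)\<close> they are the usual infinite generating sequence of \<open>F\<close>.
\<close>

definition ramp :: "real \<Rightarrow> real \<Rightarrow> real \<Rightarrow> real" where
  "ramp a d x = (if x \<le> a \<or> 1 \<le> x then x else min (2 * x - a) (min (x + d) ((1 + x) / 2)))"

lemma ramp_pieces:
  assumes "0 < d" "a + 3 * d < 1"
  shows "x \<le> a \<Longrightarrow> ramp a d x = x"
    and "a \<le> x \<Longrightarrow> x \<le> a + d \<Longrightarrow> ramp a d x = 2 * x - a"
    and "a + d \<le> x \<Longrightarrow> x \<le> 1 - 2 * d \<Longrightarrow> ramp a d x = x + d"
    and "1 - 2 * d \<le> x \<Longrightarrow> x \<le> 1 \<Longrightarrow> ramp a d x = (1 + x) / 2"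
    and "1 \<le> x \<Longrightarrow> ramp a d x = x"
  using assms by (auto simp: ramp_def min_def)

lemma ramp_thompson:
  assumes "a \<in> dyadics" "0 \<le> a" "d = 1 / 2 ^ M" "a + 3 * d < 1"
  shows "ramp a d \<in> thompson_F_set"
proof -
  have d: "0 < d" using assms by simp
  note p = ramp_pieces[OF d assms(4)]
  have "of_int 1 / 2 ^ M \<in> dyadics" "of_int (-2) / 2 ^ M \<in> dyadics" by (rule dyadics_basic)+
  then have dy: "a + d \<in> dyadics" "1 - 2 * d \<in> dyadics" "d \<in> dyadics"
    using dyadics_add[of a d] dyadics_add[of 1 "- 2 * d"] assms dyadics_basic by auto
  have slopes: "\<exists>(k::int) c. \<forall>x\<in>{a..a + d}. ramp a d x = 2 powi k * x + c"
    "\<exists>(k::int) c. \<forall>x\<in>{a + d..1 - 2 * d}. ramp a d x = 2 powi k * x + c"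
    "\<exists>(k::int) c. \<forall>x\<in>{1 - 2 * d..1}. ramp a d x = 2 powi k * x + c"
    "\<exists>(k::int) c. \<forall>x\<in>{0..a}. ramp a d x = 2 powi k * x + c"
    by (rule exI[of _ 1], rule exI[of _ "- a"], simp add: p,
        rule exI[of _ 0], rule exI[of _ d], simp add: p,
        rule exI[of _ "-1"], rule exI[of _ "1/2"], simp add: p power_int_minus field_simps,
        rule exI[of _ 0], rule exI[of _ 0], simp add: p)
  have outer: "ramp a d 0 = 0" "ramp a d 1 = 1" "\<And>x. x \<notin> {0..1} \<Longrightarrow> ramp a d x = x"
    using p assms d by auto
  show ?thesis
  proof (cases "a = 0")
    case True
    define b where "b i = (if i = 0 then 0 else if i = 1 then d else if i = 2 then 1 - 2 * d else 1)" for i :: nat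
    have b: "b 0 = 0" "b (Suc 0) = d" "b (Suc (Suc 0)) = 1 - 2 * d" "b (Suc (Suc (Suc 0))) = 1"
      by (auto simp: b_def)
    show ?thesis
    proof (rule thompson_F_setI[OF outer, of b "Suc (Suc (Suc 0))"])
      fix i :: nat assume "i < Suc (Suc (Suc 0))"
      then have i: "i = 0 \<or> i = Suc 0 \<or> i = Suc (Suc 0)" by linarith
      show "b i < b (Suc i)" using i True d assms(4) by (elim disjE) (simp_all add: b)
      show "\<exists>(k::int) c. \<forall>x\<in>{b i..b (Suc i)}. ramp a d x = 2 powi k * x + c"
        using i slopes(1-3)[unfolded True add_0] True by (elim disjE) (simp_all only: b)
    next
      show "b i \<in> dyadics" for i using dy dyadics_basic by (simp add: b_def)
    qed (use b in auto)
  next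
    case False
    define b where "b i = (if i = 0 then 0 else if i = 1 then a else if i = 2 then a + d
        else if i = 3 then 1 - 2 * d else 1)" for i :: nat
    have b: "b 0 = 0" "b (Suc 0) = a" "b (Suc (Suc 0)) = a + d" "b (Suc (Suc (Suc 0))) = 1 - 2 * d"
      "b (Suc (Suc (Suc (Suc 0)))) = 1"
      by (auto simp: b_def)
    show ?thesis
    proof (rule thompson_F_setI[OF outer, of b "Suc (Suc (Suc (Suc 0)))"])
      fix i :: nat assume "i < Suc (Suc (Suc (Suc 0)))"
      then have i: "i = 0 \<or> i = Suc 0 \<or> i = Suc (Suc 0) \<or> i = Suc (Suc (Suc 0))" by linarith
      show "b i < b (Suc i)" using i False d assms(2,4) by (elim disjE) (simp_all add: b)
      show "\<exists>(k::int) c. \<forall>x\<in>{b i..b (Suc i)}. ramp a d x = 2 powi k * x + c"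
        using i slopes by (elim disjE) (simp_all only: b)
    next
      show "b i \<in> dyadics" for i using dy dyadics_basic assms(1) by (simp add: b_def)
    qed (use b in auto)
  qed
qed

text \<open>
  The right comb with \<open>n\<close> leaves: only the last interval is ever halved.
\<close>

definition vine :: "nat \<Rightarrow> nat \<Rightarrow> real" where
  "vine n i = (if i < n then 1 - 1 / 2 ^ i else 1)"

definition thompson_x :: "nat \<Rightarrow> real \<Rightarrow> real" where
  "thompson_x i = ramp (1 - 1 / 2 ^ i) (1 / 2 ^ (i + 2))"

lemma thompson_x_pieces:
  shows "x \<le> 1 - 1 / 2 ^ i \<Longrightarrow> thompson_x i x = x"
    and "1 - 1 / 2 ^ i \<le> x \<Longrightarrow> x \<le> 1 - 3 / 2 ^ (i + 2) \<Longrightarrow> thompson_x i x = 2 * x - (1 - 1 / 2 ^ i)"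
    and "1 - 3 / 2 ^ (i + 2) \<le> x \<Longrightarrow> x \<le> 1 - 1 / 2 ^ Suc i \<Longrightarrow> thompson_x i x = x + 1 / 2 ^ (i + 2)"
    and "1 - 1 / 2 ^ Suc i \<le> x \<Longrightarrow> x \<le> 1 \<Longrightarrow> thompson_x i x = (1 + x) / 2"
    and "1 \<le> x \<Longrightarrow> thompson_x i x = x"
proof -
  define d where "d = (1::real) / 2 ^ (i + 2)"
  have d: "0 < d" "1 / 2 ^ i = 4 * d" "1 / 2 ^ Suc i = 2 * d" "3 / 2 ^ (i + 2) = 3 * d"
    by (auto simp: d_def)
  have x: "thompson_x i = ramp (1 - 4 * d) d" by (simp add: thompson_x_def d_def)
  note p = ramp_pieces[of d "1 - 4 * d"]
  show "x \<le> 1 - 1 / 2 ^ i \<Longrightarrow> thompson_x i x = x"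
    "1 - 1 / 2 ^ i \<le> x \<Longrightarrow> x \<le> 1 - 3 / 2 ^ (i + 2) \<Longrightarrow> thompson_x i x = 2 * x - (1 - 1 / 2 ^ i)"
    "1 - 3 / 2 ^ (i + 2) \<le> x \<Longrightarrow> x \<le> 1 - 1 / 2 ^ Suc i \<Longrightarrow> thompson_x i x = x + 1 / 2 ^ (i + 2)"
    "1 - 1 / 2 ^ Suc i \<le> x \<Longrightarrow> x \<le> 1 \<Longrightarrow> thompson_x i x = (1 + x) / 2"
    "1 \<le> x \<Longrightarrow> thompson_x i x = x"
    unfolding d x d_def[symmetric] using p d(1) by auto
qed

lemma thompson_x_in_F: "thompson_x i \<in> thompson_F_set"
  unfolding thompson_x_def
proof (rule ramp_thompson[where M = "i + 2"])
  show "1 - 1 / 2 ^ i \<in> dyadics"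
    using dyadics_add[OF dyadics_basic(2) dyadics_basic(3)[of "-1" i]] by simp
qed (auto simp: field_simps)

text \<open>
  On \<open>[1/2, 1]\<close> the first generator is \<open>x \<mapsto> (1 + x) / 2\<close>, which rescales the support of \<open>thompson_x i\<close>
  to the support of \<open>thompson_x (i + 1)\<close>.  Consequently two of these elements generate all of them.
\<close>

lemma thompson_x_conjugate:
  assumes "i \<ge> 1"
  shows "thompson_x (Suc i) \<circ> thompson_x 0 = thompson_x 0 \<circ> thompson_x i"
proof
  fix x :: real
  have half: "(1::real) / 2 \<le> 1 - 1 / 2 ^ i" using assms by (cases i) (auto simp: field_simps)
  note p0 = thompson_x_pieces[where x = x and i = 0] and pi = thompson_x_pieces[where x = x and i = i]
  consider "x \<le> 0 \<or> 1 \<le> x" | "0 < x" "x \<le> 1/2" | "1/2 \<le> x" "x \<le> 1" by linarith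
  then show "(thompson_x (Suc i) \<circ> thompson_x 0) x = (thompson_x 0 \<circ> thompson_x i) x"
  proof cases
    case 1
    then have "thompson_x j x = x" for j
    proof
      assume "x \<le> 0"
      moreover have "1 / 2 ^ j \<le> (1::real)" by simp
      ultimately have "x \<le> 1 - 1 / 2 ^ j" by linarith
      then show ?thesis by (rule thompson_x_pieces)
    qed (rule thompson_x_pieces)
    then show ?thesis by simp
  next
    case 2
    have "thompson_x 0 x \<le> 3/4" using 2 p0 by (cases "x \<le> 1/4") auto
    also have "(3/4::real) \<le> 1 - (1 / 2 ^ i) / 2" using half by (simp add: field_simps)
    also have "\<dots> = 1 - 1 / 2 ^ Suc i" by simp
    finally have "thompson_x (Suc i) (thompson_x 0 x) = thompson_x 0 x"
      by (rule thompson_x_pieces)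
    moreover have "thompson_x i x = x" using order_trans[OF 2(2) half] by (rule thompson_x_pieces)
    ultimately show ?thesis by simp
  next
    case 3
    define d where "d = (1::real) / 2 ^ (i + 3)"
    have d: "0 < d" "1 / 2 ^ i = 8 * d" "1 / 2 ^ Suc i = 4 * d" "3 / 2 ^ (i + 2) = 6 * d" "1 / 2 ^ (i + 2) = 2 * d"
      "1 / 2 ^ Suc (Suc i) = 2 * d" "3 / 2 ^ (Suc i + 2) = 3 * d" "1 / 2 ^ (Suc i + 2) = d"
      by (auto simp: d_def power_add)
    have x0: "thompson_x 0 y = (1 + y) / 2" if "1/2 \<le> y" "y \<le> 1" for y
      using that thompson_x_pieces(4)[where x = y and i = 0] by simp
    note ps = thompson_x_pieces[where x = "(1 + x) / 2" and i = "Suc i", unfolded d]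
    note pi = pi[unfolded d]
    consider "x \<le> 1 - 8 * d" | "1 - 8 * d \<le> x" "x \<le> 1 - 6 * d" | "1 - 6 * d \<le> x" "x \<le> 1 - 4 * d"
      | "1 - 4 * d \<le> x" by linarith
    then have "thompson_x (Suc i) ((1 + x) / 2) = (1 + thompson_x i x) / 2 \<and>
        1/2 \<le> thompson_x i x \<and> thompson_x i x \<le> 1"
    proof cases
      case 1 then show ?thesis using ps(1) pi(1) 3 by (simp add: field_simps)
    next
      case 2 then show ?thesis using ps(2) pi(2) 3 half d by (simp add: field_simps)
    next
      case a: 3 then show ?thesis using ps(3) pi(3) 3 half d by (simp add: field_simps)
    next
      case 4 then show ?thesis using ps(4) pi(4) 3 half d by (simp add: field_simps)
    qed
    then show ?thesis using x0[OF 3] x0[of "thompson_x i x"] by (simp only: comp_apply)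
  qed
qed

abbreviation thompson_gens :: "(real \<Rightarrow> real) set" where
  "thompson_gens \<equiv> {thompson_x 0, thompson_x 1}"

lemma thompson_F_simps:
  "carrier thompson_F = thompson_F_set" "g \<otimes>\<^bsub>thompson_F\<^esub> h = h \<circ> g" "\<one>\<^bsub>thompson_F\<^esub> = id"
  by (simp_all add: thompson_F_def)

lemma generated_comp:
  "g \<in> generate thompson_F S \<Longrightarrow> h \<in> generate thompson_F S \<Longrightarrow> h \<circ> g \<in> generate thompson_F S"
  using generate.eng[of g thompson_F S h] by (simp add: thompson_F_simps)

lemma generated_subset: "generate thompson_F thompson_gens \<subseteq> thompson_F_set"
  using group.generate_in_carrier[OF group_thompson_F, of thompson_gens] thompson_x_in_F
  by (auto simp: thompson_F_simps)

lemma generated_inv: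
  assumes "g \<in> generate thompson_F thompson_gens"
  shows "inv_into UNIV g \<in> generate thompson_F thompson_gens"
proof -
  have "inv\<^bsub>thompson_F\<^esub> g \<in> generate thompson_F thompson_gens"
    using group.generate_m_inv_closed[OF group_thompson_F _ assms] thompson_x_in_F
    by (auto simp: thompson_F_simps)
  then show ?thesis using inv_thompson_F generated_subset assms by auto
qed

lemma thompson_x_generated: "thompson_x i \<in> generate thompson_F thompson_gens"
proof (induction i)
  case 0 show ?case by (rule generate.incl) simp
next
  case (Suc i)
  show ?case
  proof (cases "i = 0")
    case True then show ?thesis by (auto intro: generate.incl)
  next
    case False
    let ?y = "inv_into UNIV (thompson_x 0)"
    have x0: "thompson_x 0 \<in> generate thompson_F thompson_gens" by (rule generate.incl) simp
    have "surj (thompson_x 0)" using thompson_F_bij[OF thompson_x_in_F] by (simp add: bij_def)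
    then have "thompson_x 0 \<circ> ?y = id" by (simp add: surj_iff)
    then have "thompson_x (Suc i) = (thompson_x 0 \<circ> thompson_x i) \<circ> ?y"
      using thompson_x_conjugate[of i] False by (metis comp_assoc comp_id less_one not_le)
    then show ?thesis using generated_comp generated_inv[OF x0] x0 Suc by metis
  qed
qed

lemma affine_on_segment:
  fixes f :: "real \<Rightarrow> real"
  assumes "\<And>x. x \<in> {u..v} \<Longrightarrow> f x = s * x + c" "u \<le> v" "t \<in> {0..1}"
    "s * u + c = u'" "s * v + c = v'"
  shows "f (u + t * (v - u)) = u' + t * (v' - u')"
proof -
  have "t * (v - u) \<le> 1 * (v - u)" using assms(2,3) by (intro mult_right_mono) auto
  moreover have "0 \<le> t * (v - u)" using assms(2,3) by (intro mult_nonneg_nonneg) auto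
  ultimately have "u + t * (v - u) \<in> {u..v}" by auto
  then have "f (u + t * (v - u)) = s * (u + t * (v - u)) + c" by (rule assms(1))
  then show ?thesis unfolding assms(4,5)[symmetric] by (simp add: algebra_simps)
qed

lemma vine_less: "i < n \<Longrightarrow> vine n i = 1 - 1 / 2 ^ i"
  by (simp add: vine_def)

lemma vine_mono: "vine n i \<le> vine n (Suc i)"
  by (auto simp: vine_def field_simps)

text \<open>
  Halving the leaf \<open>i\<close> of the comb gives a tree with one caret off the spine; \<open>thompson_x i\<close> is the
  rotation that moves this caret onto the spine.
\<close>

lemma thompson_x_rotates_vine:
  assumes i: "Suc i < n"
  shows "affine_between (thompson_x i) (Suc n) (halve i (vine n)) (vine (Suc n))"
proof -
  define d where "d = (1::real) / 2 ^ (i + 2)"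
  have d: "0 < d" "1 / 2 ^ i = 4 * d" "1 / 2 ^ Suc i = 2 * d" "3 / 2 ^ (i + 2) = 3 * d" "1 / 2 ^ (i + 2) = d"
    by (auto simp: d_def)
  note p = thompson_x_pieces[where i = i, unfolded d]
  have lt: "i < n" "i < Suc n" "Suc i < Suc n" "Suc (Suc i) < Suc n" using i by auto
  have v: "vine n i = 1 - 4 * d" "vine n (Suc i) = 1 - 2 * d" "vine (Suc n) i = 1 - 4 * d"
    "vine (Suc n) (Suc i) = 1 - 2 * d" "vine (Suc n) (Suc (Suc i)) = 1 - d"
    using d by (simp_all only: vine_less lt i add_2_eq_Suc')
  have "thompson_x i (halve i (vine n) j + t * (halve i (vine n) (Suc j) - halve i (vine n) j)) =
      vine (Suc n) j + t * (vine (Suc n) (Suc j) - vine (Suc n) j)"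
    if j: "j < Suc n" and t: "t \<in> {0..1}" for j t
  proof (cases rule: halve_cases[OF j Suc_lessD[OF i], of "vine n"])
    case 1
    have "vine n (Suc j) \<le> vine n i" using 1(1) by (intro lift_Suc_mono_le[of "vine n", OF vine_mono]) simp
    then have "thompson_x i x = 1 * x + 0" if "x \<in> {vine n j..vine n (Suc j)}" for x
      using that v(1) p(1)[of x] by auto
    moreover have "vine (Suc n) j = vine n j" "vine (Suc n) (Suc j) = vine n (Suc j)"
      using 1(1) i by (simp_all add: vine_less)
    ultimately show ?thesis unfolding 1(2,3) using t vine_mono[of n j]
      by (intro affine_on_segment[where s = 1 and c = 0]) simp_all
  next
    case 2
    have "thompson_x i x = 2 * x + - (1 - 4 * d)" if "x \<in> {1 - 4 * d..(1 - 4 * d + (1 - 2 * d)) / 2}" for x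
      using that p(2)[of x] by auto
    then show ?thesis unfolding 2(2,3) unfolding 2(1) v using t d(1)
      by (intro affine_on_segment[where s = 2 and c = "- (1 - 4 * d)"]) (simp_all add: field_simps)
  next
    case 3
    have "thompson_x i x = 1 * x + d" if "x \<in> {(1 - 4 * d + (1 - 2 * d)) / 2..1 - 2 * d}" for x
      using that p(3)[of x] by auto
    then show ?thesis unfolding 3(2,3) unfolding 3(1) v using t d(1)
      by (intro affine_on_segment[where s = 1 and c = d]) (simp_all add: field_simps)
  next
    case (4 k)
    have "1 - 2 * d \<le> vine n k"
      unfolding v(2)[symmetric] using 4(2) by (intro lift_Suc_mono_le[of "vine n", OF vine_mono]) simp
    moreover have "vine n (Suc k) \<le> 1" by (simp add: vine_def)
    ultimately have "thompson_x i x = (1/2) * x + 1/2" if "x \<in> {vine n k..vine n (Suc k)}" for x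
      using that p(4)[of x] by (simp add: add_divide_distrib)
    moreover have "vine (Suc n) (Suc l) = (1 + vine n l) / 2" for l by (simp add: vine_def field_simps)
    ultimately show ?thesis unfolding 4(4,5) unfolding 4(1) using t vine_mono[of n k]
      by (intro affine_on_segment[where s = "1/2" and c = "1/2"]) (simp_all add: add_divide_distrib)
  qed
  then show ?thesis by (simp add: affine_between_def)
qed

text \<open>
  Induction along the construction of the subdivision: each further halving of a leaf is undone by one
  rotation.  Halving the last leaf of the comb already gives a comb.
\<close>

lemma subdivision_to_vine:
  assumes "dyadic_subdivision n P"
  shows "\<exists>h\<in>generate thompson_F thompson_gens. affine_between h n P (vine n)"
  using assms
proof induction
  case unit
  have "affine_between id 1 real (vine 1)" by (simp add: affine_between_def vine_def)
  then show ?case using generate.one[of thompson_F] by (auto simp: thompson_F_simps)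
next
  case (halve n P i)
  then obtain h where h: "h \<in> generate thompson_F thompson_gens" "affine_between h n P (vine n)" by blast
  have h': "affine_between h (Suc n) (halve i P) (halve i (vine n))"
    by (rule affine_between_halve[OF h(2) halve.hyps(2)])
  show ?case
  proof (cases "Suc i < n")
    case True
    then show ?thesis
      using affine_between_comp[OF h' thompson_x_rotates_vine] h(1) thompson_x_generated generated_comp
      by blast
  next
    case False
    then have n: "n = Suc i" using halve.hyps(2) by simp
    have "halve i (vine n) j = vine (Suc n) j" if j: "j \<le> Suc n" for j
    proof -
      consider "j \<le> i" | "j = Suc i" | "j = Suc (Suc i)" using j n by linarith
      then show ?thesis unfolding n by cases (auto simp: halve_def vine_def field_simps)
    qed
    then show ?thesis
      using h' h(1) affine_between_cong[of "Suc n" "halve i P" "halve i P" "halve i (vine n)" "vine (Suc n)" h]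
      by auto
  qed
qed

text \<open>
  Carrying the source and the target of a tree pair to the same comb writes the element as a quotient
  of two elements of the generated subgroup.
\<close>

lemma thompson_F_generated: "generate thompson_F thompson_gens = carrier thompson_F"
proof
  show "generate thompson_F thompson_gens \<subseteq> carrier thompson_F"
    using generated_subset by (simp add: thompson_F_simps)
  show "carrier thompson_F \<subseteq> generate thompson_F thompson_gens"
  proof
    fix f assume "f \<in> carrier thompson_F"
    then have f: "f \<in> thompson_F_set" by (simp add: thompson_F_simps)
    then obtain n P Q where fPQ: "dyadic_subdivision n P" "dyadic_subdivision n Q" "affine_between f n P Q"
      by (auto simp: thompson_iff_tree_pair tree_pair_def)
    obtain h k where h: "h \<in> generate thompson_F thompson_gens" "affine_between h n P (vine n)"
      and k: "k \<in> generate thompson_F thompson_gens" "affine_between k n Q (vine n)"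
      using subdivision_to_vine fPQ by blast
    have n: "n \<ge> 1" "P 0 = 0" "P n = 1"
      using dyadic_subdivision_steps[OF fPQ(1)] dyadic_steps_pos by (auto simp: dyadic_steps_def)
    have hk: "h \<in> thompson_F_set" "k \<in> thompson_F_set" using h k generated_subset by auto
    have "(k \<circ> f) x = h x" for x
    proof (cases "x \<in> {0..1}")
      case True
      then show ?thesis
        using affine_between_unique[OF affine_between_comp[OF fPQ(3) k(2)] h(2)] n by simp
    next
      case False
      then show ?thesis using f hk by (auto simp: thompson_F_set_def)
    qed
    then have "k \<circ> f = h" by (rule ext)
    moreover have "inv_into UNIV k \<circ> k = id" using thompson_F_bij[OF hk(2)] by (simp add: bij_def)
    ultimately have "f = inv_into UNIV k \<circ> h" by (metis comp_assoc id_comp)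
    then show "f \<in> generate thompson_F thompson_gens"
      using generated_comp generated_inv h(1) k(1) by simp
  qed
qed

lemma finitely_generated_thompson_F: "finitely_generated_group thompson_F"
  unfolding finitely_generated_group_def finite_generating_set_def
  using group_thompson_F thompson_F_generated thompson_x_in_F
  by (auto intro!: exI[of _ thompson_gens] simp: thompson_F_simps)

section \<open>The action on the dyadic points\<close>

lemma dyadics_scale: "x \<in> dyadics \<Longrightarrow> 2 powi k * x \<in> dyadics"
proof -
  assume "x \<in> dyadics"
  then obtain a b :: int where "x = of_int a * 2 powi b" by (auto simp: dyadics_def)
  then have "2 powi k * x = of_int a * 2 powi (k + b)" by (simp add: power_int_add)
  then show ?thesis by (auto simp: dyadics_def)
qed

lemma dyadics_diff: "x \<in> dyadics \<Longrightarrow> y \<in> dyadics \<Longrightarrow> x - y \<in> dyadics"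
proof -
  assume x: "x \<in> dyadics" and "y \<in> dyadics"
  then obtain a b :: int where "y = of_int a * 2 powi b" by (auto simp: dyadics_def)
  then have "- y = of_int (- a) * 2 powi b" by simp
  then have "- y \<in> dyadics" unfolding dyadics_def by blast
  from dyadics_add[OF x this] show ?thesis by simp
qed

lemma countable_dyadics: "countable dyadics"
proof -
  have "dyadics = range (\<lambda>(a :: int, b :: int). of_int a * 2 powi b)" by (auto simp: dyadics_def)
  moreover have "countable (range (\<lambda>(a :: int, b :: int). of_int a * 2 powi b :: real))"
    by (intro countable_image) simp
  ultimately show ?thesis by simp
qed

lemma powi_times_half_power: "(2::real) powi k * (1 / 2 ^ n) = 2 powi (k - int n)"
proof -
  have "(2::real) powi (k - int n) = 2 powi k / 2 powi int n" by (rule power_int_diff) simp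
  then show ?thesis by (simp only: power_int_of_nat times_divide_eq_right mult_1_right)
qed

lemma thompson_F_preserves_dyadics:
  assumes f: "f \<in> thompson_F_set" and x: "x \<in> dyadics"
  shows "f x \<in> dyadics"
proof (cases "x \<in> {0<..<1}")
  case False
  then show ?thesis using thompson_F_outside[OF f] x by simp
next
  case True
  obtain n :: nat and b :: "nat \<Rightarrow> real" where b: "b 0 = 0" "b n = 1" "\<And>i. i \<le> n \<Longrightarrow> b i \<in> dyadics"
    "\<And>i. i < n \<Longrightarrow> b i < b (Suc i)"
    "\<And>i. i < n \<Longrightarrow> \<exists>(k::int) c. \<forall>x\<in>{b i..b (Suc i)}. f x = 2 powi k * x + c"
    using f by (auto simp: thompson_F_set_def)
  have piece: "\<exists>k::int. \<forall>x\<in>{b i..b (Suc i)}. f x = f (b i) + 2 powi k * (x - b i)" if i: "i < n" for i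
  proof -
    obtain k :: int and c where "\<forall>x\<in>{b i..b (Suc i)}. f x = 2 powi k * x + c" using b(5)[OF i] by blast
    then show ?thesis using b(4)[OF i] by (intro exI[of _ k]) (auto simp: algebra_simps)
  qed
  have ends: "f (b i) \<in> dyadics" if "i \<le> n" for i
    using that
  proof (induction i)
    case 0 then show ?case using b(1) thompson_F_fixes_ends(1)[OF f] dyadics_basic by simp
  next
    case (Suc i)
    then have i: "i < n" by simp
    then obtain k :: int where k: "\<forall>x\<in>{b i..b (Suc i)}. f x = f (b i) + 2 powi k * (x - b i)"
      using piece by blast
    have "b (Suc i) \<in> {b i..b (Suc i)}" using b(4)[OF i] by simp
    with k have eq: "f (b (Suc i)) = f (b i) + 2 powi k * (b (Suc i) - b i)" by blast
    have "f (b i) \<in> dyadics" "b i \<in> dyadics" "b (Suc i) \<in> dyadics" using Suc b(3) i by simp_all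
    then show ?case unfolding eq by (intro dyadics_add dyadics_scale dyadics_diff)
  qed
  obtain i where i: "i < n" "b i \<le> x" "x < b (Suc i)"
    using bracket_exists[of b x n] b(1,2) True by auto
  from piece[OF i(1)] obtain k :: int where k: "\<forall>x\<in>{b i..b (Suc i)}. f x = f (b i) + 2 powi k * (x - b i)"
    by blast
  have "x \<in> {b i..b (Suc i)}" using i by simp
  with k have eq: "f x = f (b i) + 2 powi k * (x - b i)" by blast
  have "f (b i) \<in> dyadics" "b i \<in> dyadics" using ends b(3) i(1) by simp_all
  then show ?thesis unfolding eq using x by (intro dyadics_add dyadics_scale dyadics_diff)
qed

lemma thompson_F_acts: "right_action thompson_F dyadic_points thompson_act"
  unfolding right_action_def
proof (intro conjI ballI)
  fix x f assume x: "x \<in> dyadic_points" and "f \<in> carrier thompson_F"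
  then have f: "f \<in> thompson_F_set" by (simp add: thompson_F_simps)
  show "thompson_act x f \<in> dyadic_points"
    using x thompson_F_preserves_dyadics[OF f] thompson_F_strict_mono[OF f, of 0 x]
      thompson_F_strict_mono[OF f, of x 1] thompson_F_fixes_ends[OF f]
    by (auto simp: dyadic_points_def thompson_act_def)
qed (auto simp: thompson_act_def thompson_F_simps)

text \<open>
  The set that the walk cannot decide to stay in or to avoid: a ray of the Schreier graph that converges
  to \<open>0\<close>.
\<close>

definition halving_ray :: "real set" where
  "halving_ray = {1 / 2 ^ Suc k | k :: nat. True}"

text \<open>
  Near \<open>0\<close> an element of \<open>F\<close> multiplies by a power of two, so only finitely many points leave the ray.
  The points that enter it are those that leave it under the inverse.
\<close>

lemma halving_ray_almost_invariant:
  assumes "f \<in> carrier thompson_F"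
  shows "finite {x \<in> dyadic_points. (x \<in> halving_ray) \<noteq> (thompson_act x f \<in> halving_ray)}"
proof -
  have leave: "finite {x \<in> halving_ray. f x \<notin> halving_ray}" if f: "f \<in> thompson_F_set" for f
  proof -
    obtain k :: int and e where e: "e > 0" "\<And>x. x \<in> {0..e} \<Longrightarrow> f x = 2 powi k * x"
      using thompson_F_germ_at_0[OF f] by blast
    obtain N where N: "(1/2) ^ N < e" using real_arch_pow_inv[of e "1/2"] e(1) by auto
    have "x \<in> (\<lambda>j. 1 / 2 ^ Suc j) ` {..<N + nat \<bar>k\<bar>}" if x: "x \<in> halving_ray" "f x \<notin> halving_ray" for x
    proof -
      obtain j where j: "x = 1 / 2 ^ Suc j" using x(1) by (auto simp: halving_ray_def)
      have "j < N + nat \<bar>k\<bar>"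
      proof (rule ccontr)
        assume "\<not> j < N + nat \<bar>k\<bar>"
        then have jN: "N \<le> Suc j" and l: "k \<le> int j" by linarith+
        have "x = (1/2) ^ Suc j" by (simp add: j power_one_over)
        also have "\<dots> \<le> (1/2) ^ N" using jN by (intro power_decreasing) auto
        finally have "f x = 2 powi k * x" using N j by (intro e(2)) auto
        also have "\<dots> = 2 powi (k - int (Suc j))" unfolding j by (rule powi_times_half_power)
        also have "k - int (Suc j) = - int (Suc (nat (int j - k)))" using l by simp
        also have "2 powi (- int (Suc (nat (int j - k)))) = (1::real) / 2 ^ Suc (nat (int j - k))"
          by (simp only: power_int_minus power_int_of_nat inverse_eq_divide)
        finally show False using x(2) by (auto simp: halving_ray_def)
      qed
      then show ?thesis using j by blast
    qed
    then have "{x \<in> halving_ray. f x \<notin> halving_ray} \<subseteq> (\<lambda>j. 1 / 2 ^ Suc j) ` {..<N + nat \<bar>k\<bar>}" by blast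
    then show ?thesis by (rule finite_subset) simp
  qed
  have f: "f \<in> thompson_F_set" using assms by (simp add: thompson_F_simps)
  let ?i = "inv_into UNIV f"
  have bij: "bij f" by (rule thompson_F_bij[OF f])
  have "{x. x \<notin> halving_ray \<and> f x \<in> halving_ray} \<subseteq> ?i ` {y \<in> halving_ray. ?i y \<notin> halving_ray}"
    using bij by (auto simp: image_iff bij_def) (metis inv_f_f)
  then have "finite {x. x \<notin> halving_ray \<and> f x \<in> halving_ray}"
    using leave[OF thompson_inv_closed[OF f]] finite_subset by blast
  with leave[OF f] have "finite ({x \<in> halving_ray. f x \<notin> halving_ray} \<union> {x. x \<notin> halving_ray \<and> f x \<in> halving_ray})"
    by simp
  then show ?thesis by (rule finite_subset[rotated]) (auto simp: thompson_act_def)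
qed

lemma thompson_F_power_add:
  assumes "g \<in> thompson_F_set"
  shows "(g [^]\<^bsub>thompson_F\<^esub> (i + j :: int)) x = (g [^]\<^bsub>thompson_F\<^esub> j) ((g [^]\<^bsub>thompson_F\<^esub> i) x)"
  using group.int_pow_mult[OF group_thompson_F, of g i j] assms by (simp add: thompson_F_simps)

lemma thompson_F_power_1:
  assumes "g \<in> thompson_F_set"
  shows "g [^]\<^bsub>thompson_F\<^esub> (1 :: int) = g"
  using group.int_pow_1[OF group_thompson_F, of g] assms by (simp add: thompson_F_simps)

lemma thompson_F_power_closed: "g \<in> thompson_F_set \<Longrightarrow> g [^]\<^bsub>thompson_F\<^esub> (i :: int) \<in> thompson_F_set"
  using group.int_pow_closed[OF group_thompson_F, of g i] by (simp add: thompson_F_simps)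

lemma ramp_increases: "0 < d \<Longrightarrow> x \<in> {0<..<1} \<Longrightarrow> x < ramp 0 d x"
  by (auto simp: ramp_def)

lemma power_increases:
  assumes g: "g \<in> thompson_F_set" and up: "\<And>x. x \<in> {0<..<1} \<Longrightarrow> x < g x"
    and x: "x \<in> {0<..<1}" and ij: "i < j"
  shows "(g [^]\<^bsub>thompson_F\<^esub> (i :: int)) x < (g [^]\<^bsub>thompson_F\<^esub> j) x"
proof -
  have inside: "(g [^]\<^bsub>thompson_F\<^esub> (k :: int)) x \<in> {0<..<1}" for k
  proof -
    have h: "g [^]\<^bsub>thompson_F\<^esub> k \<in> thompson_F_set" by (rule thompson_F_power_closed[OF g])
    show ?thesis using x thompson_F_strict_mono[OF h, of 0 x] thompson_F_strict_mono[OF h, of x 1]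
        thompson_F_fixes_ends[OF h] by auto
  qed
  have "(g [^]\<^bsub>thompson_F\<^esub> i) x < (g [^]\<^bsub>thompson_F\<^esub> (i + int (Suc n))) x" for n
  proof (induction n)
    case 0
    show ?case using up[OF inside[of i]] thompson_F_power_add[OF g, of i 1 x] thompson_F_power_1[OF g] by simp
  next
    case (Suc n)
    also have "(g [^]\<^bsub>thompson_F\<^esub> (i + int (Suc n))) x < (g [^]\<^bsub>thompson_F\<^esub> ((i + int (Suc n)) + 1)) x"
      using up[OF inside[of "i + int (Suc n)"]] thompson_F_power_add[OF g, of "i + int (Suc n)" 1 x]
        thompson_F_power_1[OF g] by simp
    finally show ?case by (simp add: algebra_simps)
  qed
  from this[of "nat (j - i - 1)"] ij show ?thesis by simp
qed

text \<open>
  With \<open>d = 1 / 2 ^ L\<close> the map \<open>ramp 0 d\<close> translates by \<open>d\<close> between \<open>d\<close> and \<open>1 - 2 * d\<close>, so it runs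
  through all multiples of \<open>d\<close> inside \<open>(0,1)\<close>; below \<open>2 * d\<close> its inverse halves.  For \<open>L\<close> large the finite set
  consists of multiples of \<open>d\<close>.  The orbits are infinite because every point moves up.
\<close>

lemma dyadic_points_in_one_orbit:
  assumes K: "finite K" "K \<subseteq> dyadic_points"
  shows "\<exists>g\<in>carrier thompson_F.
      (\<forall>x\<in>dyadic_points. inj (\<lambda>j::int. thompson_act x (g [^]\<^bsub>thompson_F\<^esub> j))) \<and>
      (\<forall>x\<in>K. \<exists>d::int. x = thompson_act (1/2) (g [^]\<^bsub>thompson_F\<^esub> d)) \<and>
      (\<exists>D::int. \<forall>j\<ge>D. thompson_act (1/2) (g [^]\<^bsub>thompson_F\<^esub> (-j)) \<in> halving_ray \<and>
                      thompson_act (1/2) (g [^]\<^bsub>thompson_F\<^esub> j) \<notin> halving_ray)"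
proof -
  have "K \<subseteq> dyadics" using K(2) by (auto simp: dyadic_points_def)
  with K(1) obtain L0 where L0: "\<forall>L\<ge>L0. \<forall>x\<in>K. \<exists>a::int. x = of_int a / 2 ^ L"
    using finite_dyadics_common_level by blast
  define L where "L = L0 + 2"
  define d where "d = (1::real) / 2 ^ L"
  define g where "g = ramp 0 d"
  have d: "0 < d" "0 + 3 * d < 1" "4 * d \<le> 1"
  proof -
    have "(2::real) ^ 2 \<le> 2 ^ L" by (intro power_increasing) (auto simp: L_def)
    then have "4 * d \<le> 1" by (simp add: d_def field_simps)
    then show "0 < d" "0 + 3 * d < 1" "4 * d \<le> 1" by (auto simp: d_def)
  qed
  have g: "g \<in> thompson_F_set"
    unfolding g_def using d by (intro ramp_thompson[where M = L]) (auto simp: d_def dyadics_basic)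
  note pieces = ramp_pieces[OF d(1,2), folded g_def]
  let ?P = "\<lambda>j::int. g [^]\<^bsub>thompson_F\<^esub> j"
  note add = thompson_F_power_add[OF g]
  note one = thompson_F_power_1[OF g]
  have up: "x < g x" if "x \<in> {0<..<1}" for x unfolding g_def using d(1) that by (rule ramp_increases)
  have forward: "Suc n < 2 ^ L \<Longrightarrow> ?P (int n) d = real (Suc n) * d" for n
  proof (induction n)
    case 0 then show ?case by (simp add: thompson_F_simps)
  next
    case (Suc n)
    have "real (n + 3) \<le> real (2 ^ L)" using Suc.prems by (intro of_nat_mono) simp
    then have "real (n + 3) * d \<le> 1" by (simp add: d_def field_simps)
    then have "g (real (Suc n) * d) = real (Suc n) * d + d"
      using d(1) by (intro pieces) (auto simp: algebra_simps)
    then show ?case using Suc add[of "int n" 1 d] one by (simp add: algebra_simps)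
  qed
  have backward: "?P (- int n) d = 1 / 2 ^ (L + n)" for n
  proof (induction n)
    case 0 then show ?case by (simp add: thompson_F_simps d_def)
  next
    case (Suc n)
    have "g (1 / 2 ^ (L + Suc n)) = 2 * (1 / 2 ^ (L + Suc n)) - 0"
    proof (rule pieces)
      have "(1::real) / 2 ^ (L + Suc n) \<le> 1 / 2 ^ L" by (intro divide_left_mono power_increasing) auto
      then show "1 / 2 ^ (L + Suc n) \<le> 0 + d" by (simp add: d_def)
    qed simp
    also have "\<dots> = ?P (- int n) d" using Suc by simp
    also have "\<dots> = g (?P (- int (Suc n)) d)" using add[of "- int (Suc n)" 1 d] one by simp
    finally show ?case using thompson_F_bij[OF g] by (simp add: bij_def inj_eq)
  qed
  \<comment> \<open>the number of steps from \<open>d\<close> to \<open>1/2\<close>\<close>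
  define h where "h = int (2 ^ (L - 1)) - 1"
  have half: "?P h d = 1/2"
  proof -
    have L: "L = Suc (L - 1)" by (simp add: L_def)
    have "2 ^ L = 2 * (2 ^ (L - 1) :: nat)" by (subst L) simp
    then have "Suc (2 ^ (L - 1) - 1) < 2 ^ L" by simp
    from forward[OF this] have "?P h d = 2 ^ (L - 1) * d" by (simp add: h_def of_nat_diff)
    also have "2 ^ (L - 1) * d = 1/2" unfolding d_def by (subst (2) L) simp
    finally show ?thesis .
  qed
  have base_change: "?P j (1/2) = ?P (h + j) d" for j using add[of h j d] half by simp
  show ?thesis
  proof (intro bexI[of _ g] conjI ballI)
    fix x assume "x \<in> dyadic_points"
    then have x: "x \<in> {0<..<1}" by (simp add: dyadic_points_def)
    show "inj (\<lambda>j::int. thompson_act x (?P j))"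
    proof (rule injI)
      fix i j assume "thompson_act x (?P i) = thompson_act x (?P j)"
      then show "i = j"
        using power_increases[OF g up x, of i j] power_increases[OF g up x, of j i]
        by (cases i j rule: linorder_cases) (auto simp: thompson_act_def)
    qed
  next
    fix x assume x: "x \<in> K"
    have "L0 \<le> L" by (simp add: L_def)
    then obtain a :: int where a: "x = of_int a / 2 ^ L" using L0 x by blast
    have "0 < x" "x < 1" using x K(2) by (auto simp: dyadic_points_def)
    then have "0 < a" "real_of_int a < real_of_int (2 ^ L)" by (auto simp: a zero_less_divide_iff)
    then have "0 < a" "a < 2 ^ L" by (auto simp only: of_int_less_iff)
    then have "int (Suc (nat (a - 1))) < int (2 ^ L)" by simp
    then have "Suc (nat (a - 1)) < 2 ^ L" by (simp only: of_nat_less_iff)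
    from forward[OF this] \<open>0 < a\<close> have "?P (a - 1) d = x" by (simp add: a d_def)
    then have "x = ?P (a - 1 - h) (1/2)" by (simp add: base_change)
    then show "\<exists>d::int. x = thompson_act (1/2) (?P d)" by (auto simp: thompson_act_def)
  next
    have "?P (- j) (1/2) \<in> halving_ray \<and> ?P j (1/2) \<notin> halving_ray" if j: "j \<ge> h + 1" for j
    proof
      have h0: "h \<ge> 0" by (simp add: h_def)
      have "?P (- j) (1/2) = ?P (- int (nat (j - h))) d" using j by (simp add: base_change)
      also have "\<dots> = 1 / 2 ^ Suc (L + nat (j - h) - 1)" unfolding backward by (simp add: L_def)
      finally show "?P (- j) (1/2) \<in> halving_ray" unfolding halving_ray_def by blast
      have "1/2 < ?P j (1/2)"
        using power_increases[OF g up, of "1/2" 0 j] j h0 by (simp add: thompson_F_simps)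
      moreover have "y \<le> 1/2" if "y \<in> halving_ray" for y
        using that by (auto simp: halving_ray_def)
      ultimately show "?P j (1/2) \<notin> halving_ray" by fastforce
    qed
    then show "\<exists>D::int. \<forall>j\<ge>D. thompson_act (1/2) (?P (-j)) \<in> halving_ray \<and> thompson_act (1/2) (?P j) \<notin> halving_ray"
      by (auto simp: thompson_act_def)
  qed (use g in \<open>simp add: thompson_F_simps\<close>)
qed

lemma transitive_thompson_F: "transitive_action thompson_F dyadic_points thompson_act"
  unfolding transitive_action_def
proof (intro ballI)
  fix x y assume "x \<in> dyadic_points" "y \<in> dyadic_points"
  then obtain g and i j :: int where g: "g \<in> carrier thompson_F"
    and xy: "x = (g [^]\<^bsub>thompson_F\<^esub> i) (1/2)" "y = (g [^]\<^bsub>thompson_F\<^esub> j) (1/2)"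
    using dyadic_points_in_one_orbit[of "{x, y}"] by (auto simp: thompson_act_def)
  then have "thompson_act x (g [^]\<^bsub>thompson_F\<^esub> (j - i)) = y"
    using thompson_F_power_add[of g i "j - i" "1/2"] by (simp add: thompson_act_def thompson_F_simps)
  moreover have "g [^]\<^bsub>thompson_F\<^esub> (j - i) \<in> carrier thompson_F"
    using g thompson_F_power_closed by (simp add: thompson_F_simps)
  ultimately show "\<exists>g\<in>carrier thompson_F. thompson_act x g = y" by blast
qed


section \<open>An invariant mean on the dyadic points\<close>

text \<open>
  Shifting by one changes only the first and the last summand.
\<close>

lemma shift_average_bound:
  fixes a :: "nat \<Rightarrow> real"
  assumes "\<And>j. \<bar>a j\<bar> \<le> C"
  shows "\<bar>(\<Sum>j<n. a j) - (\<Sum>j<n. a (j + r))\<bar> \<le> 2 * real r * C"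
proof (induction r)
  case (Suc r)
  have "(\<Sum>j<n. a (j + r)) - (\<Sum>j<n. a (j + Suc r)) = a r - a (n + r)"
  proof -
    have "(\<Sum>j<n. a (j + r) - a (Suc j + r)) = a (0 + r) - a (n + r)" by (rule sum_lessThan_telescope')
    then show ?thesis by (simp add: sum_subtractf)
  qed
  moreover have "\<bar>a r - a (n + r)\<bar> \<le> 2 * C" using assms[of r] assms[of "n + r"] by linarith
  ultimately have "\<bar>(\<Sum>j<n. a j) - (\<Sum>j<n. a (j + Suc r))\<bar> \<le> 2 * real r * C + 2 * C" using Suc by linarith
  then show ?case by (simp add: algebra_simps)
qed simp

text \<open>
  Tychonoff's theorem for the product of the intervals \<open>[- C \<phi>, C \<phi>]\<close> replaces the choice of an
  ultrafilter: along \<open>F\<close> all values converge at once, so linear identities and limits that hold along the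
  sequence pass to the cluster point.
\<close>

lemma limit_functional_exists:
  fixes L :: "nat \<Rightarrow> ('b \<Rightarrow> real) \<Rightarrow> real"
  assumes "\<And>n \<phi>. \<bar>L n \<phi>\<bar> \<le> C \<phi>"
  shows "\<exists>(m :: ('b \<Rightarrow> real) \<Rightarrow> real) F. F \<noteq> bot \<and> F \<le> filtermap L sequentially \<and> (\<forall>\<phi>. ((\<lambda>l. l \<phi>) \<longlongrightarrow> m \<phi>) F)"
proof -
  let ?B = "PiE UNIV (\<lambda>\<phi>. {- C \<phi>..C \<phi>})"
  have "compactin (product_topology (\<lambda>_. euclideanreal) UNIV) ?B"
    by (simp add: compactin_PiE)
  then have "compact ?B" by (simp add: euclidean_product_topology)
  moreover have "L n \<in> ?B" for n using assms[of n] by (auto simp: abs_le_iff minus_le_iff)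
  then have "eventually (\<lambda>l. l \<in> ?B) (filtermap L sequentially)" by (simp add: eventually_filtermap)
  moreover have "filtermap L sequentially \<noteq> bot" by (simp add: filtermap_bot_iff)
  ultimately obtain m where m: "inf (nhds m) (filtermap L sequentially) \<noteq> bot"
    unfolding compact_filter by blast
  have "((\<lambda>l. l \<phi>) \<longlongrightarrow> m \<phi>) (nhds m)" for \<phi>
  proof (rule topological_tendstoI)
    fix T :: "real set" assume T: "open T" "m \<phi> \<in> T"
    have "open ((\<lambda>l. l \<phi>) -` T)"
      using T(1) continuous_on_product_coordinates[of \<phi>] by (rule open_vimage)
    then show "eventually (\<lambda>l. l \<phi> \<in> T) (nhds m)"
      using T(2) by (auto simp: eventually_nhds)
  qed
  then have "((\<lambda>l. l \<phi>) \<longlongrightarrow> m \<phi>) (inf (nhds m) (filtermap L sequentially))" for \<phi>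
    by (rule tendsto_mono[OF inf_le1])
  with m show ?thesis
    by (intro exI[of _ m] exI[of _ "inf (nhds m) (filtermap L sequentially)"] conjI allI) simp_all
qed

text \<open>
  The averages over \<open>1/2, \<dots>, 1 / 2 ^ n\<close> are asymptotically invariant, because an element of \<open>F\<close> acts on
  the small points of the ray as a shift.
\<close>

lemma amenable_thompson_F: "amenable_action thompson_F dyadic_points thompson_act"
proof -
  let ?X = dyadic_points and ?b = "bounded_fun_on dyadic_points"
  define pt where "pt j = (1::real) / 2 ^ Suc j" for j :: nat
  have pt: "pt j \<in> ?X" for j
    using dyadics_basic(3)[of 1 "Suc j"] by (simp add: dyadic_points_def pt_def field_simps del: power_Suc)
  define L where "L n \<phi> = (if ?b \<phi> then (\<Sum>j<n. \<phi> (pt j)) / real n else 0)" for n and \<phi> :: "real \<Rightarrow> real"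
  have "\<exists>C. \<forall>n. \<bar>L n \<phi>\<bar> \<le> C" for \<phi>
  proof (cases "?b \<phi>")
    case True
    then obtain C where C: "\<And>x. x \<in> ?X \<Longrightarrow> \<bar>\<phi> x\<bar> \<le> C" by (auto simp: bounded_fun_on_def)
    have "\<bar>L n \<phi>\<bar> \<le> C" for n
    proof (cases "n = 0")
      case True then show ?thesis using C[OF pt[of 0]] by (simp add: L_def)
    next
      case False
      have "\<bar>\<Sum>j<n. \<phi> (pt j)\<bar> \<le> (\<Sum>j<n. \<bar>\<phi> (pt j)\<bar>)" by (rule sum_abs)
      also have "\<dots> \<le> real n * C" using sum_bounded_above[of "{..<n}" "\<lambda>j. \<bar>\<phi> (pt j)\<bar>" C] C pt by simp
      finally show ?thesis using False \<open>?b \<phi>\<close> by (simp add: L_def divide_le_eq mult.commute)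
    qed
    then show ?thesis by blast
  qed (auto simp: L_def intro!: exI[of _ 0])
  then obtain C where "\<And>n \<phi>. \<bar>L n \<phi>\<bar> \<le> C \<phi>" by metis
  from limit_functional_exists[of L, OF this]
  obtain m and F where F: "F \<noteq> bot" "F \<le> filtermap L sequentially" and m: "\<And>\<phi>. ((\<lambda>l. l \<phi>) \<longlongrightarrow> m \<phi>) F"
    by blast
  have along: "(\<Psi> \<longlongrightarrow> c) F" if "(\<lambda>n. \<Psi> (L n)) \<longlonglongrightarrow> c" for \<Psi> :: "((real \<Rightarrow> real) \<Rightarrow> real) \<Rightarrow> real" and c
  proof -
    have "(\<Psi> \<longlongrightarrow> c) (filtermap L sequentially)" using that by (simp add: filterlim_filtermap)
    then show ?thesis by (rule tendsto_mono[OF F(2)])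
  qed
  have zero: "c = 0" if "(\<Psi> \<longlongrightarrow> c) F" "(\<lambda>n. \<Psi> (L n)) \<longlonglongrightarrow> 0" for \<Psi> and c :: real
    using tendsto_unique[OF F(1) that(1) along[OF that(2)]] .
  have bsum: "?b (\<lambda>x. f x + g x)" if "?b f" "?b g" for f g
    using that unfolding bounded_fun_on_def by (metis abs_triangle_ineq add_mono order_trans)
  have bscale: "?b (\<lambda>x. c * f x)" if "?b f" for f c
    using that unfolding bounded_fun_on_def by (metis abs_mult abs_ge_zero mult_left_mono)
  have "is_mean ?X m"
    unfolding is_mean_def
  proof (intro conjI allI impI)
    fix f g assume fg: "?b f" "?b g"
    have "((\<lambda>l. l (\<lambda>x. f x + g x) - (l f + l g)) \<longlongrightarrow> m (\<lambda>x. f x + g x) - (m f + m g)) F"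
      by (intro tendsto_intros m)
    moreover have "(\<lambda>n. L n (\<lambda>x. f x + g x) - (L n f + L n g)) = (\<lambda>n. 0)"
      using fg bsum by (auto simp: L_def sum.distrib add_divide_distrib)
    ultimately show "m (\<lambda>x. f x + g x) = m f + m g" using zero by fastforce
  next
    fix c f assume f: "?b f"
    have "((\<lambda>l. l (\<lambda>x. c * f x) - c * l f) \<longlongrightarrow> m (\<lambda>x. c * f x) - c * m f) F"
      by (intro tendsto_intros m)
    moreover have "(\<lambda>n. L n (\<lambda>x. c * f x) - c * L n f) = (\<lambda>n. 0)"
      using f bscale by (auto simp: L_def sum_distrib_left)
    ultimately show "m (\<lambda>x. c * f x) = c * m f" using zero by fastforce
  next
    fix f assume f: "?b f" "\<forall>x\<in>?X. 0 \<le> f x"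
    have "L n f \<ge> 0" for n using f pt by (auto simp: L_def intro!: sum_nonneg divide_nonneg_nonneg)
    then have "eventually (\<lambda>l. 0 \<le> l f) (filtermap L sequentially)" by (simp add: eventually_filtermap)
    then have "eventually (\<lambda>l. 0 \<le> l f) F" using F(2) by (rule filter_leD[rotated])
    then show "0 \<le> m f" using tendsto_lowerbound[OF m _ F(1)] by blast
  next
    have b1: "?b (\<lambda>x. 1)" by (auto simp: bounded_fun_on_def)
    have "(\<lambda>n. L n (\<lambda>x. 1)) \<longlonglongrightarrow> 1"
      using b1 by (intro tendsto_eventually) (auto simp: L_def intro!: eventually_sequentiallyI[of 1])
    from tendsto_unique[OF F(1) m along[OF this]] show "m (\<lambda>x. 1) = 1" .
  qed
  moreover have "m (\<lambda>x. f (thompson_act x g)) = m f" if g: "g \<in> carrier thompson_F" and f: "?b f" for f g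
  proof -
    have gF: "g \<in> thompson_F_set" using g by (simp add: thompson_F_simps)
    have gX: "g x \<in> ?X" if "x \<in> ?X" for x
      using thompson_F_acts g that by (auto simp: right_action_def thompson_act_def)
    obtain C where C: "\<And>x. x \<in> ?X \<Longrightarrow> \<bar>f x\<bar> \<le> C" using f by (auto simp: bounded_fun_on_def)
    have fg: "?b (\<lambda>x. f (g x))" using C gX by (auto simp: bounded_fun_on_def)
    obtain k :: int and e where e: "e > 0" "\<And>x. x \<in> {0..e} \<Longrightarrow> g x = 2 powi k * x"
      using thompson_F_germ_at_0[OF gF] by blast
    obtain N where N: "(1/2) ^ N < e" using real_arch_pow_inv[of e "1/2"] e(1) by auto
    \<comment> \<open>\<open>r\<close> steps into the ray the element acts linearly and keeps the points inside the ray\<close>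
    define r where "r = N + nat \<bar>k\<bar>"
    define s where "s = nat (int r - k)"
    have shift: "g (pt (j + r)) = pt (j + s)" for j
    proof -
      have "pt (j + r) = (1/2) ^ Suc (j + r)" by (simp add: pt_def power_one_over)
      also have "\<dots> \<le> (1/2) ^ N" by (intro power_decreasing) (auto simp: r_def)
      finally have "g (pt (j + r)) = 2 powi k * pt (j + r)" using N by (intro e(2)) (auto simp: pt_def)
      also have "\<dots> = 2 powi (k - int (Suc (j + r)))" unfolding pt_def by (rule powi_times_half_power)
      also have "k - int (Suc (j + r)) = - int (Suc (j + s))" by (auto simp: s_def r_def)
      also have "2 powi (- int (Suc (j + s))) = pt (j + s)"
        by (simp only: pt_def power_int_minus power_int_of_nat inverse_eq_divide)
      finally show ?thesis .
    qed
    define c where "c = 2 * real r * C + 2 * real s * C"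
    have "\<bar>(\<Sum>j<n. f (g (pt j))) - (\<Sum>j<n. f (pt j))\<bar> \<le> c" for n
    proof -
      have "\<bar>(\<Sum>j<n. f (g (pt j))) - (\<Sum>j<n. f (g (pt (j + r))))\<bar> \<le> 2 * real r * C"
        using C gX pt by (intro shift_average_bound[of "\<lambda>j. f (g (pt j))"]) auto
      moreover have "\<bar>(\<Sum>j<n. f (pt j)) - (\<Sum>j<n. f (pt (j + s)))\<bar> \<le> 2 * real s * C"
        using C pt by (intro shift_average_bound[of "\<lambda>j. f (pt j)"]) auto
      ultimately show ?thesis unfolding shift c_def by linarith
    qed
    then have bound: "norm (L n (\<lambda>x. f (g x)) - L n f) \<le> c / real n" for n
      using f fg by (simp add: L_def diff_divide_distrib[symmetric] abs_divide divide_right_mono)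
    have "(\<lambda>n. c / real n) \<longlonglongrightarrow> 0" by (rule lim_const_over_n)
    then have "(\<lambda>n. L n (\<lambda>x. f (g x)) - L n f) \<longlonglongrightarrow> 0"
      by (rule Lim_null_comparison[rotated]) (simp add: bound del: real_norm_def)
    moreover have "((\<lambda>l. l (\<lambda>x. f (g x)) - l f) \<longlongrightarrow> m (\<lambda>x. f (g x)) - m f) F"
      by (intro tendsto_intros m)
    ultimately have "m (\<lambda>x. f (g x)) - m f = 0" by (rule zero[rotated])
    then show ?thesis by (simp add: thompson_act_def)
  qed
  ultimately show ?thesis unfolding amenable_action_def by blast
qed

section \<open>Averages over discrete distributions and geometric waiting times\<close>

lemma pmf_integrable_bounded:
  fixes f :: "'a \<Rightarrow> real"
  assumes "\<And>x. x \<in> set_pmf M \<Longrightarrow> \<bar>f x\<bar> \<le> C"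
  shows "integrable (measure_pmf M) f"
  using assms by (intro measure_pmf.integrable_const_bound[where B = C]) (auto simp: AE_measure_pmf_iff)

lemma pmf_integral_mono:
  fixes f g :: "'a \<Rightarrow> real"
  assumes "\<And>x. x \<in> set_pmf M \<Longrightarrow> \<bar>f x\<bar> \<le> C" "\<And>x. x \<in> set_pmf M \<Longrightarrow> \<bar>g x\<bar> \<le> D"
    and "\<And>x. x \<in> set_pmf M \<Longrightarrow> f x \<le> g x"
  shows "measure_pmf.expectation M f \<le> measure_pmf.expectation M g"
  using assms pmf_integrable_bounded[of M f C] pmf_integrable_bounded[of M g D]
  by (intro integral_mono_AE) (auto simp: AE_measure_pmf_iff)

lemma pmf_integral_le:
  fixes f :: "'a \<Rightarrow> real"
  assumes "\<And>x. x \<in> set_pmf M \<Longrightarrow> \<bar>f x\<bar> \<le> C" "\<And>x. x \<in> set_pmf M \<Longrightarrow> f x \<le> a"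
  shows "measure_pmf.expectation M f \<le> a"
  using pmf_integral_mono[of M f C "\<lambda>_. a" "\<bar>a\<bar>"] assms by simp

lemma pmf_integral_abs_le:
  fixes f :: "'a \<Rightarrow> real"
  assumes "\<And>x. x \<in> set_pmf M \<Longrightarrow> \<bar>f x\<bar> \<le> C"
  shows "\<bar>measure_pmf.expectation M f\<bar> \<le> C"
proof -
  have "f x \<le> C \<and> - f x \<le> C" if "x \<in> set_pmf M" for x using assms[OF that] by linarith
  then show ?thesis
    using pmf_integral_le[of M f C C] pmf_integral_le[of M "\<lambda>x. - f x" C C] assms by auto
qed

lemma pmf_integral_bind:
  fixes f :: "'b \<Rightarrow> real"
  assumes "\<And>x y. x \<in> set_pmf M \<Longrightarrow> y \<in> set_pmf (N x) \<Longrightarrow> \<bar>f y\<bar> \<le> C"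
  shows "measure_pmf.expectation (bind_pmf M N) f =
         measure_pmf.expectation M (\<lambda>x. measure_pmf.expectation (N x) f)"
proof -
  define h where "h y = (if \<bar>f y\<bar> \<le> C then f y else 0)" for y
  have "measure_pmf.expectation (bind_pmf M N) f = measure_pmf.expectation (bind_pmf M N) h"
    using assms by (intro integral_cong_AE) (auto simp: AE_measure_pmf_iff h_def)
  also have "\<dots> = measure_pmf.expectation M (\<lambda>x. measure_pmf.expectation (N x) h)"
    unfolding measure_pmf_bind
    by (rule integral_bind[where K = "count_space UNIV" and B = "\<bar>C\<bar>" and B' = 1])
       (auto simp: h_def measure_pmf_in_subprob_algebra intro: measure_pmf.finite_measure_axioms)
  also have "\<dots> = measure_pmf.expectation M (\<lambda>x. measure_pmf.expectation (N x) f)"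
    using assms by (intro integral_cong_AE) (auto simp: AE_measure_pmf_iff h_def intro!: integral_cong_AE)
  finally show ?thesis .
qed

lemma geometric_tail:
  "measure_pmf.prob (geometric_pmf (1/2)) {m<..} = 1 / 2 ^ Suc m"
proof -
  have "measure_pmf.prob (geometric_pmf (1/2)) {..m} = (\<Sum>k\<le>m. (1/2) ^ k * (1/2 :: real))"
    by (subst measure_measure_pmf_finite) auto
  also have "\<dots> = 1 - 1 / 2 ^ Suc m"
    by (induction m) (auto simp: field_simps)
  finally have "measure_pmf.prob (geometric_pmf (1/2)) (UNIV - {..m}) = 1 / 2 ^ Suc m"
    by (subst measure_pmf.prob_compl[of "{..m}", simplified]) simp_all
  moreover have "UNIV - {..m} = {m<..}" by auto
  ultimately show ?thesis by simp
qed

text \<open>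
  The way in which the mixture is used: a crude bound \<open>a\<close> on the components up to \<open>m\<close> and a good bound
  \<open>b\<close> on the later ones.
\<close>

lemma geometric_split:
  fixes \<psi> :: "nat \<Rightarrow> real"
  assumes "\<And>k. \<bar>\<psi> k\<bar> \<le> C" "\<And>k. k \<le> m \<Longrightarrow> \<psi> k \<le> a" "\<And>k. k > m \<Longrightarrow> \<psi> k \<le> b"
  shows "measure_pmf.expectation (geometric_pmf (1/2)) \<psi> \<le> (1 - 1 / 2 ^ Suc m) * a + (1 / 2 ^ Suc m) * b"
proof -
  have "measure_pmf.expectation (geometric_pmf (1/2)) \<psi> \<le>
      measure_pmf.expectation (geometric_pmf (1/2)) (\<lambda>k. a + (b - a) * indicator {m<..} k)"
    using assms by (intro pmf_integral_mono[where C = C and D = "\<bar>a\<bar> + \<bar>b\<bar>"]) (auto simp: indicator_def not_less)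
  also have "\<dots> = a + (b - a) * measure_pmf.prob (geometric_pmf (1/2)) {m<..}"
    by (subst Bochner_Integration.integral_add) (auto simp: measure_pmf.emeasure_eq_measure)
  also have "\<dots> = (1 - 1 / 2 ^ Suc m) * a + (1 / 2 ^ Suc m) * b"
    unfolding geometric_tail by (simp add: algebra_simps diff_divide_distrib)
  finally show ?thesis .
qed

text \<open>
  Running \<open>R\<close> steps, each of which succeeds with probability \<open>T\<close> and then achieves the bound \<open>b\<close>, leaves
  the initial bound \<open>M\<close> with weight \<open>(1 - T) ^ R\<close> only.  The predicate \<open>\<Phi> r a\<close> stands for a bound \<open>a\<close> at
  all points reachable in \<open>r\<close> steps; a bound one step further out gives a bound at distance \<open>r\<close>.
\<close>

lemma backward_iteration:
  fixes T M b :: real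
  assumes "\<And>r a. r < R \<Longrightarrow> \<Phi> (Suc r) a \<Longrightarrow> \<Phi> r ((1 - T) * a + T * b)" "\<Phi> R M"
  shows "\<Phi> 0 ((1 - T) ^ R * (M - b) + b)"
proof -
  have "s \<le> R \<Longrightarrow> \<Phi> (R - s) ((1 - T) ^ s * (M - b) + b)" for s
  proof (induction s)
    case (Suc s)
    then have "\<Phi> (R - Suc s) ((1 - T) * ((1 - T) ^ s * (M - b) + b) + T * b)"
      using assms(1)[of "R - Suc s" "(1 - T) ^ s * (M - b) + b"] by (simp add: Suc_diff_Suc)
    then show ?case by (simp add: algebra_simps)
  qed (use assms in simp)
  from this[of R] show ?thesis by simp
qed

text \<open>
  The jumps with index above \<open>m\<close> have total weight \<open>1 / y\<close> with \<open>y = 2 ^ (m + 1)\<close>, and the chance to see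
  none of them in \<open>y\<^sup>2\<close> steps is at most \<open>exp (- y)\<close>.
\<close>

lemma late_jump_bound: "(1 - 1 / 2 ^ Suc m :: real) ^ (4 ^ Suc m) \<le> 1 / 2 ^ Suc m"
proof -
  define y :: real where "y = 2 ^ Suc m"
  have y: "y > 0" "y \<ge> 1" unfolding y_def by (simp_all del: power_Suc)
  have "(1 - 1 / y) ^ (4 ^ Suc m) \<le> exp (- (1 / y)) ^ (4 ^ Suc m)"
    using exp_ge_add_one_self[of "- (1 / y)"] y by (intro power_mono) auto
  also have "\<dots> = exp (- ((2 * 2) ^ Suc m / y))"
    by (simp add: exp_of_nat_mult[symmetric] del: power_Suc)
  also have "(2 * 2 :: real) ^ Suc m / y = y"
    unfolding y_def power_mult_distrib by simp
  also have "y \<le> exp y" using exp_ge_add_one_self[of y] by linarith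
  then have "exp (- y) \<le> 1 / y"
    using y frac_le[of 1 1 y "exp y"] by (simp add: exp_minus inverse_eq_divide)
  finally show ?thesis by (simp add: y_def)
qed


lemma le_of_geometric_error:
  fixes a b c :: real
  assumes "\<And>m. m \<ge> m0 \<Longrightarrow> a \<le> b + c / 2 ^ Suc m"
  shows "a \<le> b"
proof -
  have "(\<lambda>m. b + c * (1/2) ^ Suc m) \<longlonglongrightarrow> b + c * 0"
    by (intro tendsto_intros LIMSEQ_Suc LIMSEQ_power_zero) auto
  then have "(\<lambda>m. b + c / 2 ^ Suc m) \<longlonglongrightarrow> b" by (simp add: power_one_over)
  then show ?thesis using assms by (intro LIMSEQ_le_const[of _ b a]) auto
qed

text \<open>
  For \<open>m\<close> with \<open>4 ^ (m + 1) \<le> n < 4 ^ (m + 2)\<close> the first summand is at most \<open>exp (- sqrt n)\<close> and the second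
  is at most \<open>16 / n\<^sup>2\<close>.
\<close>

lemma summable_power_scales:
  fixes u :: "nat \<Rightarrow> real"
  assumes "\<And>n. 0 \<le> u n" "\<And>n m. u n \<le> (1 - 1 / 2 ^ Suc m) ^ n + 1 / 16 ^ Suc m"
  shows "summable u"
proof -
  have bound: "u n \<le> 272 / real n ^ 2" if "n \<ge> 4" for n
  proof -
    have "\<exists>k. 4 ^ k \<le> n \<and> n < 4 ^ (k + 1)" using that by (intro ex_power_ivl1) auto
    then obtain k where k: "4 ^ k \<le> n" "n < 4 ^ (k + 1)" by blast
    have "k \<noteq> 0" using k that by (auto intro: ccontr)
    then obtain m where m: "k = Suc m" by (cases k) auto
    define y :: real where "y = 2 ^ Suc m"
    have y: "y > 0" "y \<ge> 1" unfolding y_def by (simp_all del: power_Suc)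
    have y2: "y\<^sup>2 = 4 ^ Suc m" unfolding y_def power2_eq_square power_mult_distrib[symmetric] by simp
    have "real (4 ^ Suc m) \<le> real n" using k m by (intro of_nat_mono) simp
    then have yn: "y\<^sup>2 \<le> real n" by (simp add: y2)
    have "real n < real (4 ^ (Suc m + 1))" using k m by (intro of_nat_less_iff[THEN iffD2]) simp
    then have ny: "real n \<le> 4 * y\<^sup>2" by (simp add: y2)
    have n0: "real n > 0" using that by simp
    have "(1 - 1 / y) ^ n \<le> exp (- (1 / y)) ^ n"
      using exp_ge_add_one_self[of "- (1 / y)"] y by (intro power_mono) auto
    also have "\<dots> = exp (- (real n / y))" by (simp add: exp_of_nat_mult[symmetric])
    also have "\<dots> \<le> 256 / real n ^ 2"
    proof -
      define t where "t = real n / y"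
      have t: "t \<ge> 0" using y n0 by (simp add: t_def)
      \<comment> \<open>\<open>exp t\<close> dominates \<open>t ^ 4 / 256\<close>, and \<open>t\<^sup>2 \<ge> n\<close>\<close>
      have "t / 4 \<le> exp (t / 4)" using exp_ge_add_one_self[of "t / 4"] by linarith
      then have "(t / 4) ^ 4 \<le> exp (t / 4) ^ 4" using t by (intro power_mono) auto
      also have "\<dots> = exp t" by (simp add: exp_of_nat_mult[symmetric])
      finally have e: "t ^ 4 / 256 \<le> exp t" by (simp add: power_divide)
      have "real n \<le> t\<^sup>2"
        using yn y n0 by (simp add: t_def power_divide le_divide_eq power2_eq_square)
      then have "real n ^ 2 \<le> (t\<^sup>2) ^ 2" using n0 by (intro power_mono) auto
      then have "real n ^ 2 / 256 \<le> exp t" using e by (simp add: power_mult[symmetric])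
      then have "1 / exp t \<le> 1 / (real n ^ 2 / 256)" using n0 by (intro frac_le) auto
      then show ?thesis by (simp add: exp_minus t_def inverse_eq_divide)
    qed
    finally have 1: "(1 - 1 / y) ^ n \<le> 256 / real n ^ 2" .
    have "real n ^ 2 \<le> (4 * y\<^sup>2) ^ 2" using ny n0 by (intro power_mono) auto
    also have "\<dots> = 16 * (4 * 4) ^ Suc m"
      unfolding power_mult_distrib y2 by (simp add: power2_eq_square)
    finally have "real n ^ 2 \<le> 16 * 16 ^ Suc m" by simp
    then have 2: "1 / 16 ^ Suc m \<le> 16 / real n ^ 2" using n0 by (simp add: field_simps)
    have "u n \<le> (1 - 1 / y) ^ n + 1 / 16 ^ Suc m" unfolding y_def by (rule assms(2))
    also have "\<dots> \<le> 256 / real n ^ 2 + 16 / real n ^ 2" using 1 2 by (rule add_mono)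
    finally show ?thesis by (simp add: add_divide_distrib[symmetric])
  qed
  have "summable (\<lambda>n. inverse (real n ^ 2))" using inverse_power_summable[of 2, where 'a = real] by simp
  then have "summable (\<lambda>n. 272 * inverse (real n ^ 2))" by (rule summable_mult)
  moreover have "norm (u n) \<le> 272 * inverse (real n ^ 2)" if "n \<ge> 4" for n
    using bound[OF that] assms(1)[of n] by (simp add: divide_inverse)
  ultimately show ?thesis by (intro summable_comparison_test[of u "\<lambda>n. 272 * inverse (real n ^ 2)"]) blast+
qed


section \<open>Mixing distributions on the powers of one element\<close>

definition markov_op :: "('x \<Rightarrow> 'g \<Rightarrow> 'x) \<Rightarrow> 'g pmf \<Rightarrow> ('x \<Rightarrow> real) \<Rightarrow> 'x \<Rightarrow> real" where
  "markov_op act \<nu> f x = measure_pmf.expectation \<nu> (\<lambda>g. f (act x g))"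

text \<open>
  A window and its translate by \<open>d\<close> differ in at most \<open>\<bar>d\<bar>\<close> points on either side.
\<close>

lemma sum_shift_diff:
  fixes F :: "int \<Rightarrow> real"
  assumes "\<And>j. \<bar>F j\<bar> \<le> C"
  shows "\<bar>(\<Sum>j\<in>{-N..N}. F (d + j)) - (\<Sum>j\<in>{-N..N}. F j)\<bar> \<le> 2 * \<bar>of_int d\<bar> * C"
proof -
  have C: "C \<ge> 0" using assms[of 0] by linarith
  let ?I = "{d - N..d + N}" and ?J = "{-N..N}"
  have "(\<Sum>j\<in>{-N..N}. F (d + j)) = sum F ?I"
    by (rule sum.reindex_bij_witness[of _ "\<lambda>j. j - d" "\<lambda>j. d + j"]) auto
  moreover have "sum F ?I - sum F ?J = sum F (?I - ?J) - sum F (?J - ?I)"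
  proof -
    have "sum F ?I = sum F (?I - ?J) + sum F (?I \<inter> ?J)" "sum F ?J = sum F (?J - ?I) + sum F (?I \<inter> ?J)"
      by (subst sum.union_disjoint[symmetric]; auto intro!: sum.cong)+
    then show ?thesis by simp
  qed
  moreover have bound: "\<bar>sum F Z\<bar> \<le> \<bar>of_int d\<bar> * C" if "Z \<subseteq> {a..<a + \<bar>d\<bar>}" for Z a
  proof -
    have fin: "finite Z" using that finite_subset by blast
    have "card Z \<le> nat \<bar>d\<bar>" using card_mono[OF _ that] by simp
    then have "real (card Z) \<le> \<bar>of_int d\<bar>" by linarith
    have "\<bar>sum F Z\<bar> \<le> (\<Sum>j\<in>Z. \<bar>F j\<bar>)" by (rule sum_abs)
    also have "\<dots> \<le> of_nat (card Z) * C" using assms by (intro sum_bounded_above) auto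
    also have "\<dots> \<le> \<bar>of_int d\<bar> * C" using \<open>real (card Z) \<le> _\<close> C by (intro mult_right_mono) auto
    finally show ?thesis .
  qed
  moreover have "\<exists>a b. ?I - ?J \<subseteq> {a..<a + \<bar>d\<bar>} \<and> ?J - ?I \<subseteq> {b..<b + \<bar>d\<bar>}"
  proof (cases "d \<ge> 0")
    case True then show ?thesis by (intro exI[of _ "N + 1"] exI[of _ "- N"]) auto
  next
    case False then show ?thesis by (intro exI[of _ "d - N"] exI[of _ "d + N + 1"]) auto
  qed
  then have "\<bar>sum F (?I - ?J)\<bar> \<le> \<bar>of_int d\<bar> * C" "\<bar>sum F (?J - ?I)\<bar> \<le> \<bar>of_int d\<bar> * C"
    using bound by blast+
  ultimately show ?thesis by linarith
qed

text \<open>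
  The properties of the action on the dyadic points from which the random walk is built: a single cyclic
  subgroup, depending on the finite set \<open>K\<close>, connects all points of \<open>K\<close> by an infinite orbit with one tail
  in \<open>A\<close> and the other tail outside of \<open>A\<close>, and \<open>A\<close> has finite boundary in every Schreier graph.
\<close>

locale spreading_action = group G for G (structure) +
  fixes X :: "'x set" and act :: "'x \<Rightarrow> 'a \<Rightarrow> 'x" and p :: 'x and A :: "'x set" and S :: "'a set"
  assumes action: "right_action G X act"
    and countable_X: "countable X"
    and base: "p \<in> X"
    and gens: "finite_generating_set G S"
    and single_orbit: "\<And>K. finite K \<Longrightarrow> K \<subseteq> X \<Longrightarrow> \<exists>g\<in>carrier G.
          (\<forall>x\<in>X. inj (\<lambda>j::int. act x (g [^] j))) \<and>
          (\<forall>x\<in>K. \<exists>d::int. x = act p (g [^] d)) \<and>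
          (\<exists>D::int. \<forall>j\<ge>D. act p (g [^] (-j)) \<in> A \<and> act p (g [^] j) \<notin> A)"
    and almost_invariant: "\<And>g. g \<in> carrier G \<Longrightarrow> finite {x \<in> X. (x \<in> A) \<noteq> (act x g \<in> A)}"
begin

text \<open>
  The three effects of a single jump.  They are phrased by the action of \<open>\<nu>\<close> on functions, so that they
  can be inserted directly into the one-step equations for visit probabilities (\<open>u\<close>), for harmonic
  functions (\<open>f\<close>) and for the probability of never hitting \<open>B\<close> (\<open>q\<close>).
\<close>

definition spreads :: "real \<Rightarrow> 'a pmf \<Rightarrow> bool" where
  "spreads e \<nu> \<longleftrightarrow> (\<forall>u. (\<forall>x\<in>X. 0 \<le> u x) \<longrightarrow> (\<forall>Z. finite Z \<longrightarrow> Z \<subseteq> X \<longrightarrow> sum u Z \<le> 1) \<longrightarrow>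
     (\<forall>x\<in>X. markov_op act \<nu> u x \<le> e))"

definition merges :: "'x set \<Rightarrow> real \<Rightarrow> 'a pmf \<Rightarrow> bool" where
  "merges K e \<nu> \<longleftrightarrow> (\<forall>f C. (\<forall>x\<in>X. \<bar>f x\<bar> \<le> C) \<longrightarrow> (\<forall>x\<in>K. \<bar>markov_op act \<nu> f x - markov_op act \<nu> f p\<bar> \<le> C * e))"

definition hits_both_sides :: "'x set \<Rightarrow> 'a pmf \<Rightarrow> bool" where
  "hits_both_sides K \<nu> \<longleftrightarrow>
     (\<forall>B\<in>{A, - A}. \<forall>q C. (\<forall>x\<in>X. 0 \<le> q x \<and> q x \<le> C \<and> (x \<in> B \<longrightarrow> q x = 0)) \<longrightarrow>
        (\<forall>x\<in>K. markov_op act \<nu> q x \<le> 2/3 * C))"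

definition mixing :: "'x set \<Rightarrow> real \<Rightarrow> 'a pmf \<Rightarrow> bool" where
  "mixing K e \<nu> \<longleftrightarrow>
     finite (set_pmf \<nu>) \<and> set_pmf \<nu> \<subseteq> carrier G \<and> map_pmf (m_inv G) \<nu> = \<nu> \<and>
     spreads e \<nu> \<and> merges K e \<nu> \<and> hits_both_sides K \<nu>"

lemma spreadsD:
  assumes "spreads e \<nu>" "\<forall>x\<in>X. 0 \<le> u x" "\<And>Z. finite Z \<Longrightarrow> Z \<subseteq> X \<Longrightarrow> sum u Z \<le> 1" "x \<in> X"
  shows "markov_op act \<nu> u x \<le> e"
  using assms(1)[unfolded spreads_def, rule_format, of u x] assms(2-) by simp

lemma mergesD:
  assumes "merges K e \<nu>" "\<forall>x\<in>X. \<bar>f x\<bar> \<le> C" "x \<in> K"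
  shows "\<bar>markov_op act \<nu> f x - markov_op act \<nu> f p\<bar> \<le> C * e"
  using assms(1)[unfolded merges_def, rule_format, of f C x] assms(2-) by simp

lemma hits_both_sidesD:
  assumes "hits_both_sides K \<nu>" "B \<in> {A, - A}"
    and "\<forall>x\<in>X. 0 \<le> q x \<and> q x \<le> C \<and> (x \<in> B \<longrightarrow> q x = 0)" "x \<in> K"
  shows "markov_op act \<nu> q x \<le> 2/3 * C"
  using assms(1)[unfolded hits_both_sides_def, rule_format, of B q C x] assms(2-) by simp

lemma act_closed: "x \<in> X \<Longrightarrow> g \<in> carrier G \<Longrightarrow> act x g \<in> X"
  and act_one: "x \<in> X \<Longrightarrow> act x \<one> = x"
  and act_mult: "x \<in> X \<Longrightarrow> g \<in> carrier G \<Longrightarrow> h \<in> carrier G \<Longrightarrow> act x (g \<otimes> h) = act (act x g) h"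
  using action by (auto simp: right_action_def)

text \<open>
  Take the uniform distribution on \<open>g\<^sup>j\<close> for \<open>\<bar>j\<bar> \<le> N\<close>.  Starting at \<open>x\<close>, the jump is uniform on a window of
  length \<open>2 * N + 1\<close> in an infinite orbit, which gives the spreading.  The window of a point of \<open>K\<close> is
  a translate of the window of \<open>p\<close> by at most \<open>M\<close>, which is negligible for large \<open>N\<close> and gives the merging.
  Up to at most \<open>M + D\<close> indices, one half of each window is inside \<open>A\<close> and the other half outside.
  Symmetry holds since \<open>j\<close> ranges over a symmetric interval.
\<close>

lemma exists_mixing:
  assumes K: "finite K" "K \<subseteq> X" and e: "e > 0"
  shows "\<exists>\<nu>. mixing K e \<nu>"
proof -
  obtain g and D0 :: int where g: "g \<in> carrier G"
    and inj: "\<And>x. x \<in> X \<Longrightarrow> inj (\<lambda>j::int. act x (g [^] j))"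
    and orbit: "\<forall>x\<in>K. \<exists>d::int. x = act p (g [^] d)"
    and D0: "\<And>j. j \<ge> D0 \<Longrightarrow> act p (g [^] (-j)) \<in> A \<and> act p (g [^] j) \<notin> A"
    using single_orbit[OF K] by blast
  from orbit obtain d :: "'x \<Rightarrow> int" where d: "\<And>x. x \<in> K \<Longrightarrow> x = act p (g [^] d x)" by metis
  define M where "M = (\<Sum>x\<in>K. \<bar>d x\<bar>)"
  have M: "\<bar>d x\<bar> \<le> M" if "x \<in> K" for x
    unfolding M_def using that K by (intro member_le_sum) auto
  have M0: "M \<ge> 0" by (auto simp: M_def sum_nonneg)
  define D where "D = \<bar>D0\<bar>"
  have D: "D \<ge> 0" "\<And>j. j \<ge> D \<Longrightarrow> act p (g [^] (-j)) \<in> A \<and> act p (g [^] j) \<notin> A"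
    using D0 by (auto simp: D_def)
  define a b where "a = 1 / e" and "b = 2 * real_of_int M / e"
  have ab: "a \<ge> 0" "b \<ge> 0" using e M0 by (auto simp: a_def b_def)
  obtain k l :: int where kl: "a \<le> of_int k" "b \<le> of_int l" using ex_le_of_int by metis
  define N where "N = k + l + 3 * (M + D)"
  have "real_of_int M \<ge> 0" "real_of_int D \<ge> 0" using M0 D(1) by simp_all
  moreover have "real_of_int N = real_of_int k + real_of_int l + 3 * (real_of_int M + real_of_int D)"
    by (simp add: N_def)
  ultimately have N': "a \<le> of_int N" "b \<le> of_int N" "real_of_int N \<ge> 3 * (real_of_int M + real_of_int D)" "real_of_int N \<ge> 0"
    using ab kl by simp_all
  from N'(1,2) have "1 \<le> of_int N * e" "2 * of_int M \<le> of_int N * e"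
    using e by (simp_all add: a_def b_def field_simps)
  moreover have "of_int N * e \<le> (2 * of_int N + 1) * e" using N'(4) e by (intro mult_right_mono) auto
  ultimately have "1 \<le> (2 * of_int N + 1) * e" "2 * of_int M \<le> (2 * of_int N + 1) * e" by linarith+
  then have N: "1 / (2 * of_int N + 1) \<le> e" "2 * of_int M / (2 * of_int N + 1) \<le> e" "N \<ge> 3 * (M + D)" "N \<ge> 0"
    using N'(3,4) by (simp_all add: divide_le_eq mult.commute)
  define \<nu> where "\<nu> = map_pmf (\<lambda>j::int. g [^] j) (pmf_of_set {-N..N})"
  have ne: "{-N..N} \<noteq> {}" "finite {-N..N}" using N(4) by auto
  have card: "real (card {-N..N}) = 2 * of_int N + 1" using N(4) by simp
  have step: "markov_op act \<nu> f x = (\<Sum>j\<in>{-N..N}. f (act x (g [^] j))) / (2 * of_int N + 1)" for f x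
    unfolding markov_op_def \<nu>_def integral_map_pmf using ne card by (subst integral_pmf_of_set) auto
  have shift: "act (act p (g [^] c)) (g [^] j) = act p (g [^] (c + j))" for c j :: int
    using g base by (simp add: int_pow_mult act_mult)
  have shiftx: "act x (g [^] j) = act p (g [^] (d x + j))" if "x \<in> K" for x and j :: int
    using d[OF that] shift by metis
  have inX: "act p (g [^] j) \<in> X" for j :: int using g base by (simp add: act_closed)
  have N1: "2 * real_of_int N + 1 > 0" using N(4) by simp
  have "mixing K e \<nu>"
    unfolding mixing_def spreads_def merges_def hits_both_sides_def
  proof (intro conjI allI impI ballI)
    show "finite (set_pmf \<nu>)" using ne by (simp add: \<nu>_def)
    show "set_pmf \<nu> \<subseteq> carrier G" using ne g by (auto simp: \<nu>_def)
    have "map_pmf (m_inv G) \<nu> = map_pmf (\<lambda>j. g [^] j) (map_pmf uminus (pmf_of_set {-N..N}))"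
      using g by (simp add: \<nu>_def pmf.map_comp o_def int_pow_neg)
    also have "map_pmf uminus (pmf_of_set {-N..N}) = pmf_of_set (uminus ` {-N..N})"
      using ne by (intro map_pmf_of_set_inj) (auto simp: inj_on_def)
    finally show "map_pmf (m_inv G) \<nu> = \<nu>" by (simp add: \<nu>_def)
  next
    fix u :: "'x \<Rightarrow> real" and x assume u: "\<forall>x\<in>X. 0 \<le> u x" "\<forall>Z. finite Z \<longrightarrow> Z \<subseteq> X \<longrightarrow> sum u Z \<le> 1" and x: "x \<in> X"
    have "(\<Sum>j\<in>{-N..N}. u (act x (g [^] j))) = sum u ((\<lambda>j. act x (g [^] j)) ` {-N..N})"
      using inj[OF x] by (subst sum.reindex) (auto simp: inj_on_def inj_def)
    also have "\<dots> \<le> 1"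
      using x g by (intro u(2)[rule_format]) (auto simp: act_closed)
    finally have "markov_op act \<nu> u x \<le> 1 / (2 * of_int N + 1)"
      unfolding step using N1 by (intro divide_right_mono) auto
    then show "markov_op act \<nu> u x \<le> e" using N(1) by linarith
  next
    fix f :: "'x \<Rightarrow> real" and C x assume f: "\<forall>x\<in>X. \<bar>f x\<bar> \<le> C" and x: "x \<in> K"
    have C: "C \<ge> 0" using f base by (smt (verit))
    have "\<bar>(\<Sum>j\<in>{-N..N}. f (act p (g [^] (d x + j)))) - (\<Sum>j\<in>{-N..N}. f (act p (g [^] j)))\<bar>
        \<le> 2 * \<bar>of_int (d x)\<bar> * C"
      by (rule sum_shift_diff[where F = "\<lambda>j. f (act p (g [^] j))"]) (use f inX in auto)
    also have "\<dots> \<le> 2 * of_int M * C" using M[OF x] C by (intro mult_right_mono) auto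
    finally have "\<bar>(\<Sum>j\<in>{-N..N}. f (act x (g [^] j))) - (\<Sum>j\<in>{-N..N}. f (act p (g [^] j)))\<bar> \<le> 2 * of_int M * C"
      unfolding shiftx[OF x] .
    then have "\<bar>markov_op act \<nu> f x - markov_op act \<nu> f p\<bar> \<le> 2 * of_int M * C / (2 * of_int N + 1)"
      unfolding step diff_divide_distrib[symmetric] abs_divide using N1 by (simp add: divide_right_mono)
    also have "\<dots> = C * (2 * of_int M / (2 * of_int N + 1))" by simp
    also have "\<dots> \<le> C * e" using N(2) C by (rule mult_left_mono)
    finally show "\<bar>markov_op act \<nu> f x - markov_op act \<nu> f p\<bar> \<le> C * e" .
  next
    fix B and q :: "'x \<Rightarrow> real" and C x
    assume B: "B \<in> {A, - A}" and q: "\<forall>x\<in>X. 0 \<le> q x \<and> q x \<le> C \<and> (x \<in> B \<longrightarrow> q x = 0)" and x: "x \<in> K"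
    have C: "C \<ge> 0" using q base by force
    \<comment> \<open>the indices at which the jump may fail to land in \<open>B\<close>\<close>
    define I where "I = (if B = A then {- D - d x + 1..N} else {- N..D - d x - 1})"
    have vanish: "q (act x (g [^] j)) = 0" if "j \<in> {-N..N} - I" for j
    proof -
      have "act p (g [^] (d x + j)) \<in> B"
      proof (cases "B = A")
        case True
        then have "- (d x + j) \<ge> D" using that by (auto simp: I_def)
        from D(2)[OF this] show ?thesis using True by (simp only: minus_minus)
      next
        case False
        then have "d x + j \<ge> D" using that by (auto simp: I_def)
        from D(2)[OF this] show ?thesis using False B by simp
      qed
      then show ?thesis using q inX shiftx[OF x] by metis
    qed
    have I: "finite I" "of_nat (card I) \<le> real_of_int (N + D + M)"
      using M[OF x] N D by (auto simp: I_def)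
    have "(\<Sum>j\<in>{-N..N}. q (act x (g [^] j))) = (\<Sum>j\<in>{-N..N} \<inter> I. q (act x (g [^] j)))"
      using vanish by (intro sum.mono_neutral_right) auto
    also have "\<dots> \<le> of_nat (card ({-N..N} \<inter> I)) * C"
      using q x K(2) g by (intro sum_bounded_above) (auto simp: act_closed subset_iff)
    also have "\<dots> \<le> of_nat (card I) * C"
      using C I(1) by (intro mult_right_mono of_nat_mono card_mono) auto
    also have "\<dots> \<le> of_int (N + D + M) * C" using I C by (intro mult_right_mono) auto
    also have "\<dots> \<le> (2/3 * (2 * of_int N + 1)) * C"
      using N(3) M0 D(1) C by (intro mult_right_mono) auto
    finally show "markov_op act \<nu> q x \<le> 2/3 * C"
      unfolding step using N1 by (simp add: divide_le_eq algebra_simps)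
  qed
  then show ?thesis by blast
qed

section \<open>A mixture of ever stronger mixing distributions\<close>

lemma mixing_mono:
  assumes "mixing K e \<nu>" "K' \<subseteq> K" "e \<le> e'"
  shows "mixing K' e' \<nu>"
proof -
  have *: "C * e \<le> C * e'" if "\<forall>x\<in>X. \<bar>f x\<bar> \<le> C" for f :: "'x \<Rightarrow> real" and C
  proof -
    have "0 \<le> C" using that base by force
    then show ?thesis using assms(3) by (rule mult_left_mono[rotated])
  qed
  have m: "spreads e \<nu>" "merges K e \<nu>" "hits_both_sides K \<nu>" using assms(1) by (auto simp: mixing_def)
  have "spreads e' \<nu>"
    unfolding spreads_def
  proof (intro allI impI ballI)
    fix u :: "'x \<Rightarrow> real" and x
    assume "\<forall>x\<in>X. 0 \<le> u x" "\<forall>Z. finite Z \<longrightarrow> Z \<subseteq> X \<longrightarrow> sum u Z \<le> 1" "x \<in> X"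
    then have "markov_op act \<nu> u x \<le> e" using spreadsD[OF m(1)] by blast
    then show "markov_op act \<nu> u x \<le> e'" using assms(3) by linarith
  qed
  moreover have "merges K' e' \<nu>"
    unfolding merges_def
  proof (intro allI impI ballI)
    fix f :: "'x \<Rightarrow> real" and C x assume f: "\<forall>x\<in>X. \<bar>f x\<bar> \<le> C" and "x \<in> K'"
    then have "x \<in> K" using assms(2) by blast
    from mergesD[OF m(2) f this] *[OF f]
    show "\<bar>markov_op act \<nu> f x - markov_op act \<nu> f p\<bar> \<le> C * e'" by linarith
  qed
  moreover have "hits_both_sides K' \<nu>"
    unfolding hits_both_sides_def
  proof (intro allI impI ballI)
    fix B and q :: "'x \<Rightarrow> real" and C x
    assume "B \<in> {A, - A}" "\<forall>x\<in>X. 0 \<le> q x \<and> q x \<le> C \<and> (x \<in> B \<longrightarrow> q x = 0)" "x \<in> K'"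
    then show "markov_op act \<nu> q x \<le> 2/3 * C" using hits_both_sidesD[OF m(3)] assms(2) by blast
  qed
  ultimately show ?thesis using assms(1) by (simp add: mixing_def)
qed

definition exhaustion :: "nat \<Rightarrow> 'x set" where
  "exhaustion m = from_nat_into X ` {..m}"

primrec reach :: "'a set \<Rightarrow> 'x set \<Rightarrow> nat \<Rightarrow> 'x set" where
  "reach B E 0 = E"
| "reach B E (Suc r) = reach B E r \<union> (\<lambda>(x, g). act x g) ` (reach B E r \<times> B)"

lemma exhaustion_finite: "finite (exhaustion m)" "exhaustion m \<subseteq> X"
  using base by (auto simp: exhaustion_def intro: from_nat_into)

lemma exhaustion_mono: "m \<le> n \<Longrightarrow> exhaustion m \<subseteq> exhaustion n"
  by (auto simp: exhaustion_def)

lemma exhaustion_covers: "x \<in> X \<Longrightarrow> \<exists>m. x \<in> exhaustion m"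
  unfolding exhaustion_def using countable_X from_nat_into_to_nat_on by (metis atMost_iff imageI order_refl)

lemma reach_finite: "finite B \<Longrightarrow> finite E \<Longrightarrow> finite (reach B E r)"
  by (induction r) auto

lemma reach_subset: "B \<subseteq> carrier G \<Longrightarrow> E \<subseteq> X \<Longrightarrow> reach B E r \<subseteq> X"
  by (induction r) (auto intro: act_closed)

lemma reach_mono:
  assumes "B \<subseteq> B'" "E \<subseteq> E'" "r \<le> r'"
  shows "reach B E r \<subseteq> reach B' E' r'"
proof -
  have "reach B E r \<subseteq> reach B' E' r" using assms(1,2) by (induction r) auto
  also have "\<dots> \<subseteq> reach B' E' r'" by (rule lift_Suc_mono_le[OF _ assms(3)]) simp
  finally show ?thesis .
qed

definition mix :: "'x set \<Rightarrow> real \<Rightarrow> 'a pmf" where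
  "mix K e = (SOME \<nu>. mixing K e \<nu>)"

lemma mixing_mix: "finite K \<Longrightarrow> K \<subseteq> X \<Longrightarrow> e > 0 \<Longrightarrow> mixing K e (mix K e)"
  unfolding mix_def using exists_mixing by (rule someI_ex)

text \<open>
  All jumps of index at most \<open>m\<close>.  The next distribution has to mix everything that these jumps reach within
  the time that the walk typically waits for a jump of larger index; therefore the jumps and the
  distributions are built in one recursion.
\<close>

primrec steps :: "nat \<Rightarrow> 'a set" where
  "steps 0 = insert \<one> (S \<union> m_inv G ` S)"
| "steps (Suc m) = steps m \<union>
     set_pmf (mix (reach (steps m) (exhaustion m) (4 ^ Suc m)) (1 / 16 ^ Suc m))"

definition target :: "nat \<Rightarrow> 'x set" where
  "target m = reach (steps m) (exhaustion m) (4 ^ Suc m)"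

primrec law :: "nat \<Rightarrow> 'a pmf" where
  "law 0 = pmf_of_set (steps 0)"
| "law (Suc m) = mix (target m) (1 / 16 ^ Suc m)"

definition mixture :: "'a pmf" where
  "mixture = bind_pmf (geometric_pmf (1/2)) law"

lemma steps_Suc: "steps (Suc m) = steps m \<union> set_pmf (law (Suc m))"
  by (simp add: target_def)

lemma S_facts: "finite S" "S \<subseteq> carrier G" "generate G S = carrier G"
  using gens by (auto simp: finite_generating_set_def)

lemma steps_finite_carrier: "finite (steps m) \<and> steps m \<subseteq> carrier G"
proof (induction m)
  case 0 then show ?case using S_facts by auto
next
  case (Suc m)
  then have "mixing (target m) (1 / 16 ^ Suc m) (law (Suc m))"
    unfolding law.simps target_def
    by (intro mixing_mix reach_finite reach_subset exhaustion_finite) auto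
  then show ?case using Suc unfolding steps_Suc by (auto simp: mixing_def)
qed

lemma target_facts: "finite (target m)" "target m \<subseteq> X"
  unfolding target_def using steps_finite_carrier exhaustion_finite
  by (blast intro: reach_finite, intro reach_subset) auto

lemma steps_mono: "m \<le> n \<Longrightarrow> steps m \<subseteq> steps n"
  by (rule lift_Suc_mono_le) auto

lemma law_support: "k \<le> m \<Longrightarrow> set_pmf (law k) \<subseteq> steps m"
proof -
  assume "k \<le> m"
  have "set_pmf (law k) \<subseteq> steps k"
    using steps_finite_carrier[of 0] by (cases k) (auto simp: target_def)
  then show ?thesis using steps_mono[OF \<open>k \<le> m\<close>] by blast
qed

lemma law_carrier: "set_pmf (law k) \<subseteq> carrier G"
  using law_support[of k k] steps_finite_carrier by blast

lemma law_mixing: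
  assumes "k > m"
  shows "mixing (target m) (1 / 16 ^ Suc m) (law k)"
proof -
  obtain n where n: "k = Suc n" "m \<le> n" using assms by (cases k) auto
  have "mixing (target n) (1 / 16 ^ Suc n) (law k)"
    unfolding n law.simps by (intro mixing_mix target_facts) auto
  moreover have "target m \<subseteq> target n"
    unfolding target_def using n(2) by (intro reach_mono steps_mono exhaustion_mono power_increasing) auto
  moreover have "(1::real) / 16 ^ Suc n \<le> 1 / 16 ^ Suc m"
    using n(2) by (intro divide_left_mono power_increasing) auto
  ultimately show ?thesis by (rule mixing_mono)
qed

lemma mixture_support: "set_pmf mixture \<subseteq> carrier G"
  using law_carrier by (auto simp: mixture_def)

lemma prob_measure_mixture: "prob_measure_on G mixture"
  using mixture_support by (simp add: prob_measure_on_def)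

lemma map_inv_law: "map_pmf (m_inv G) (law k) = law k"
proof (cases k)
  case 0
  have sub: "steps 0 \<subseteq> carrier G" and fin: "finite (steps 0)" using S_facts by auto
  have "(\<lambda>g. inv (inv g)) ` S = (\<lambda>g. g) ` S" using S_facts(2) by (intro image_cong) auto
  then have "m_inv G ` m_inv G ` S = S" by (simp add: image_image)
  then have "m_inv G ` steps 0 = steps 0" by (simp add: image_Un Un_commute)
  moreover have "inj_on (m_inv G) (steps 0)" using inv_inj sub by (rule inj_on_subset)
  ultimately show ?thesis using 0 fin map_pmf_of_set_inj[of "m_inv G" "steps 0"] by simp
next
  case (Suc n) then show ?thesis using law_mixing[of n k] by (simp add: mixing_def)
qed

lemma symmetric_mixture: "symmetric_measure G mixture"
  unfolding symmetric_measure_def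
proof
  fix g assume g: "g \<in> carrier G"
  have "map_pmf (m_inv G) mixture = mixture"
    by (simp add: mixture_def map_bind_pmf map_inv_law)
  then have "pmf mixture (inv g) = pmf (map_pmf (m_inv G) mixture) (inv g)" by simp
  also have "\<dots> = measure_pmf.prob mixture (m_inv G -` {inv g})" by (rule pmf_map)
  also have "\<dots> = measure_pmf.prob mixture {g}"
  proof (intro measure_pmf.finite_measure_eq_AE AE_pmfI)
    fix h assume "h \<in> set_pmf mixture"
    then have "h \<in> carrier G" using mixture_support by blast
    then have "inv h = inv g \<longleftrightarrow> h = g" using g by (metis inv_inv)
    then show "h \<in> m_inv G -` {inv g} \<longleftrightarrow> h \<in> {g}" by simp
  qed simp_all
  finally show "pmf mixture g = pmf mixture (inv g)" by (simp add: measure_pmf_single)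
qed

lemma non_degenerate_mixture: "non_degenerate G mixture"
  unfolding non_degenerate_def
proof
  have "set_pmf (law 0) \<subseteq> set_pmf mixture"
    by (auto simp: mixture_def set_pmf_geometric simp del: law.simps)
  moreover have "set_pmf (law 0) = steps 0" using S_facts(1) by (simp add: set_pmf_of_set)
  ultimately have sub: "\<And>h. h \<in> steps 0 \<Longrightarrow> h \<in> semigroup_generated G (set_pmf mixture)"
    by (blast intro: semigroup_generated.incl)
  show "carrier G \<subseteq> semigroup_generated G (set_pmf mixture)"
  proof
    fix g assume "g \<in> carrier G"
    then have "g \<in> generate G S" using S_facts by simp
    then show "g \<in> semigroup_generated G (set_pmf mixture)"
    proof induction
      case (eng h1 h2) then show ?case by (blast intro: semigroup_generated.mult)
    qed (use sub in auto)
  qed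
  show "semigroup_generated G (set_pmf mixture) \<subseteq> carrier G"
  proof
    fix g assume "g \<in> semigroup_generated G (set_pmf mixture)"
    then show "g \<in> carrier G" by induction (use mixture_support in auto)
  qed
qed


section \<open>Bounded harmonic functions and avoided sets\<close>

lemma markov_op_abs_le:
  assumes "\<forall>x\<in>X. \<bar>f x\<bar> \<le> C" "x \<in> X" "set_pmf \<nu> \<subseteq> carrier G"
  shows "\<bar>markov_op act \<nu> f x\<bar> \<le> C"
  unfolding markov_op_def using assms by (intro pmf_integral_abs_le) (auto simp: act_closed subset_iff)

lemma markov_op_diff:
  assumes "\<forall>x\<in>X. \<bar>f x\<bar> \<le> C" "x \<in> X" "y \<in> X" "set_pmf \<nu> \<subseteq> carrier G"
  shows "markov_op act \<nu> f x - markov_op act \<nu> f y = measure_pmf.expectation \<nu> (\<lambda>g. f (act x g) - f (act y g))"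
  unfolding markov_op_def using assms
  by (intro Bochner_Integration.integral_diff[symmetric] pmf_integrable_bounded[where C = C])
     (auto simp: act_closed subset_iff)

lemma markov_op_mixture:
  assumes "\<forall>x\<in>X. \<bar>f x\<bar> \<le> C" "x \<in> X"
  shows "markov_op act mixture f x = measure_pmf.expectation (geometric_pmf (1/2)) (\<lambda>k. markov_op act (law k) f x)"
  unfolding markov_op_def mixture_def using assms law_carrier
  by (intro pmf_integral_bind[where C = C]) (auto simp: act_closed subset_iff)

lemma markov_op_mixture_le:
  assumes "\<forall>x\<in>X. \<bar>f x\<bar> \<le> C" "x \<in> X"
    and "\<And>k. k \<le> m \<Longrightarrow> markov_op act (law k) f x \<le> a" "\<And>k. k > m \<Longrightarrow> markov_op act (law k) f x \<le> b"
  shows "markov_op act mixture f x \<le> (1 - 1 / 2 ^ Suc m) * a + (1 / 2 ^ Suc m) * b"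
  unfolding markov_op_mixture[OF assms(1,2)]
  by (rule geometric_split[where C = C]) (use assms markov_op_abs_le law_carrier in auto)

lemma reach_act: "x \<in> reach B E r \<Longrightarrow> g \<in> B \<Longrightarrow> act x g \<in> reach B E (Suc r)"
  by force

lemma reach_in_target:
  "r \<le> 4 ^ Suc m \<Longrightarrow> reach (steps m) (exhaustion m) r \<subseteq> target m"
  unfolding target_def by (rule reach_mono) auto

text \<open>
  Couple the walks from \<open>x\<close> and \<open>y\<close> by using the same jumps until the index first exceeds \<open>m\<close>.  If this
  happens within \<open>4 ^ (m + 1)\<close> steps, then both walks are still in the target set of the jump, which
  nearly merges them.
\<close>

lemma harmonic_oscillation:
  assumes f: "\<forall>x\<in>X. \<bar>f x\<bar> \<le> C" and harm: "\<forall>x\<in>X. f x = markov_op act mixture f x"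
    and xy: "x \<in> exhaustion m" "y \<in> exhaustion m"
  shows "f x - f y \<le> 4 * C / 2 ^ Suc m"
proof -
  let ?R = "reach (steps m) (exhaustion m)" and ?T = "1 / 2 ^ Suc m :: real"
  define \<Phi> where "\<Phi> r a \<longleftrightarrow> (\<forall>x\<in>?R r. \<forall>y\<in>?R r. f x - f y \<le> a)" for r and a :: real
  \<comment> \<open>the difference that remains after a merging jump, once for each of the two points\<close>
  define b where "b = 2 * C / 16 ^ Suc m"
  have C: "C \<ge> 0" using f base by force
  have RX: "?R r \<subseteq> X" for r using steps_finite_carrier exhaustion_finite by (intro reach_subset) auto
  have "\<Phi> r ((1 - ?T) * a + ?T * b)" if r: "r < 4 ^ Suc m" and a: "\<Phi> (Suc r) a" for r a
    unfolding \<Phi>_def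
  proof (intro ballI)
    fix x y assume x: "x \<in> ?R r" and y: "y \<in> ?R r"
    then have X: "x \<in> X" "y \<in> X" using RX by auto
    let ?psi = "\<lambda>k. markov_op act (law k) f x - markov_op act (law k) f y"
    have bounded: "\<bar>markov_op act (law k) f z\<bar> \<le> C" if "z \<in> X" for k z
      using f that law_carrier by (rule markov_op_abs_le)
    have "f x - f y = measure_pmf.expectation (geometric_pmf (1/2)) ?psi"
      using harm X markov_op_mixture[OF f] bounded
      by (subst Bochner_Integration.integral_diff) (auto intro!: pmf_integrable_bounded[where C = C])
    also have "\<dots> \<le> (1 - ?T) * a + ?T * b"
    proof (rule geometric_split)
      show "\<bar>?psi k\<bar> \<le> 2 * C" for k using bounded[OF X(1), of k] bounded[OF X(2), of k] by linarith
      show "?psi k \<le> a" if "k \<le> m" for k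
        unfolding markov_op_diff[OF f X law_carrier]
      proof (rule pmf_integral_le)
        fix g assume "g \<in> set_pmf (law k)"
        then have g: "g \<in> steps m" "g \<in> carrier G" using law_support[OF that] law_carrier by auto
        have "f (act x g) - f (act y g) \<le> a"
          using a reach_act[OF x g(1)] reach_act[OF y g(1)] unfolding \<Phi>_def by blast
        then show "f (act x g) - f (act y g) \<le> a" .
        have "\<bar>f (act x g)\<bar> \<le> C" "\<bar>f (act y g)\<bar> \<le> C" using f X g act_closed by auto
        then show "\<bar>f (act x g) - f (act y g)\<bar> \<le> 2 * C" by linarith
      qed
      show "?psi k \<le> b" if "k > m" for k
      proof -
        have "\<bar>markov_op act (law k) f z - markov_op act (law k) f p\<bar> \<le> C * (1 / 16 ^ Suc m)" if "z \<in> ?R r" for z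
          using law_mixing[OF \<open>k > m\<close>] that reach_in_target[of r m] r f
          by (intro mergesD[of "target m"]) (auto simp: mixing_def simp del: power_Suc)
        from this[OF x] this[OF y] show ?thesis by (simp add: b_def abs_le_iff)
      qed
    qed
    finally show "f x - f y \<le> (1 - ?T) * a + ?T * b" .
  qed
  moreover have "f x - f y \<le> 2 * C" if "x \<in> X" "y \<in> X" for x y
    using f[rule_format, OF that(1)] f[rule_format, OF that(2)] by linarith
  then have "\<Phi> (4 ^ Suc m) (2 * C)" unfolding \<Phi>_def using RX by blast
  ultimately have "\<Phi> 0 ((1 - ?T) ^ (4 ^ Suc m) * (2 * C - b) + b)" by (rule backward_iteration)
  then have "f x - f y \<le> (1 - ?T) ^ (4 ^ Suc m) * (2 * C - b) + b" using xy by (simp add: \<Phi>_def)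
  also have "\<dots> \<le> ?T * (2 * C) + 2 * C * ?T"
  proof (rule add_mono)
    have "b \<ge> 0" using C by (simp add: b_def)
    have "(1 - ?T) ^ (4 ^ Suc m) * (2 * C - b) \<le> (1 - ?T) ^ (4 ^ Suc m) * (2 * C)"
      using \<open>b \<ge> 0\<close> by (intro mult_left_mono zero_le_power) (auto simp del: power_Suc)
    also have "\<dots> \<le> ?T * (2 * C)" using late_jump_bound[of m] C by (intro mult_right_mono) auto
    finally show "(1 - ?T) ^ (4 ^ Suc m) * (2 * C - b) \<le> ?T * (2 * C)" .
    have "(1::real) / 16 ^ Suc m \<le> ?T" by (intro divide_left_mono power_mono) auto
    from mult_left_mono[OF this, of "2 * C"] show "b \<le> 2 * C * ?T" using C by (simp add: b_def)
  qed
  also have "\<dots> = 4 * C / 2 ^ Suc m" by simp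
  finally show ?thesis .
qed

lemma trivial_poisson_boundary_mixture: "trivial_poisson_boundary X act mixture"
  unfolding trivial_poisson_boundary_def
proof (intro allI impI)
  fix f assume "bounded_fun_on X f" and "harmonic_on X act mixture f"
  then obtain C where f: "\<forall>x\<in>X. \<bar>f x\<bar> \<le> C" and harm: "\<forall>x\<in>X. f x = markov_op act mixture f x"
    by (auto simp: bounded_fun_on_def harmonic_on_def kernel_def markov_op_def)
  have "f x - f y \<le> 0" if xy: "x \<in> X" "y \<in> X" for x y
  proof -
    obtain m1 m2 where m: "x \<in> exhaustion m1" "y \<in> exhaustion m2" using exhaustion_covers xy by blast
    show ?thesis
    proof (rule le_of_geometric_error[of "max m1 m2"])
      fix m assume "m \<ge> max m1 m2"
      then have "x \<in> exhaustion m" "y \<in> exhaustion m"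
        using m exhaustion_mono[of m1 m] exhaustion_mono[of m2 m] by auto
      from harmonic_oscillation[OF f harm this] show "f x - f y \<le> 0 + (4 * C) / 2 ^ Suc m" by simp
    qed
  qed
  then have "\<forall>x\<in>X. f x = f p" using base by (metis antisym diff_le_0_iff_le)
  then show "\<exists>c. \<forall>x\<in>X. f x = c" by blast
qed

text \<open>
  The function \<open>q\<close> is to be thought of as the probability never to hit \<open>B\<close>.  The first jump of index above
  \<open>m\<close> hits \<open>B\<close> with probability at least \<open>1/3\<close> if it comes in time, and otherwise the bound \<open>C\<close> is left.
\<close>

lemma avoidance_contraction:
  assumes B: "B \<in> {A, - A}"
    and q: "\<forall>x\<in>X. 0 \<le> q x \<and> q x \<le> C \<and> (x \<in> B \<longrightarrow> q x = 0)"
    and sub: "\<forall>x\<in>X. q x \<le> markov_op act mixture q x"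
    and x: "x \<in> X"
  shows "q x \<le> 2/3 * C"
proof -
  obtain m0 where m0: "x \<in> exhaustion m0" using exhaustion_covers x by blast
  have C: "C \<ge> 0" using q base by force
  have q': "\<forall>x\<in>X. \<bar>q x\<bar> \<le> C" using q by auto
  show ?thesis
  proof (rule le_of_geometric_error[of m0])
    fix m assume "m \<ge> m0"
    then have xm: "x \<in> exhaustion m" using m0 exhaustion_mono[of m0 m] by auto
    let ?R = "reach (steps m) (exhaustion m)" and ?T = "1 / 2 ^ Suc m :: real"
    have RX: "?R r \<subseteq> X" for r using steps_finite_carrier exhaustion_finite by (intro reach_subset) auto
    have "\<forall>x\<in>?R 0. q x \<le> (1 - ?T) ^ (4 ^ Suc m) * (C - 2/3 * C) + 2/3 * C"
    proof (rule backward_iteration[where \<Phi> = "\<lambda>r a. \<forall>x\<in>?R r. q x \<le> a"])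
      show "\<forall>x\<in>?R (4 ^ Suc m). q x \<le> C" using q RX by blast
    next
      fix r a assume r: "r < 4 ^ Suc m" and a: "\<forall>x\<in>?R (Suc r). q x \<le> a"
      show "\<forall>x\<in>?R r. q x \<le> (1 - ?T) * a + ?T * (2/3 * C)"
      proof
        fix x assume x: "x \<in> ?R r"
        then have X: "x \<in> X" using RX by auto
        have "q x \<le> markov_op act mixture q x" using sub X by blast
        also have "\<dots> \<le> (1 - ?T) * a + ?T * (2/3 * C)"
        proof (rule markov_op_mixture_le[OF q' X])
          show "markov_op act (law k) q x \<le> a" if "k \<le> m" for k
            unfolding markov_op_def
          proof (rule pmf_integral_le)
            fix g assume "g \<in> set_pmf (law k)"
            then have g: "g \<in> steps m" "g \<in> carrier G" using law_support[OF that] law_carrier by auto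
            show "q (act x g) \<le> a" using a reach_act[OF x g(1)] by blast
            show "\<bar>q (act x g)\<bar> \<le> C" using q' X g act_closed by auto
          qed
          show "markov_op act (law k) q x \<le> 2/3 * C" if "k > m" for k
            using law_mixing[OF that] B q x reach_in_target[of r m] r
            by (intro hits_both_sidesD[of "target m" _ B]) (auto simp: mixing_def simp del: power_Suc)
        qed
        finally show "q x \<le> (1 - ?T) * a + ?T * (2/3 * C)" .
      qed
    qed
    then have "q x \<le> (1 - ?T) ^ (4 ^ Suc m) * (C - 2/3 * C) + 2/3 * C" using xm by simp
    also have "\<dots> \<le> ?T * (C - 2/3 * C) + 2/3 * C"
      using late_jump_bound[of m] C by (intro add_right_mono mult_right_mono) auto
    finally show "q x \<le> 2/3 * C + (C - 2/3 * C) / 2 ^ Suc m" by simp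
  qed
qed

text \<open>
  Applied repeatedly, the contraction improves the bound to \<open>(2/3) ^ n\<close> for every \<open>n\<close>.
\<close>

lemma avoidance_vanishes:
  assumes B: "B \<in> {A, - A}"
    and q: "\<forall>x\<in>X. 0 \<le> q x \<and> q x \<le> 1 \<and> (x \<in> B \<longrightarrow> q x = 0)"
    and sub: "\<forall>x\<in>X. q x \<le> markov_op act mixture q x"
    and x: "x \<in> X"
  shows "q x = 0"
proof -
  have "\<forall>x\<in>X. q x \<le> (2/3) ^ n" for n
  proof (induction n)
    case 0 then show ?case using q by simp
  next
    case (Suc n)
    then have "\<forall>x\<in>X. 0 \<le> q x \<and> q x \<le> (2/3) ^ n \<and> (x \<in> B \<longrightarrow> q x = 0)" using q by blast
    from avoidance_contraction[OF B this sub] show ?case by simp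
  qed
  then have "q x \<le> (2/3) ^ n" for n using x by blast
  moreover have "(\<lambda>n. (2/3::real) ^ n) \<longlonglongrightarrow> 0" by (rule LIMSEQ_power_zero) simp
  ultimately have "q x \<le> 0" by (intro LIMSEQ_le_const) auto
  then show ?thesis using q x by force
qed


section \<open>Decay of the visit probabilities\<close>

text \<open>
  The probability to be at \<open>y\<close> after \<open>n\<close> steps, as a function of the starting point; the recursion
  conditions on the first jump.
\<close>

primrec visit :: "'x \<Rightarrow> nat \<Rightarrow> 'x \<Rightarrow> real" where
  "visit y 0 x = (if x = y then 1 else 0)"
| "visit y (Suc n) x = markov_op act mixture (visit y n) x"

lemma act_inj: "g \<in> carrier G \<Longrightarrow> inj_on (\<lambda>x. act x g) X"
  by (rule inj_on_inverseI[where g = "\<lambda>x. act x (inv g)"]) (simp add: act_mult[symmetric] act_one)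

lemma visit_bounds: "\<forall>x\<in>X. 0 \<le> visit y n x \<and> visit y n x \<le> 1"
proof (induction n)
  case (Suc n)
  then have b: "\<forall>x\<in>X. \<bar>visit y n x\<bar> \<le> 1" by auto
  show ?case
  proof
    fix x assume x: "x \<in> X"
    have "0 \<le> markov_op act mixture (visit y n) x"
      unfolding markov_op_def using Suc x mixture_support act_closed
      by (intro integral_nonneg_AE) (auto simp: AE_measure_pmf_iff subset_iff)
    then show "0 \<le> visit y (Suc n) x \<and> visit y (Suc n) x \<le> 1"
      using markov_op_abs_le[OF b x mixture_support] by simp
  qed
qed simp

text \<open>
  The counting measure on \<open>X\<close> is invariant, as every group element acts injectively.
\<close>

lemma visit_sum: "finite Z \<Longrightarrow> Z \<subseteq> X \<Longrightarrow> sum (visit y n) Z \<le> 1"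
proof (induction n arbitrary: Z)
  case 0 then show ?case by (simp add: sum.delta)
next
  case (Suc n)
  have b: "\<bar>visit y n (act z g)\<bar> \<le> 1" if "z \<in> Z" "g \<in> set_pmf mixture" for z g
    using visit_bounds[of y n] that Suc.prems mixture_support act_closed by (auto simp: subset_iff)
  have "sum (visit y (Suc n)) Z = measure_pmf.expectation mixture (\<lambda>g. \<Sum>z\<in>Z. visit y n (act z g))"
    using b by (simp add: markov_op_def Bochner_Integration.integral_sum pmf_integrable_bounded[of mixture _ 1])
  also have "\<dots> \<le> 1"
  proof (rule pmf_integral_le)
    fix g assume g: "g \<in> set_pmf mixture"
    then have gc: "g \<in> carrier G" using mixture_support by auto
    have "(\<Sum>z\<in>Z. visit y n (act z g)) = sum (visit y n) ((\<lambda>z. act z g) ` Z)"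
      using act_inj[OF gc] Suc.prems by (subst sum.reindex) (auto intro: inj_on_subset)
    also have "\<dots> \<le> 1" using Suc.prems gc by (intro Suc.IH) (auto simp: act_closed subset_iff)
    finally show le: "(\<Sum>z\<in>Z. visit y n (act z g)) \<le> 1" .
    have "0 \<le> (\<Sum>z\<in>Z. visit y n (act z g))"
      using visit_bounds[of y n] Suc.prems gc by (intro sum_nonneg) (auto simp: act_closed subset_iff)
    then show "\<bar>\<Sum>z\<in>Z. visit y n (act z g)\<bar> \<le> 1" using le by simp
  qed
  finally show ?case .
qed

text \<open>
  A jump of index above \<open>m\<close> spreads a function of total mass at most one down to \<open>1 / 16 ^ (m + 1)\<close>, and further
  averaging does not destroy this bound.
\<close>

lemma visit_decay:
  assumes "x \<in> X"
  shows "visit y n x \<le> (1 - 1 / 2 ^ Suc m) ^ n + 1 / 16 ^ Suc m"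
  using assms
proof (induction n arbitrary: x)
  case 0 then show ?case by simp
next
  case (Suc n)
  let ?T = "1 / 2 ^ Suc m :: real" and ?e = "1 / 16 ^ Suc m :: real"
  have b: "\<forall>x\<in>X. \<bar>visit y n x\<bar> \<le> 1" using visit_bounds[of y n] by auto
  have "visit y (Suc n) x \<le> (1 - ?T) * ((1 - ?T) ^ n + ?e) + ?T * ?e"
    unfolding visit.simps
  proof (rule markov_op_mixture_le[OF b Suc.prems])
    show "markov_op act (law k) (visit y n) x \<le> (1 - ?T) ^ n + ?e" if "k \<le> m" for k
      unfolding markov_op_def
      using Suc b law_carrier[of k] act_closed
      by (intro pmf_integral_le[where C = 1]) (auto simp: subset_iff simp del: power_Suc)
    show "markov_op act (law k) (visit y n) x \<le> ?e" if "k > m" for k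
      using law_mixing[OF that] visit_bounds[of y n] visit_sum Suc.prems
      by (intro spreadsD) (auto simp: mixing_def simp del: power_Suc)
  qed
  also have "(1 - T) * (z + e) + T * e = (1 - T) * z + e" for T e z :: real by (simp add: algebra_simps)
  then have "(1 - ?T) * ((1 - ?T) ^ n + ?e) + ?T * ?e = (1 - ?T) ^ Suc n + ?e" by (simp only: power_Suc)
  finally show ?case .
qed

lemma visit_summable: "x \<in> X \<Longrightarrow> summable (\<lambda>n. visit y n x)"
proof (rule summable_power_scales)
  assume x: "x \<in> X"
  show "0 \<le> visit y n x" for n using visit_bounds x by blast
  show "visit y n x \<le> (1 - 1 / 2 ^ Suc m) ^ n + 1 / 16 ^ Suc m" for n m by (rule visit_decay[OF x])
qed

section \<open>Trajectories: transience and ends\<close>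

abbreviation paths :: "(nat \<Rightarrow> 'a) measure" where
  "paths \<equiv> increments mixture"

text \<open>
  Multiplication need not be measurable for the product sigma-algebra of an uncountable discrete space.
  Replacing increments outside of the countable support by the identity changes nothing almost surely and
  turns the position into a measurable function of the path.
\<close>

definition increment_of :: "'a \<Rightarrow> 'a" where
  "increment_of g = (if g \<in> set_pmf mixture then g else \<one>)"

definition position :: "'x \<Rightarrow> (nat \<Rightarrow> 'a) \<Rightarrow> nat \<Rightarrow> 'x" where
  "position x h n = act x (walk G (increment_of \<circ> h) n)"

lemma paths_eq: "paths = (\<Pi>\<^sub>M i\<in>UNIV. measure_pmf mixture)"
  by (simp add: increments_def)

lemma sequence_space_mixture: "sequence_space (measure_pmf mixture)"
  by unfold_locales

lemma prob_space_paths: "prob_space paths"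
  unfolding paths_eq by (intro prob_space_PiM measure_pmf.prob_space_axioms)

lemma space_paths [simp]: "space paths = UNIV"
  by (simp add: paths_eq space_PiM)

lemma increment_of_carrier [simp]: "increment_of g \<in> carrier G"
  using mixture_support by (auto simp: increment_of_def)

lemma walk_carrier: "(\<And>i. h i \<in> carrier G) \<Longrightarrow> walk G h n \<in> carrier G"
  by (induction n) auto

lemma walk_shift:
  assumes "g \<in> carrier G" "\<And>i. h i \<in> carrier G"
  shows "walk G (case_nat g h) (Suc n) = g \<otimes> walk G h n"
  using assms by (induction n) (auto simp: m_assoc walk_carrier)

lemma position_0: "x \<in> X \<Longrightarrow> position x h 0 = x"
  by (simp add: position_def act_one)

lemma position_Suc:
  assumes "x \<in> X"
  shows "position x (case_nat g h) (Suc n) = position (act x (increment_of g)) h n"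
proof -
  have "increment_of \<circ> case_nat g h = case_nat (increment_of g) (increment_of \<circ> h)"
    by (auto simp: fun_eq_iff split: nat.split)
  then show ?thesis
    using assms walk_shift[of "increment_of g" "increment_of \<circ> h" n]
    by (simp add: position_def act_mult walk_carrier del: walk.simps)
qed

lemma walk_measurable:
  "(\<lambda>h. walk G (increment_of \<circ> h) n) \<in> measurable paths (count_space UNIV)"
proof (induction n)
  case 0 then show ?case by simp
next
  case (Suc n)
  have "countable (range increment_of)"
    by (rule countable_subset[of _ "insert \<one> (set_pmf mixture)"]) (auto simp: increment_of_def)
  moreover have "(\<lambda>h. h n) \<in> measurable paths (measure_pmf mixture)"
    unfolding paths_eq by (rule measurable_component_singleton) simp
  then have "(\<lambda>h. increment_of (h n)) \<in> measurable paths (count_space (range increment_of))"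
    by (rule measurable_compose) simp
  moreover have "(\<lambda>h. walk G (increment_of \<circ> h) n \<otimes> g) \<in> measurable paths (count_space UNIV)" for g
    using Suc by (rule measurable_compose) simp
  ultimately have "(\<lambda>h. walk G (increment_of \<circ> h) n \<otimes> increment_of (h n)) \<in> measurable paths (count_space UNIV)"
    by (intro measurable_compose_countable'[where I = "range increment_of"
          and f = "\<lambda>g h. walk G (increment_of \<circ> h) n \<otimes> g" and g = "\<lambda>h. increment_of (h n)"])
  then show ?case by (simp add: o_def)
qed

lemma position_pred: "Measurable.pred paths (\<lambda>h. P (position x h n))"
  unfolding position_def using walk_measurable by (rule measurable_compose) simp

lemma position_eq_walk: "AE h in paths. \<forall>n. position x h n = induced_walk G act x h n"
proof -
  have "AE h in paths. \<forall>i. h i \<in> set_pmf mixture"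
    unfolding AE_all_countable paths_eq
    by (intro allI AE_PiM_component[where P = "\<lambda>g. g \<in> set_pmf mixture"])
       (auto intro: measure_pmf.prob_space_axioms simp: AE_measure_pmf_iff)
  then show ?thesis
  proof eventually_elim
    case (elim h)
    then have "increment_of \<circ> h = h" by (auto simp: increment_of_def)
    then show ?case by (simp add: position_def induced_walk_def)
  qed
qed

text \<open>
  Conditioning on the first increment; the remaining increments have the law of the whole sequence.
\<close>

lemma first_step:
  assumes P: "Measurable.pred paths P"
  shows "measure paths {h. P h} =
    measure_pmf.expectation mixture (\<lambda>g. measure paths {h. P (case_nat g h)})"
proof -
  interpret S: sequence_space "measure_pmf mixture" by (rule sequence_space_mixture)
  interpret paths: prob_space paths by (rule prob_space_paths)
  have B: "{h. P h} \<in> sets paths" using P by (simp add: pred_def)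
  have m: "(\<lambda>(s, \<omega>). case_nat s \<omega>) \<in> measurable (measure_pmf mixture \<Otimes>\<^sub>M paths) paths"
    unfolding paths_eq by measurable
  let ?V = "(\<lambda>(s, \<omega>). case_nat s \<omega>) -` {h. P h} \<inter> space (measure_pmf mixture \<Otimes>\<^sub>M paths)"
  have V: "?V \<in> sets (measure_pmf mixture \<Otimes>\<^sub>M paths)" using m B by (rule measurable_sets)
  have "emeasure paths {h. P h} = emeasure (distr (measure_pmf mixture \<Otimes>\<^sub>M paths) paths (\<lambda>(s, \<omega>). case_nat s \<omega>)) {h. P h}"
    using S.PiM_iter unfolding paths_eq by simp
  also have "\<dots> = emeasure (measure_pmf mixture \<Otimes>\<^sub>M paths) ?V" by (rule emeasure_distr[OF m B])
  also have "\<dots> = (\<integral>\<^sup>+g. emeasure paths (Pair g -` ?V) \<partial>measure_pmf mixture)"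
    by (rule paths.emeasure_pair_measure_alt[OF V])
  also have "\<dots> = (\<integral>\<^sup>+g. ennreal (measure paths {h. P (case_nat g h)}) \<partial>measure_pmf mixture)"
    by (simp add: space_pair_measure vimage_def paths.emeasure_eq_measure)
  also have "\<dots> = ennreal (measure_pmf.expectation mixture (\<lambda>g. measure paths {h. P (case_nat g h)}))"
    by (intro nn_integral_eq_integral pmf_integrable_bounded[where C = 1]) auto
  finally show ?thesis
    by (simp add: paths.emeasure_eq_measure integral_nonneg_AE)
qed

lemma visit_probability:
  "x \<in> X \<Longrightarrow> measure paths {h. position x h n = y} = visit y n x"
proof (induction n arbitrary: x)
  case 0
  interpret paths: prob_space paths by (rule prob_space_paths)
  show ?case using 0 paths.prob_space by (simp add: position_0)
next
  case (Suc n)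
  have "measure paths {h. position x h (Suc n) = y} =
      measure_pmf.expectation mixture (\<lambda>g. measure paths {h. position x (case_nat g h) (Suc n) = y})"
    by (rule first_step[OF position_pred])
  also have "\<dots> = measure_pmf.expectation mixture (\<lambda>g. visit y n (act x g))"
    using Suc mixture_support
    by (intro integral_cong_AE AE_pmfI) (auto simp: position_Suc act_closed increment_of_def subset_iff)
  finally show ?case by (simp add: markov_op_def)
qed

lemma transient_mixture: "transient_walk G X act mixture"
  unfolding transient_walk_def
proof (intro ballI)
  fix x y assume x: "x \<in> X" and "y \<in> X"
  interpret paths: prob_space paths by (rule prob_space_paths)
  have "AE h in paths. eventually (\<lambda>n. h \<in> space paths - {h. position x h n = y}) sequentially"
  proof (rule borel_cantelli_AE1)
    show "{h. position x h n = y} \<in> sets paths" for n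
      using position_pred[of "\<lambda>z. z = y" x n] by (simp add: pred_def)
    show "summable (\<lambda>n. measure paths {h. position x h n = y})"
      using visit_summable[OF x] by (simp add: visit_probability[OF x])
  qed (simp add: paths.emeasure_eq_measure)
  then show "AE h in paths. finite {n. induced_walk G act x h n = y}"
    using position_eq_walk[of x]
  proof eventually_elim
    case (elim h)
    then have "eventually (\<lambda>n. \<not> induced_walk G act x h n = y) sequentially" by simp
    then obtain N where "\<And>n. n \<ge> N \<Longrightarrow> induced_walk G act x h n \<noteq> y"
      by (auto simp: eventually_sequentially)
    then have "{n. induced_walk G act x h n = y} \<subseteq> {..<N}" by (metis (mono_tags) lessThan_iff mem_Collect_eq not_le subsetI)
    then show ?case by (rule finite_subset) simp
  qed
qed

text \<open>
  For \<open>n = 0\<close> the probability of avoiding \<open>B\<close> satisfies the inequality of \<open>avoidance_vanishes\<close> by conditioning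
  on the first jump.  Since this holds for all starting points, avoiding \<open>B\<close> after time \<open>n\<close> has probability
  zero as well.
\<close>

lemma avoidance_null:
  assumes B: "B \<in> {A, - A}" and x: "x \<in> X"
  shows "measure paths {h. \<forall>k\<ge>n. position x h k \<notin> B} = 0"
  using x
proof (induction n arbitrary: x)
  case 0
  interpret paths: prob_space paths by (rule prob_space_paths)
  define q where "q x = measure paths {h. \<forall>k. position x h k \<notin> B}" for x
  have pred: "Measurable.pred paths (\<lambda>h. \<forall>k. position x h k \<notin> B)" for x
    using position_pred[of "\<lambda>z. z \<notin> B" x] by measurable
  have "\<forall>x\<in>X. 0 \<le> q x \<and> q x \<le> 1 \<and> (x \<in> B \<longrightarrow> q x = 0)"
  proof (intro ballI conjI impI)
    fix x assume "x \<in> X" "x \<in> B"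
    then have none: "{h. \<forall>k. position x h k \<notin> B} = {}" using position_0[of x] by (metis (mono_tags, lifting) Collect_empty_eq)
    show "q x = 0" unfolding q_def none by simp
  qed (auto simp: q_def)
  moreover have "\<forall>x\<in>X. q x \<le> markov_op act mixture q x"
  proof
    fix x assume x: "x \<in> X"
    have "q x = measure_pmf.expectation mixture (\<lambda>g. measure paths {h. \<forall>k. position x (case_nat g h) k \<notin> B})"
      unfolding q_def by (rule first_step[OF pred])
    also have "\<dots> \<le> measure_pmf.expectation mixture (\<lambda>g. q (act x g))"
    proof (rule pmf_integral_mono)
      fix g assume "g \<in> set_pmf mixture"
      then have "{h. \<forall>k. position x (case_nat g h) k \<notin> B} \<subseteq> {h. \<forall>k. position (act x g) h k \<notin> B}"
        using position_Suc[OF x, of g] by (auto simp: increment_of_def) (metis position_Suc[OF x])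
      then show "measure paths {h. \<forall>k. position x (case_nat g h) k \<notin> B} \<le> q (act x g)"
        unfolding q_def using pred[of "act x g"] by (intro paths.finite_measure_mono) (auto simp: pred_def)
      show "\<bar>measure paths {h. \<forall>k. position x (case_nat g h) k \<notin> B}\<bar> \<le> 1" by simp
      show "\<bar>q (act x g)\<bar> \<le> 1" by (simp add: q_def)
    qed
    finally show "q x \<le> markov_op act mixture q x" by (simp add: markov_op_def)
  qed
  ultimately have "q x = 0" using avoidance_vanishes[OF B] 0 by blast
  then show ?case by (simp add: q_def)
next
  case (Suc n)
  have pred: "Measurable.pred paths (\<lambda>h. \<forall>k\<ge>Suc n. position x h k \<notin> B)"
    using position_pred[of "\<lambda>z. z \<notin> B" x] by measurable
  have "measure paths {h. \<forall>k\<ge>Suc n. position x h k \<notin> B} =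
      measure_pmf.expectation mixture (\<lambda>g. measure paths {h. \<forall>k\<ge>Suc n. position x (case_nat g h) k \<notin> B})"
    by (rule first_step[OF pred])
  also have "\<dots> = measure_pmf.expectation mixture (\<lambda>g. 0)"
  proof (intro integral_cong_AE AE_pmfI)
    fix g
    have "(\<forall>k\<ge>Suc n. position x (case_nat g h) k \<notin> B) \<longleftrightarrow>
        (\<forall>k\<ge>n. position (act x (increment_of g)) h k \<notin> B)" for h
      using position_Suc[OF Suc.prems, of g h] by (metis Suc_le_D Suc_le_mono)
    then show "measure paths {h. \<forall>k\<ge>Suc n. position x (case_nat g h) k \<notin> B} = 0"
      using Suc by (simp add: act_closed)
  qed simp_all
  finally show ?case by simp
qed

lemma visits_infinitely_often:
  assumes B: "B \<in> {A, - A}" and x: "x \<in> X"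
  shows "AE h in paths. \<forall>n. \<exists>k\<ge>n. position x h k \<in> B"
  unfolding AE_all_countable
proof
  fix n
  interpret paths: prob_space paths by (rule prob_space_paths)
  have "Measurable.pred paths (\<lambda>h. \<forall>k\<ge>n. position x h k \<notin> B)"
    using position_pred[of "\<lambda>z. z \<notin> B" x] by measurable
  then have "{h. \<forall>k\<ge>n. position x h k \<notin> B} \<in> null_sets paths"
    using avoidance_null[OF B x, of n] by (auto simp: null_sets_def paths.emeasure_eq_measure pred_def)
  from AE_not_in[OF this] show "AE h in paths. \<exists>k\<ge>n. position x h k \<in> B" by simp
qed

text \<open>
  Every edge from \<open>A\<close> to its complement has an endpoint in \<open>K\<close>.
\<close>

lemma component_on_one_side:
  assumes K: "\<And>x s. x \<in> X - K \<Longrightarrow> s \<in> S' \<Longrightarrow> x \<in> A \<longleftrightarrow> act x s \<in> A"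
    and U: "U \<in> components_outside X act S' K"
  shows "U \<subseteq> A \<or> U \<subseteq> - A"
proof -
  let ?V = "X - K" and ?E = "schreier_adj X act S' \<inter> (X - K) \<times> (X - K)"
  have same: "a \<in> A \<longleftrightarrow> b \<in> A" if "(a, b) \<in> ?E\<^sup>*" for a b
    using that
  proof induction
    case (step b c)
    then show ?case using K by (auto simp: schreier_adj_def)
  qed simp
  obtain v where "U = {(x, y). x \<in> ?V \<and> y \<in> ?V \<and> (x, y) \<in> ?E\<^sup>*} `` {v}"
    using U unfolding components_outside_def Let_def by (auto elim: quotientE)
  then show ?thesis using same by blast
qed

text \<open>
  The finite set \<open>K\<close> of points that some generator moves across the boundary of \<open>A\<close> separates \<open>A\<close> from its
  complement, while the walk is on either side infinitely often.
\<close>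

lemma no_convergence_to_ends:
  assumes S': "finite_generating_set G S'" and x: "x \<in> X"
  shows "\<not> walk_converges_to_ends G X act S' mixture x"
proof
  assume "walk_converges_to_ends G X act S' mixture x"
  then have conv: "AE h in paths. \<exists>U\<in>ends X act S'. converges_to_end X (induced_walk G act x h) U"
    by (simp add: walk_converges_to_ends_def)
  interpret paths: prob_space paths by (rule prob_space_paths)
  have S'f: "finite S'" "S' \<subseteq> carrier G" using S' by (auto simp: finite_generating_set_def)
  define K where "K = (\<Union>s\<in>S'. {x \<in> X. (x \<in> A) \<noteq> (act x s \<in> A)})"
  have K: "finite K" "K \<subseteq> X" unfolding K_def using S'f almost_invariant by auto
  have "AE h in paths. False"
    using conv position_eq_walk[of x] visits_infinitely_often[of A, OF _ x, simplified]
      visits_infinitely_often[of "- A", OF _ x, simplified]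
  proof eventually_elim
    case (elim h)
    have "position x h = induced_walk G act x h" using elim(2) by (simp add: fun_eq_iff)
    then obtain U where U: "U \<in> ends X act S'" "converges_to_end X (position x h) U" using elim(1) by auto
    then have "U K \<in> components_outside X act S' K" using K by (auto simp: ends_def)
    then have "U K \<subseteq> A \<or> U K \<subseteq> - A" by (rule component_on_one_side[rotated]) (auto simp: K_def)
    moreover have "\<forall>\<^sub>F n in sequentially. position x h n \<in> U K"
      using U(2) K by (simp add: converges_to_end_def)
    then obtain N where N: "\<And>n. n \<ge> N \<Longrightarrow> position x h n \<in> U K" by (auto simp: eventually_sequentially)
    moreover obtain k l where "k \<ge> N" "position x h k \<in> A" "l \<ge> N" "position x h l \<notin> A"
      using elim by blast
    ultimately show False by blast
  qed
  then show False by simp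
qed

theorem exists_liouville_nonconvergent_measure:
  "\<exists>\<mu>. prob_measure_on G \<mu> \<and> symmetric_measure G \<mu> \<and> non_degenerate G \<mu> \<and>
     trivial_poisson_boundary X act \<mu> \<and> transient_walk G X act \<mu> \<and>
     (\<forall>S x. finite_generating_set G S \<longrightarrow> x \<in> X \<longrightarrow> \<not> walk_converges_to_ends G X act S \<mu> x)"
  using prob_measure_mixture symmetric_mixture non_degenerate_mixture trivial_poisson_boundary_mixture
    transient_mixture no_convergence_to_ends by blast

end

section \<open>The walk on the dyadic points\<close>

lemma spreading_thompson_F:
  "spreading_action thompson_F dyadic_points thompson_act (1/2) halving_ray thompson_gens"
proof -
  interpret group thompson_F by (rule group_thompson_F)
  show ?thesis
  proof
    show "countable dyadic_points" unfolding dyadic_points_def using countable_dyadics by blast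
    show "1/2 \<in> dyadic_points" using dyadics_basic(3)[of 1 1] by (simp add: dyadic_points_def)
    show "finite_generating_set thompson_F thompson_gens"
      unfolding finite_generating_set_def
      using thompson_F_generated thompson_x_in_F by (simp add: thompson_F_simps)
  qed (use thompson_F_acts dyadic_points_in_one_orbit halving_ray_almost_invariant in auto)
qed

theorem corollary1p4:
  shows
    "(\<exists>(G :: (real \<Rightarrow> real) monoid) (X :: real set) (act :: real \<Rightarrow> (real \<Rightarrow> real) \<Rightarrow> real)
        (\<mu> :: (real \<Rightarrow> real) pmf).
        finitely_generated_group G \<and> right_action G X act \<and>
        prob_measure_on G \<mu> \<and> symmetric_measure G \<mu> \<and> non_degenerate G \<mu> \<and>
        amenable_action G X act \<and> transitive_action G X act \<and>
        transient_walk G X act \<mu> \<and>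
        (\<forall>S x\<^sub>0. finite_generating_set G S \<longrightarrow> x\<^sub>0 \<in> X \<longrightarrow>
           \<not> walk_converges_to_ends G X act S \<mu> x\<^sub>0))
     \<and>
     (finitely_generated_group thompson_F \<and>
      right_action thompson_F dyadic_points thompson_act \<and>
      amenable_action thompson_F dyadic_points thompson_act \<and>
      transitive_action thompson_F dyadic_points thompson_act \<and>
      (\<exists>\<mu> :: (real \<Rightarrow> real) pmf.
        prob_measure_on thompson_F \<mu> \<and> symmetric_measure thompson_F \<mu> \<and>
        non_degenerate thompson_F \<mu> \<and>
        trivial_poisson_boundary dyadic_points thompson_act \<mu> \<and>
        transient_walk thompson_F dyadic_points thompson_act \<mu> \<and>
        (\<forall>S x\<^sub>0. finite_generating_set thompson_F S \<longrightarrow> x\<^sub>0 \<in> dyadic_points \<longrightarrow>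
           \<not> walk_converges_to_ends thompson_F dyadic_points thompson_act S \<mu> x\<^sub>0)))"
proof -
  obtain \<mu> :: "(real \<Rightarrow> real) pmf" where \<mu>: "prob_measure_on thompson_F \<mu>" "symmetric_measure thompson_F \<mu>"
    "non_degenerate thompson_F \<mu>" "trivial_poisson_boundary dyadic_points thompson_act \<mu>"
    "transient_walk thompson_F dyadic_points thompson_act \<mu>"
    "\<forall>S x\<^sub>0. finite_generating_set thompson_F S \<longrightarrow> x\<^sub>0 \<in> dyadic_points \<longrightarrow>
       \<not> walk_converges_to_ends thompson_F dyadic_points thompson_act S \<mu> x\<^sub>0"
    using spreading_action.exists_liouville_nonconvergent_measure[OF spreading_thompson_F] by blast
  note action = finitely_generated_thompson_F thompson_F_acts amenable_thompson_F transitive_thompson_F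
  show ?thesis
    using \<mu> action by blast
qed

end
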